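(* Let $m\ge 1$ be an integer and let $V$ be a finite-dimensional complex vector space with $\dim V\ge 2m$. Then $S_{((2m+2)^{2m-1},2)}V$ occurs in $S^{2m}(S^{2m+1}V)$ with multiplicity $1$, and $((2m+2)^{2m-1},2)$ is the smallest partition, with respect to the lexicographic order, among all partitions $\lambda$ such that $S_\lambda V$ occurs in the decomposition of $S^{2m}(S^{2m+1}V)$ into irreducible $GL(V)$-modules.
   Context: For a partition $\lambda$, $S_\lambda V$ is the irreducible polynomial $GL(V)$-module of highest weight $\lambda$. $S^k(S^dV)$ carries the induced $GL(V)$-action. Exponents denote repeated parts: $((2m+2)^{2m-1},2)$ has $2m-1$ parts equal to $2m+2$ followed by one part equal to $2$. Lexicographic order on partitions (padded with zeros): $\lambda>\mu$ if the first nonvanishing $\lambda_i-\mu_i$ is positive. *)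

theory Defs
  imports Complex_Main "HOL-Library.Function_Algebras"
begin

section \<open>Partitions\<close>

definition is_partition :: "nat list \<Rightarrow> bool" where
  "is_partition lam \<longleftrightarrow> sorted_wrt (\<ge>) lam \<and> 0 \<notin> set lam"

text \<open>Zero-based; the list of parts is padded with zeros.\<close>

definition padded_part :: "nat list \<Rightarrow> nat \<Rightarrow> nat" where
  "padded_part lam i = (if i < length lam then lam ! i else 0)"

definition lex_less :: "nat list \<Rightarrow> nat list \<Rightarrow> bool" where
  "lex_less mu lam \<longleftrightarrow>
     (\<exists>i. (\<forall>j<i. padded_part mu j = padded_part lam j) \<and> padded_part mu i < padded_part lam i)"


section \<open>Modules over the general linear group\<close>

text \<open>
  The space \<open>V\<close> is a type with scalar multiplication \<open>s\<close>.  A module is a subset \<open>W\<close> of a type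
  with scalar multiplication \<open>t\<close>, acted on through \<open>\<rho>\<close>; only the values of \<open>\<rho> g\<close> on \<open>W\<close>,
  for \<open>g\<close> in the general linear group, matter.
\<close>

definition GL :: "(complex \<Rightarrow> 'v \<Rightarrow> 'v::ab_group_add) \<Rightarrow> ('v \<Rightarrow> 'v) set" where
  "GL s = {g. Vector_Spaces.linear s s g \<and> bij g}"

definition GL_module ::
  "(complex \<Rightarrow> 'v \<Rightarrow> 'v::ab_group_add) \<Rightarrow> (complex \<Rightarrow> 'w \<Rightarrow> 'w::ab_group_add)
    \<Rightarrow> (('v \<Rightarrow> 'v) \<Rightarrow> 'w \<Rightarrow> 'w) \<Rightarrow> 'w set \<Rightarrow> bool" where
  "GL_module s t \<rho> W \<longleftrightarrow>
     module.subspace t W \<and>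
     (\<forall>g\<in>GL s. \<forall>x\<in>W. \<rho> g x \<in> W) \<and>
     (\<forall>g\<in>GL s. \<forall>x\<in>W. \<forall>y\<in>W. \<rho> g (x + y) = \<rho> g x + \<rho> g y) \<and>
     (\<forall>g\<in>GL s. \<forall>c. \<forall>x\<in>W. \<rho> g (t c x) = t c (\<rho> g x)) \<and>
     (\<forall>x\<in>W. \<rho> id x = x) \<and>
     (\<forall>g\<in>GL s. \<forall>h\<in>GL s. \<forall>x\<in>W. \<rho> (g \<circ> h) x = \<rho> g (\<rho> h x))"

definition GL_irreducible ::
  "(complex \<Rightarrow> 'v \<Rightarrow> 'v::ab_group_add) \<Rightarrow> (complex \<Rightarrow> 'w \<Rightarrow> 'w::ab_group_add)
    \<Rightarrow> (('v \<Rightarrow> 'v) \<Rightarrow> 'w \<Rightarrow> 'w) \<Rightarrow> 'w set \<Rightarrow> bool" where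
  "GL_irreducible s t \<rho> W \<longleftrightarrow>
     GL_module s t \<rho> W \<and> W \<noteq> {0} \<and>
     (\<forall>N. GL_module s t \<rho> N \<and> N \<subseteq> W \<longrightarrow> N = {0} \<or> N = W)"

text \<open>Polynomials in the matrix entries of an endomorphism of \<open>V\<close>.\<close>

inductive_set poly_funs ::
  "(complex \<Rightarrow> 'v \<Rightarrow> 'v::ab_group_add) \<Rightarrow> (('v \<Rightarrow> 'v) \<Rightarrow> complex) set"
  for s :: "complex \<Rightarrow> 'v \<Rightarrow> 'v" where
  const: "(\<lambda>g. c) \<in> poly_funs s"
| entry: "Vector_Spaces.linear s (*) \<alpha> \<Longrightarrow> (\<lambda>g. \<alpha> (g v)) \<in> poly_funs s"
| add: "p \<in> poly_funs s \<Longrightarrow> q \<in> poly_funs s \<Longrightarrow> (\<lambda>g. p g + q g) \<in> poly_funs s"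
| mult: "p \<in> poly_funs s \<Longrightarrow> q \<in> poly_funs s \<Longrightarrow> (\<lambda>g. p g * q g) \<in> poly_funs s"

text \<open>
  Every linear form on the subspace \<open>W\<close> extends to the ambient type, so it is enough to let
  \<open>\<phi>\<close> range over linear forms on the latter.
\<close>

definition polynomial_GL_module ::
  "(complex \<Rightarrow> 'v \<Rightarrow> 'v::ab_group_add) \<Rightarrow> (complex \<Rightarrow> 'w \<Rightarrow> 'w::ab_group_add)
    \<Rightarrow> (('v \<Rightarrow> 'v) \<Rightarrow> 'w \<Rightarrow> 'w) \<Rightarrow> 'w set \<Rightarrow> bool" where
  "polynomial_GL_module s t \<rho> W \<longleftrightarrow>
     GL_module s t \<rho> W \<and>
     (\<exists>B. finite B \<and> module.span t B = W) \<and>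
     (\<forall>x\<in>W. \<forall>\<phi>. Vector_Spaces.linear t (*) \<phi> \<longrightarrow>
        (\<exists>p\<in>poly_funs s. \<forall>g\<in>GL s. \<phi> (\<rho> g x) = p g))"

definition ordered_basis :: "(complex \<Rightarrow> 'v \<Rightarrow> 'v::ab_group_add) \<Rightarrow> 'v list \<Rightarrow> bool" where
  "ordered_basis s es \<longleftrightarrow>
     distinct es \<and> \<not> module.dependent s (set es) \<and> module.span s (set es) = UNIV"

text \<open>
  With respect to the ordered basis \<open>es\<close>: \<open>x\<close> is nonzero, fixed by all upper unitriangular
  matrices, and \<open>diag(c 0, c 1, ...)\<close> acts on it by the character with exponents \<open>lam\<close>.
\<close>

definition highest_weight_vector ::
  "(complex \<Rightarrow> 'v \<Rightarrow> 'v::ab_group_add) \<Rightarrow> (complex \<Rightarrow> 'w \<Rightarrow> 'w::ab_group_add)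
    \<Rightarrow> (('v \<Rightarrow> 'v) \<Rightarrow> 'w \<Rightarrow> 'w) \<Rightarrow> 'v list \<Rightarrow> nat list \<Rightarrow> 'w \<Rightarrow> bool" where
  "highest_weight_vector s t \<rho> es lam x \<longleftrightarrow>
     x \<noteq> 0 \<and>
     (\<forall>g\<in>GL s. (\<forall>j<length es. g (es ! j) - es ! j \<in> module.span s (set (take j es)))
        \<longrightarrow> \<rho> g x = x) \<and>
     (\<forall>g\<in>GL s. \<forall>c. (\<forall>i<length es. g (es ! i) = s (c i) (es ! i))
        \<longrightarrow> \<rho> g x = t (\<Prod>i<length es. c i ^ padded_part lam i) x)"

text \<open>
  \<open>is_Schur_module s t \<rho> lam W\<close> says that \<open>W\<close> is (a copy of) \<open>S\<^sub>\<lambda> V\<close>, the irreducible polynomial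
  module of highest weight \<open>\<lambda>\<close>, which is determined up to isomorphism.  The choice of the
  ordered basis is immaterial: the general linear group permutes the ordered bases transitively
  and carries highest weight vectors for one of them to highest weight vectors for another.
  A partition with more than \<open>dim V\<close> parts is not a weight (then \<open>S\<^sub>\<lambda> V = 0\<close>).
\<close>

definition is_Schur_module ::
  "(complex \<Rightarrow> 'v \<Rightarrow> 'v::ab_group_add) \<Rightarrow> (complex \<Rightarrow> 'w \<Rightarrow> 'w::ab_group_add)
    \<Rightarrow> (('v \<Rightarrow> 'v) \<Rightarrow> 'w \<Rightarrow> 'w) \<Rightarrow> nat list \<Rightarrow> 'w set \<Rightarrow> bool" where
  "is_Schur_module s t \<rho> lam W \<longleftrightarrow>
     polynomial_GL_module s t \<rho> W \<and> GL_irreducible s t \<rho> W \<and>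
     (\<exists>es. ordered_basis s es \<and> length lam \<le> length es \<and>
        (\<exists>x\<in>W. highest_weight_vector s t \<rho> es lam x))"

text \<open>
  \<open>D\<close> is the set of summands of a decomposition of \<open>M\<close> as an internal direct sum of irreducible
  submodules.  Summands are nonzero and independent, hence distinct as subsets even when they
  are isomorphic, so a set loses no multiplicities.
\<close>

definition irreducible_decomposition ::
  "(complex \<Rightarrow> 'v \<Rightarrow> 'v::ab_group_add) \<Rightarrow> (complex \<Rightarrow> 'w \<Rightarrow> 'w::ab_group_add)
    \<Rightarrow> (('v \<Rightarrow> 'v) \<Rightarrow> 'w \<Rightarrow> 'w) \<Rightarrow> 'w set \<Rightarrow> 'w set set \<Rightarrow> bool" where
  "irreducible_decomposition s t \<rho> M D \<longleftrightarrow>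
     finite D \<and> (\<forall>N\<in>D. GL_irreducible s t \<rho> N) \<and>
     module.span t (\<Union>D) = M \<and>
     (\<forall>f. (\<forall>N\<in>D. f N \<in> N) \<and> (\<Sum>N\<in>D. f N) = 0 \<longrightarrow> (\<forall>N\<in>D. f N = 0))"

definition occurs_in ::
  "(complex \<Rightarrow> 'v \<Rightarrow> 'v::ab_group_add) \<Rightarrow> (complex \<Rightarrow> 'w \<Rightarrow> 'w::ab_group_add)
    \<Rightarrow> (('v \<Rightarrow> 'v) \<Rightarrow> 'w \<Rightarrow> 'w) \<Rightarrow> 'w set \<Rightarrow> nat list \<Rightarrow> bool" where
  "occurs_in s t \<rho> M lam \<longleftrightarrow>
     (\<exists>D. irreducible_decomposition s t \<rho> M D \<and> (\<exists>N\<in>D. is_Schur_module s t \<rho> lam N))"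

text \<open>
  The first conjunct (complete reducibility) excludes vacuous truth; the second one asks for the
  same number of summands in every decomposition, so that the multiplicity is well defined.
\<close>

definition has_multiplicity ::
  "(complex \<Rightarrow> 'v \<Rightarrow> 'v::ab_group_add) \<Rightarrow> (complex \<Rightarrow> 'w \<Rightarrow> 'w::ab_group_add)
    \<Rightarrow> (('v \<Rightarrow> 'v) \<Rightarrow> 'w \<Rightarrow> 'w) \<Rightarrow> 'w set \<Rightarrow> nat list \<Rightarrow> nat \<Rightarrow> bool" where
  "has_multiplicity s t \<rho> M lam k \<longleftrightarrow>
     (\<exists>D. irreducible_decomposition s t \<rho> M D) \<and>
     (\<forall>D. irreducible_decomposition s t \<rho> M D
        \<longrightarrow> card {N \<in> D. is_Schur_module s t \<rho> lam N} = k)"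


section \<open>Symmetric powers\<close>

text \<open>
  \<open>S\<^sup>d W\<close> is realised as the space of homogeneous polynomials of degree \<open>d\<close> on the dual space:
  the product \<open>w\<^sub>1 \<cdots> w\<^sub>d\<close> is the function \<open>\<alpha> \<mapsto> \<alpha> w\<^sub>1 \<cdots> \<alpha> w\<^sub>d\<close> of a linear form \<open>\<alpha>\<close>.  HOL functions
  being total, it is given the value 0 at arguments that are not linear forms.  For a subspace
  \<open>W\<close> the forms are taken on the ambient space, which makes no difference, since every linear
  form on \<open>W\<close> extends.  Addition of functions is pointwise (\<open>Function_Algebras\<close>).
\<close>

definition fscale :: "complex \<Rightarrow> ('a \<Rightarrow> complex) \<Rightarrow> 'a \<Rightarrow> complex" where
  "fscale c f = (\<lambda>x. c * f x)"

definition sym_prod ::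
  "(complex \<Rightarrow> 'w \<Rightarrow> 'w::ab_group_add) \<Rightarrow> 'w list \<Rightarrow> ('w \<Rightarrow> complex) \<Rightarrow> complex" where
  "sym_prod t ws = (\<lambda>\<alpha>. if Vector_Spaces.linear t (*) \<alpha> then \<Prod>w\<leftarrow>ws. \<alpha> w else 0)"

definition Sym ::
  "(complex \<Rightarrow> 'w \<Rightarrow> 'w::ab_group_add) \<Rightarrow> nat \<Rightarrow> 'w set \<Rightarrow> (('w \<Rightarrow> complex) \<Rightarrow> complex) set" where
  "Sym t d W = module.span fscale {sym_prod t ws | ws. length ws = d \<and> set ws \<subseteq> W}"

text \<open>The map on symmetric powers induced by \<open>h\<close>; see \<open>Sym_map_sym_prod\<close> below.\<close>

definition Sym_map ::
  "('w \<Rightarrow> 'w) \<Rightarrow> (('w \<Rightarrow> complex) \<Rightarrow> complex) \<Rightarrow> ('w \<Rightarrow> complex) \<Rightarrow> complex" where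
  "Sym_map h F = (\<lambda>\<alpha>. F (\<alpha> \<circ> h))"

lemma vector_space_fscale: "vector_space fscale"
  by unfold_locales (auto simp: fscale_def fun_eq_iff algebra_simps)

lemma linear_Sym_map: "Vector_Spaces.linear fscale fscale (Sym_map h)"
proof -
  interpret vector_space fscale by (rule vector_space_fscale)
  show ?thesis
    by unfold_locales (auto simp: Sym_map_def fscale_def fun_eq_iff)
qed

lemma bij_Sym_map:
  assumes "bij h"
  shows "bij (Sym_map h)"
proof (rule o_bij)
  have "h \<circ> inv h = id" "inv h \<circ> h = id"
    using assms by (auto simp: bij_def surj_iff inj_iff)
  then show "Sym_map (inv h) \<circ> Sym_map h = id" "Sym_map h \<circ> Sym_map (inv h) = id"
    by (auto simp: Sym_map_def fun_eq_iff comp_def)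
qed

lemma GL_Sym_map: "h \<in> GL t \<Longrightarrow> Sym_map h \<in> GL fscale"
  by (simp add: GL_def linear_Sym_map bij_Sym_map)

lemma Sym_map_sym_prod:
  assumes h: "h \<in> GL t"
  shows "Sym_map h (sym_prod t ws) = sym_prod t (map h ws)"
proof -
  have lin: "Vector_Spaces.linear t t h" and bij: "bij h"
    using h by (auto simp: GL_def)
  have "Vector_Spaces.linear t (*) (\<alpha> \<circ> h) = Vector_Spaces.linear t (*) \<alpha>" for \<alpha>
  proof
    assume "Vector_Spaces.linear t (*) \<alpha>"
    with lin show "Vector_Spaces.linear t (*) (\<alpha> \<circ> h)" by (rule Vector_Spaces.linear_compose)
  next
    assume l: "Vector_Spaces.linear t (*) (\<alpha> \<circ> h)"
    interpret h: Vector_Spaces.linear t t h by (rule lin)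
    interpret l: Vector_Spaces.linear t "(*)" "\<alpha> \<circ> h" by (rule l)
    have ex: "\<exists>y. x = h y" for x using bij by (meson bij_pointE)
    show "Vector_Spaces.linear t (*) \<alpha>"
    proof unfold_locales
      show "\<alpha> (x + y) = \<alpha> x + \<alpha> y" for x y
        using ex [of x] ex [of y] l.add h.add by (metis comp_apply)
      show "\<alpha> (t c x) = c * \<alpha> x" for c x
        using ex [of x] l.scale h.scale by (metis comp_apply)
    qed
  qed
  then show ?thesis
    by (auto simp: Sym_map_def sym_prod_def fun_eq_iff comp_def)
qed

lemma Sym_map_Sym:
  assumes h: "h \<in> GL t" and W: "h ` W \<subseteq> W"
  shows "Sym_map h ` Sym t d W \<subseteq> Sym t d W"
proof -
  interpret V: vector_space "fscale :: complex \<Rightarrow> (('a \<Rightarrow> complex) \<Rightarrow> complex) \<Rightarrow> _"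
    by (rule vector_space_fscale)
  interpret L: Vector_Spaces.linear fscale fscale "Sym_map h" by (rule linear_Sym_map)
  let ?P = "{sym_prod t ws | ws. length ws = d \<and> set ws \<subseteq> W}"
  have "Sym_map h ` ?P \<subseteq> ?P"
  proof safe
    fix ws :: "'a list" assume "set ws \<subseteq> W" "d = length ws"
    then have "set (map h ws) \<subseteq> W" "length (map h ws) = length ws" using W by auto
    then show "\<exists>us. Sym_map h (sym_prod t ws) = sym_prod t us \<and> length us = length ws \<and> set us \<subseteq> W"
      using Sym_map_sym_prod [OF h] by blast
  qed
  then show ?thesis
    unfolding Sym_def L.span_image [symmetric] by (rule V.span_mono)
qed

lemma GL_module_Sym_Sym:
  "GL_module s fscale (\<lambda>g. Sym_map (Sym_map g)) (Sym fscale k (Sym s d UNIV))"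
proof -
  interpret vector_space fscale by (rule vector_space_fscale)
  have "Sym_map (Sym_map g) ` Sym fscale k (Sym s d UNIV) \<subseteq> Sym fscale k (Sym s d UNIV)"
    if "g \<in> GL s" for g
    using that by (intro Sym_map_Sym GL_Sym_map) auto
  then show ?thesis
    unfolding GL_module_def
    by (auto simp: image_subset_iff, auto simp: Sym_def Sym_map_def fscale_def fun_eq_iff comp_def)
qed

end

theory Submission
  imports Defs "HOL-Computational_Algebra.Polynomial" "HOL-Combinatorics.Permutations"
    "HOL-Library.FuncSet"
begin

text \<open>
  Put \<open>n = 2 * m\<close> and \<open>d = n + 1\<close>.  Polarization embeds \<open>S\<^sup>n (S\<^sup>d V)\<close> equivariantly into the
  polynomial functions of an \<open>n \<times> dim V\<close> matrix \<open>x\<close> that are homogeneous of degree \<open>d\<close> in every row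
  and symmetric in the rows.  A highest weight vector of weight \<open>\<mu>\<close> becomes a function \<open>f\<close> that is
  invariant under adding a column to a later one and homogeneous of degree \<open>\<mu> k\<close> in column \<open>k\<close>.

  The degree of such an \<open>f\<close> in a single row is at most \<open>\<mu> 0\<close>.  If \<open>\<mu> 0 \<le> n + 2 = d + 1\<close>, then the
  operator \<open>E i j\<close> that replaces one occurrence of row \<open>j\<close> by row \<open>i\<close> satisfies \<open>E i j\<^sup>2 f = 0\<close>.
  So \<open>f\<close> has only components of highest weight 0 and 2 for the \<open>sl\<^sub>2\<close> of the rows \<open>i\<close> and \<open>j\<close>;
  as \<open>d\<close> is odd, the exchange of the two rows is \<open>- 1\<close> on the former and \<open>1\<close> on the latter, and
  symmetry leaves \<open>E j i (E i j f) = 2 * f\<close>.  Hence the Casimir operator of the row action takes a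
  known value at \<open>f\<close>.  It agrees with that of the column action, whose value depends on \<open>\<mu>\<close> only and
  is maximal, among the weights with \<open>\<mu> 0 \<le> n + 2\<close>, exactly at \<open>((n + 2)\<^sup>n\<^sup>-\<^sup>1, 2)\<close>.  For this weight \<open>f\<close> is
  determined by one of its values, and \<open>det(x)\<^sup>2\<close> times the product of the maximal minors of the
  first \<open>n - 1\<close> columns is an example; it is symmetric because \<open>n\<close> is even.
\<close>

section \<open>Polynomial functions and partial derivatives\<close>

text \<open>The bound on \<open>\<mu> 0\<close> costs nothing: a first part above
  \<open>n + 2\<close> already makes a partition lexicographically larger than the target. Since
  \<open>n * (n + 1) = (n - 1) * (n + 2) + 2\<close>, the target is the greatest partition of
  \<open>n * (n + 1)\<close> in the dominance order among those with parts at most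
  \<open>n + 2\<close>. So its minimality means that every other member of this family has to be
  excluded. The Casimir value grows strictly along the dominance order; knowing it exactly, namely
  \<open>3 * n^2 - n\<close> from the row side, therefore excludes all of them at once. The sign
  rule for two rows: in the \<open>sl\<^sub>2\<close>-module of highest weight \<open>2 * k\<close>
  the Weyl element of \<open>SL\<^sub>2\<close> acts on the vector of weight 0 by
  \<open>(- 1)^k\<close>. The exchange of two rows is that element combined with a sign change of
  one row, which contributes \<open>(- 1)^d\<close>. For odd \<open>d\<close>, symmetry in the rows
  thus forces odd \<open>k\<close>; only \<open>k = 1\<close> remains, and the eigenvalue
  \<open>k * (k + 1)\<close> is the factor 2.\<close>

inductive_set polyfun :: "'i set \<Rightarrow> (('i \<Rightarrow> complex) \<Rightarrow> complex) set" for V where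
  const: "(\<lambda>x. c) \<in> polyfun V"
| var: "v \<in> V \<Longrightarrow> (\<lambda>x. x v) \<in> polyfun V"
| add: "p \<in> polyfun V \<Longrightarrow> q \<in> polyfun V \<Longrightarrow> (\<lambda>x. p x + q x) \<in> polyfun V"
| mult: "p \<in> polyfun V \<Longrightarrow> q \<in> polyfun V \<Longrightarrow> (\<lambda>x. p x * q x) \<in> polyfun V"

lemma polyfun_sum:
  assumes "\<And>k. k \<in> K \<Longrightarrow> p k \<in> polyfun V"
  shows "(\<lambda>x. \<Sum>k\<in>K. p k x) \<in> polyfun V"
  using assms
proof (induction K rule: infinite_finite_induct)
  case (insert k K)
  then show ?case by (auto intro: polyfun.add)
qed (auto intro: polyfun.const)

lemma polyfun_prod:
  assumes "\<And>k. k \<in> K \<Longrightarrow> p k \<in> polyfun V"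
  shows "(\<lambda>x. \<Prod>k\<in>K. p k x) \<in> polyfun V"
  using assms
proof (induction K rule: infinite_finite_induct)
  case (insert k K)
  then show ?case by (auto intro: polyfun.mult)
qed (auto intro: polyfun.const)

lemma polyfun_cmult: "p \<in> polyfun V \<Longrightarrow> (\<lambda>x. c * p x) \<in> polyfun V"
  by (intro polyfun.mult polyfun.const)

lemma polyfun_diff:
  assumes "p \<in> polyfun V" "q \<in> polyfun V"
  shows "(\<lambda>x. p x - q x) \<in> polyfun V"
proof -
  have "(\<lambda>x. p x + (- 1) * q x) \<in> polyfun V"
    by (intro polyfun.add polyfun_cmult assms)
  then show ?thesis by simp
qed

lemma polyfun_cong:
  assumes "p \<in> polyfun V" "\<And>v. v \<in> V \<Longrightarrow> x v = y v"
  shows "p x = p y"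
  using assms(1) by induction (auto simp: assms(2))

text \<open>Density arguments are run along a single polynomial curve, so that the finiteness of the
  roots of a univariate polynomial suffices.\<close>

lemma polyfun_curve:
  assumes "p \<in> polyfun V" and curve: "\<And>v. v \<in> V \<Longrightarrow> \<exists>Q. \<forall>t. \<gamma> t v = poly Q t"
  shows "\<exists>P. \<forall>t. p (\<gamma> t) = poly P t"
  using assms(1)
proof induction
  case (const c)
  show ?case by (rule exI [of _ "[:c:]"]) simp
next
  case (var v)
  then show ?case by (rule curve)
next
  case (add p q)
  then show ?case by (metis poly_add)
next
  case (mult p q)
  then show ?case by (metis poly_mult)
qed

lemma poly_zero_if_cofinite:
  fixes P :: "complex poly"
  assumes "finite T" "\<And>t. t \<notin> T \<Longrightarrow> poly P t = 0"
  shows "P = 0"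
proof (rule ccontr)
  assume "P \<noteq> 0"
  then have "finite {t. poly P t = 0}" by (rule poly_roots_finite)
  moreover have "UNIV = T \<union> {t. poly P t = 0}" using assms(2) by auto
  ultimately have "finite (UNIV :: complex set)" using assms(1) by (metis finite_Un)
  then show False using infinite_UNIV_char_0 by blast
qed

lemma polyfun_curve_zero:
  assumes "p \<in> polyfun V" "\<And>v. v \<in> V \<Longrightarrow> \<exists>Q. \<forall>t. \<gamma> t v = poly Q t"
    and "finite T" "\<And>t. t \<notin> T \<Longrightarrow> p (\<gamma> t) = 0"
  shows "p (\<gamma> t) = 0"
proof -
  obtain P where P: "\<And>t. p (\<gamma> t) = poly P t" using polyfun_curve [OF assms(1), of \<gamma>, OF assms(2)] by blast
  have "P = 0" using assms(3) by (rule poly_zero_if_cofinite) (use assms(4) P in auto)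
  then show ?thesis by (simp add: P)
qed

lemma poly_curve_var: "\<exists>Q. \<forall>t. (x(v := t)) u = poly Q (t :: complex)"
  by (cases "u = v") (auto intro: exI [of _ "[:0, 1:]"] exI [of _ "[:x u:]"])

text \<open>Permits assuming that a chosen entry avoids one value, in the applications 0, so that it
  can be divided by.\<close>

lemma polyfun_zero_var:
  assumes "p \<in> polyfun V" "\<And>t. t \<noteq> t0 \<Longrightarrow> p (x(v := t)) = 0"
  shows "p x = 0"
proof -
  have "p (x(v := x v)) = 0"
    by (rule polyfun_curve_zero [where T = "{t0}" and \<gamma> = "\<lambda>t. x(v := t)", OF assms(1)])
      (simp_all only: poly_curve_var assms(2) finite.intros singleton_iff not_False_eq_True)
  then show ?thesis by simp
qed

text \<open>Differentiates functions instead of formal polynomials; the description is meaningful on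
  \<open>polyfun\<close>, where \<open>has_derivative_pd\<close> supplies existence.\<close>

definition pd :: "'i \<Rightarrow> (('i \<Rightarrow> complex) \<Rightarrow> complex) \<Rightarrow> ('i \<Rightarrow> complex) \<Rightarrow> complex" where
  "pd v p x = (THE D. ((\<lambda>t. p (x(v := t))) has_field_derivative D) (at (x v)))"

lemma pd_eqI:
  assumes "((\<lambda>t. p (x(v := t))) has_field_derivative D) (at (x v))"
  shows "pd v p x = D"
  unfolding pd_def using assms by (auto intro: DERIV_unique)

lemma polyfun_derivative_exists:
  assumes "p \<in> polyfun V"
  shows "\<exists>p'\<in>polyfun V. \<forall>x t. ((\<lambda>t. p (x(v := t))) has_field_derivative p' (x(v := t))) (at t)"
  using assms
proof induction
  case (const c)
  show ?case by (rule bexI [of _ "\<lambda>x. 0"]) (auto intro: polyfun.const)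
next
  case (var u)
  show ?case
    by (rule bexI [of _ "\<lambda>x. if u = v then 1 else 0"]) (auto intro: polyfun.const)
next
  case (add p q)
  then obtain p' q' where
    "p' \<in> polyfun V" "\<And>x t. ((\<lambda>t. p (x(v := t))) has_field_derivative p' (x(v := t))) (at t)"
    "q' \<in> polyfun V" "\<And>x t. ((\<lambda>t. q (x(v := t))) has_field_derivative q' (x(v := t))) (at t)"
    by blast
  then show ?case
    by (intro bexI [of _ "\<lambda>x. p' x + q' x"] allI DERIV_add polyfun.add)
next
  case (mult p q)
  then obtain p' q' where
    "p' \<in> polyfun V" "\<And>x t. ((\<lambda>t. p (x(v := t))) has_field_derivative p' (x(v := t))) (at t)"
    "q' \<in> polyfun V" "\<And>x t. ((\<lambda>t. q (x(v := t))) has_field_derivative q' (x(v := t))) (at t)"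
    by blast
  then show ?case
    by (intro bexI [of _ "\<lambda>x. p' x * q x + q' x * p x"] allI DERIV_mult polyfun.add polyfun.mult mult.hyps)
qed

lemma polyfun_pd: "p \<in> polyfun V \<Longrightarrow> pd v p \<in> polyfun V"
proof -
  assume "p \<in> polyfun V"
  then obtain p' where p': "p' \<in> polyfun V"
    "\<And>x t. ((\<lambda>t. p (x(v := t))) has_field_derivative p' (x(v := t))) (at t)"
    using polyfun_derivative_exists [of p V v] by blast
  have "pd v p = p'"
    using p'(2) by (intro ext pd_eqI) (metis fun_upd_triv)
  with p' show ?thesis by simp
qed

lemma has_derivative_pd:
  assumes "p \<in> polyfun V"
  shows "((\<lambda>t. p (x(v := t))) has_field_derivative pd v p x) (at (x v))"
proof -
  obtain p' where "\<And>x t. ((\<lambda>t. p (x(v := t))) has_field_derivative p' (x(v := t))) (at t)"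
    using polyfun_derivative_exists [OF assms, of v] by blast
  then have "((\<lambda>t. p (x(v := t))) has_field_derivative p' x) (at (x v))" by (metis fun_upd_triv)
  then show ?thesis using pd_eqI by metis
qed

lemma pd_const [simp]: "pd v (\<lambda>x. c) = (\<lambda>x. 0)"
  by (intro ext pd_eqI) auto

lemma pd_var: "pd v (\<lambda>x. x u) = (\<lambda>x. if u = v then 1 else 0)"
  by (intro ext pd_eqI) auto

lemma pd_add:
  assumes "p \<in> polyfun V" "q \<in> polyfun V"
  shows "pd v (\<lambda>x. p x + q x) = (\<lambda>x. pd v p x + pd v q x)"
  by (intro ext pd_eqI DERIV_add has_derivative_pd) (use assms in auto)

lemma pd_mult:
  assumes "p \<in> polyfun V" "q \<in> polyfun V"
  shows "pd v (\<lambda>x. p x * q x) = (\<lambda>x. pd v p x * q x + p x * pd v q x)"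
proof (intro ext pd_eqI)
  fix x
  show "((\<lambda>t. p (x(v := t)) * q (x(v := t))) has_field_derivative
          pd v p x * q x + p x * pd v q x) (at (x v))"
    using DERIV_mult [OF has_derivative_pd [OF assms(1), of x v] has_derivative_pd [OF assms(2), of x v]]
    by (simp add: mult.commute)
qed

lemma pd_cmult:
  assumes "p \<in> polyfun V"
  shows "pd v (\<lambda>x. c * p x) = (\<lambda>x. c * pd v p x)"
  using pd_mult [OF polyfun.const assms, of v c] by simp

lemma pd_sum:
  assumes "\<And>k. k \<in> K \<Longrightarrow> p k \<in> polyfun V"
  shows "pd v (\<lambda>x. \<Sum>k\<in>K. p k x) = (\<lambda>x. \<Sum>k\<in>K. pd v (p k) x)"
  using assms
proof (induction K rule: infinite_finite_induct)
  case (insert k K)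
  then show ?case
    using pd_add [of "p k" V "\<lambda>x. \<Sum>k\<in>K. p k x" v] polyfun_sum [of K p V] by simp
qed auto

lemma pd_commute:
  assumes "p \<in> polyfun V"
  shows "pd u (pd v p) = pd v (pd u p)"
  using assms
proof induction
  case (var w)
  then show ?case by (simp add: pd_var)
next
  case (add p q)
  then show ?case by (simp add: pd_add [where V = V] polyfun_pd)
next
  case (mult p q)
  then show ?case
    by (simp add: pd_add [where V = V] pd_mult [where V = V] polyfun_pd polyfun.mult algebra_simps)
qed auto

lemma polyfun_chain:
  assumes "p \<in> polyfun V" "finite V"
  shows "((\<lambda>t. p (\<lambda>v. x v + t * A v)) has_field_derivative
     (\<Sum>v\<in>V. A v * pd v p (\<lambda>v. x v + t * A v))) (at t)"
  using assms(1)
proof induction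
  case (const c)
  show ?case by simp
next
  case (var u)
  then have "(\<Sum>v\<in>V. A v * pd v (\<lambda>x. x u) (\<lambda>v. x v + t * A v)) = A u"
    using assms(2) by (simp add: pd_var if_distrib cong: if_cong)
  then show ?case by (auto intro!: derivative_eq_intros)
next
  case (add p q)
  then show ?case
    using DERIV_add [OF add.IH] by (simp add: pd_add [OF add.hyps] distrib_left sum.distrib)
next
  case (mult p q)
  show ?case
    using DERIV_mult [OF mult.IH]
    by (simp add: pd_mult [OF mult.hyps] distrib_left sum.distrib sum_distrib_left sum_distrib_right ac_simps)
qed

section \<open>Polarization operators and their Casimir identity\<close>

definition shift_op where
  "shift_op K A B p = (\<lambda>x :: 'i \<Rightarrow> complex. \<Sum>k\<in>K. x (A k) * pd (B k) p x)"

lemma polyfun_shift_op: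
  assumes "p \<in> polyfun V" "A ` K \<subseteq> V"
  shows "shift_op K A B p \<in> polyfun V"
  unfolding shift_op_def using assms
  by (intro polyfun_sum polyfun.mult polyfun.var polyfun_pd) auto

text \<open>Normal ordering: the first-order term arises when \<open>pd (B k)\<close> hits the
  coefficient \<open>x (B l)\<close>, which happens only for \<open>l = k\<close> because
  \<open>B\<close> is injective on \<open>K\<close>.\<close>

lemma shift_op_shift_op:
  assumes p: "p \<in> polyfun V" and K: "finite K" "inj_on B K" "B ` K \<subseteq> V"
  shows "shift_op K A B (shift_op K B A p) x =
    shift_op K A A p x + (\<Sum>k\<in>K. \<Sum>l\<in>K. x (A k) * x (B l) * pd (B k) (pd (A l) p) x)"
proof -
  have "pd (B k) (shift_op K B A p) x = pd (A k) p x + (\<Sum>l\<in>K. x (B l) * pd (B k) (pd (A l) p) x)"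
    if "k \<in> K" for k
  proof -
    have "pd (B k) (shift_op K B A p) = (\<lambda>x. \<Sum>l\<in>K. pd (B k) (\<lambda>x. x (B l) * pd (A l) p x) x)"
      unfolding shift_op_def using p K
      by (intro pd_sum [where V = V] polyfun.mult polyfun.var polyfun_pd) auto
    then have "pd (B k) (shift_op K B A p) x = (\<Sum>l\<in>K. pd (B k) (\<lambda>x. x (B l) * pd (A l) p x) x)"
      by simp
    also have "\<dots> = (\<Sum>l\<in>K. (if B l = B k then pd (A l) p x else 0) + x (B l) * pd (B k) (pd (A l) p) x)"
    proof (rule sum.cong [OF refl])
      fix l assume "l \<in> K"
      then have v: "(\<lambda>x. x (B l)) \<in> polyfun V" using K by (intro polyfun.var) auto
      show "pd (B k) (\<lambda>x. x (B l) * pd (A l) p x) x =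
        (if B l = B k then pd (A l) p x else 0) + x (B l) * pd (B k) (pd (A l) p) x"
        using pd_mult [OF v polyfun_pd [OF p], of "B k" "A l"] by (simp add: pd_var)
    qed
    finally have *: "pd (B k) (shift_op K B A p) x =
      (\<Sum>l\<in>K. (if B l = B k then pd (A l) p x else 0) + x (B l) * pd (B k) (pd (A l) p) x)" .
    have "(\<Sum>l\<in>K. (if B l = B k then pd (A l) p x else 0)) = (\<Sum>l\<in>K. if l = k then pd (A l) p x else 0)"
      using K that by (intro sum.cong) (auto dest: inj_onD)
    with * show ?thesis using K that by (simp add: sum.distrib)
  qed
  then show ?thesis
    unfolding shift_op_def [of K A B "shift_op K B A p"]
    by (simp add: distrib_left sum.distrib sum_distrib_left mult.assoc shift_op_def)
qed

text \<open>The second-order parts of the two products agree because partial derivatives commute.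
  What remains is the \<open>gl\<^sub>2\<close> relation
  \<open>[E i j, E j i] = E i i - E j j\<close>.\<close>

lemma shift_op_commutator:
  assumes p: "p \<in> polyfun V" and K: "finite K" "inj_on A K" "inj_on B K" "A ` K \<subseteq> V" "B ` K \<subseteq> V"
  shows "shift_op K A B (shift_op K B A p) x - shift_op K B A (shift_op K A B p) x = shift_op K A A p x - shift_op K B B p x"
proof -
  have "(\<Sum>k\<in>K. \<Sum>l\<in>K. x (A k) * x (B l) * pd (B k) (pd (A l) p) x) =
    (\<Sum>l\<in>K. \<Sum>k\<in>K. x (A k) * x (B l) * pd (B k) (pd (A l) p) x)"
    by (rule sum.swap)
  also have "\<dots> = (\<Sum>l\<in>K. \<Sum>k\<in>K. x (B l) * x (A k) * pd (A l) (pd (B k) p) x)"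
    by (intro sum.cong refl) (simp add: pd_commute [OF p] mult.commute)
  finally show ?thesis
    by (simp add: shift_op_shift_op [OF p K(1,3,5)] shift_op_shift_op [OF p K(1,2,4)])
qed

lemma shift_op_cmult: "p \<in> polyfun V \<Longrightarrow> shift_op K A B (\<lambda>x. c * p x) = (\<lambda>x. c * shift_op K A B p x)"
  by (simp add: shift_op_def pd_cmult sum_distrib_left ac_simps)

lemma shift_op_zero [simp]: "shift_op K A B (\<lambda>x. 0) = (\<lambda>x. 0)"
  by (simp add: shift_op_def)

lemma shift_op_diff:
  assumes "p \<in> polyfun V" "q \<in> polyfun V"
  shows "shift_op K A B (\<lambda>x. p x - q x) = (\<lambda>x. shift_op K A B p x - shift_op K A B q x)"
proof -
  have "pd v (\<lambda>x. p x - q x) = (\<lambda>x. pd v p x - pd v q x)" for v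
    using pd_add [OF assms(1) polyfun_cmult [OF assms(2), of "-1"], of v]
    by (simp add: pd_cmult [OF assms(2), of v "-1", simplified])
  then show ?thesis by (simp add: shift_op_def algebra_simps sum_subtractf)
qed

text \<open>\<open>rowop D i j\<close> is the operator \<open>E i j\<close> of the overview. Row and
  column operators are instances of one \<open>shift_op\<close> and so share the commutation rules;
  for equal indices they are Euler operators.\<close>

abbreviation rowop :: "nat \<Rightarrow> nat \<Rightarrow> nat \<Rightarrow> ((nat \<times> nat \<Rightarrow> complex) \<Rightarrow> complex) \<Rightarrow> (nat \<times> nat \<Rightarrow> complex) \<Rightarrow> complex" where
  "rowop D i j \<equiv> shift_op {..<D} (\<lambda>a. (i, a)) (\<lambda>a. (j, a))"

abbreviation colop :: "nat \<Rightarrow> nat \<Rightarrow> nat \<Rightarrow> ((nat \<times> nat \<Rightarrow> complex) \<Rightarrow> complex) \<Rightarrow> (nat \<times> nat \<Rightarrow> complex) \<Rightarrow> complex" where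
  "colop n a b \<equiv> shift_op {..<n} (\<lambda>i. (i, a)) (\<lambda>i. (i, b))"

abbreviation grid :: "nat \<Rightarrow> nat \<Rightarrow> (nat \<times> nat) set" where
  "grid n D \<equiv> {..<n} \<times> {..<D}"

text \<open>The quadratic Casimir operators of the two commuting actions on matrices agree up to
  multiples of the Euler operator.\<close>

lemma casimir_eq:
  assumes p: "p \<in> polyfun (grid n D)"
  shows "(\<Sum>i<n. \<Sum>j<n. rowop D i j (rowop D j i p) x) - of_nat n * (\<Sum>i<n. rowop D i i p x) =
    (\<Sum>a<D. \<Sum>b<D. colop n a b (colop n b a p) x) - of_nat D * (\<Sum>a<D. colop n a a p x)"
proof -
  \<comment> \<open>The common second-order part; in the column version the two derivatives arrive
    in the opposite order.\<close>
  let ?T = "\<lambda>i j a b. x (i, a) * x (j, b) * pd (j, a) (pd (i, b) p) x"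
  have r: "rowop D i j (rowop D j i p) x = rowop D i i p x + (\<Sum>a<D. \<Sum>b<D. ?T i j a b)"
    if "i < n" "j < n" for i j
    by (rule shift_op_shift_op [OF p]) (use that in \<open>auto simp: inj_on_def\<close>)
  have c: "colop n a b (colop n b a p) x = colop n a a p x + (\<Sum>i<n. \<Sum>j<n. ?T i j a b)"
    if "a < D" "b < D" for a b
  proof -
    have "colop n a b (colop n b a p) x = colop n a a p x +
        (\<Sum>i<n. \<Sum>j<n. x (i, a) * x (j, b) * pd (i, b) (pd (j, a) p) x)"
      by (rule shift_op_shift_op [OF p]) (use that in \<open>auto simp: inj_on_def\<close>)
    then show ?thesis by (simp add: pd_commute [OF p])
  qed
  have "(\<Sum>i<n. \<Sum>j<n. rowop D i j (rowop D j i p) x) - of_nat n * (\<Sum>i<n. rowop D i i p x)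
    = (\<Sum>i<n. \<Sum>j<n. \<Sum>a<D. \<Sum>b<D. ?T i j a b)"
    by (simp add: r sum.distrib sum_distrib_left)
  also have "\<dots> = (\<Sum>i<n. \<Sum>a<D. \<Sum>j<n. \<Sum>b<D. ?T i j a b)"
    by (intro sum.cong refl sum.swap)
  also have "\<dots> = (\<Sum>a<D. \<Sum>i<n. \<Sum>j<n. \<Sum>b<D. ?T i j a b)"
    by (rule sum.swap)
  also have "\<dots> = (\<Sum>a<D. \<Sum>i<n. \<Sum>b<D. \<Sum>j<n. ?T i j a b)"
    by (intro sum.cong refl sum.swap)
  also have "\<dots> = (\<Sum>a<D. \<Sum>b<D. \<Sum>i<n. \<Sum>j<n. ?T i j a b)"
    by (intro sum.cong refl sum.swap)
  also have "\<dots> = (\<Sum>a<D. \<Sum>b<D. colop n a b (colop n b a p) x) - of_nat D * (\<Sum>a<D. colop n a a p x)"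
    by (simp add: c sum.distrib sum_distrib_left)
  finally show ?thesis .
qed

section \<open>One-parameter groups of row and column operations\<close>

definition rowadd :: "nat \<Rightarrow> nat \<Rightarrow> complex \<Rightarrow> (nat \<times> nat \<Rightarrow> complex) \<Rightarrow> nat \<times> nat \<Rightarrow> complex" where
  "rowadd i j t x = (\<lambda>(r, k). if r = j then x (j, k) + t * x (i, k) else x (r, k))"

definition coladd :: "nat \<Rightarrow> nat \<Rightarrow> complex \<Rightarrow> (nat \<times> nat \<Rightarrow> complex) \<Rightarrow> nat \<times> nat \<Rightarrow> complex" where
  "coladd a b t x = (\<lambda>(r, k). if k = b then x (r, b) + t * x (r, a) else x (r, k))"

definition rowscale :: "(nat \<Rightarrow> complex) \<Rightarrow> (nat \<times> nat \<Rightarrow> complex) \<Rightarrow> nat \<times> nat \<Rightarrow> complex" where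
  "rowscale c x = (\<lambda>(r, k). c r * x (r, k))"

definition colscale :: "(nat \<Rightarrow> complex) \<Rightarrow> (nat \<times> nat \<Rightarrow> complex) \<Rightarrow> nat \<times> nat \<Rightarrow> complex" where
  "colscale e x = (\<lambda>(r, k). e k * x (r, k))"

definition rowperm :: "(nat \<Rightarrow> nat) \<Rightarrow> (nat \<times> nat \<Rightarrow> complex) \<Rightarrow> nat \<times> nat \<Rightarrow> complex" where
  "rowperm \<sigma> x = (\<lambda>(r, k). x (\<sigma> r, k))"

abbreviation scale_one :: "nat \<Rightarrow> complex \<Rightarrow> nat \<Rightarrow> complex" where
  "scale_one i c \<equiv> (\<lambda>r. if r = i then c else 1)"

text \<open>Valid at every \<open>t\<close>, not only at 0: row \<open>i\<close> does not move along
  the curve because \<open>i \<noteq> j\<close>, so the coefficients \<open>x (i, k)\<close> may be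
  read at the moving point.\<close>

lemma rowadd_derivative:
  assumes p: "p \<in> polyfun (grid n D)" and ij: "i < n" "j < n" "i \<noteq> j"
  shows "((\<lambda>t. p (rowadd i j t x)) has_field_derivative rowop D i j p (rowadd i j t x)) (at t)"
proof -
  let ?A = "\<lambda>v. if fst v = j then x (i, snd v) else 0"
  have eq: "rowadd i j t x = (\<lambda>v. x v + t * ?A v)" for t
    by (auto simp: rowadd_def fun_eq_iff)
  have "((\<lambda>t. p (rowadd i j t x)) has_field_derivative
      (\<Sum>v\<in>grid n D. ?A v * pd v p (rowadd i j t x))) (at t)"
    unfolding eq by (rule polyfun_chain [OF p]) auto
  also have "(\<Sum>v\<in>grid n D. ?A v * pd v p (rowadd i j t x)) = rowop D i j p (rowadd i j t x)"
  proof -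
    have "(\<Sum>v\<in>grid n D. ?A v * pd v p (rowadd i j t x)) =
        (\<Sum>r<n. \<Sum>k<D. ?A (r, k) * pd (r, k) p (rowadd i j t x))"
      by (subst sum.cartesian_product) (auto intro!: sum.cong)
    also have "\<dots> = (\<Sum>r<n. if r = j then \<Sum>k<D. x (i, k) * pd (r, k) p (rowadd i j t x) else 0)"
      by (intro sum.cong) auto
    finally show ?thesis using ij by (simp add: shift_op_def rowadd_def)
  qed
  finally show ?thesis .
qed

lemma coladd_derivative:
  assumes p: "p \<in> polyfun (grid n D)" and ab: "a < D" "b < D" "a \<noteq> b"
  shows "((\<lambda>t. p (coladd a b t x)) has_field_derivative colop n a b p (coladd a b t x)) (at t)"
proof -
  let ?A = "\<lambda>v. if snd v = b then x (fst v, a) else 0"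
  have eq: "coladd a b t x = (\<lambda>v. x v + t * ?A v)" for t
    by (auto simp: coladd_def fun_eq_iff)
  have "((\<lambda>t. p (coladd a b t x)) has_field_derivative
      (\<Sum>v\<in>grid n D. ?A v * pd v p (coladd a b t x))) (at t)"
    unfolding eq by (rule polyfun_chain [OF p]) auto
  also have "(\<Sum>v\<in>grid n D. ?A v * pd v p (coladd a b t x)) = colop n a b p (coladd a b t x)"
  proof -
    have "(\<Sum>v\<in>grid n D. ?A v * pd v p (coladd a b t x)) =
        (\<Sum>r<n. \<Sum>k<D. ?A (r, k) * pd (r, k) p (coladd a b t x))"
      by (subst sum.cartesian_product) (auto intro!: sum.cong)
    also have "\<dots> = (\<Sum>r<n. \<Sum>k<D. if k = b then x (r, a) * pd (r, k) p (coladd a b t x) else 0)"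
      by (intro sum.cong) auto
    finally show ?thesis using ab by (simp add: shift_op_def coladd_def)
  qed
  finally show ?thesis .
qed

lemma rowadd_0 [simp]: "rowadd i j 0 x = x" and coladd_0 [simp]: "coladd i j 0 x = x"
  by (auto simp: rowadd_def coladd_def fun_eq_iff)

text \<open>Transfers symmetries from functions to their images under row operators: both sides of
  \<open>eq\<close> are differentiated at 0. In the applications \<open>\<kappa>\<close> is a
  character and \<open>s\<close> the rescaling of the parameter caused by conjugating the
  one-parameter group.\<close>

lemma rowop_intertwine:
  assumes p: "p \<in> polyfun (grid n D)" and q: "q \<in> polyfun (grid n D)"
    and ij: "i < n" "j < n" "i \<noteq> j" "i' < n" "j' < n" "i' \<noteq> j'"
    and eq: "\<And>t. p (rowadd i j t y) = \<kappa> * q (rowadd i' j' (s * t) x)"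
  shows "rowop D i j p y = \<kappa> * s * rowop D i' j' q x"
proof (rule DERIV_unique)
  show "((\<lambda>t. p (rowadd i j t y)) has_field_derivative rowop D i j p y) (at 0)"
    using rowadd_derivative [OF p ij(1-3), of y 0] by simp
  have "((\<lambda>t. q (rowadd i' j' (s * t) x)) has_field_derivative rowop D i' j' q x * s) (at 0)"
    by (rule DERIV_chain' [of "\<lambda>t. s * t" s 0 UNIV "\<lambda>t. q (rowadd i' j' t x)", simplified])
      (use rowadd_derivative [OF q ij(4-6), of x 0] in \<open>auto intro!: derivative_eq_intros\<close>)
  then have "((\<lambda>t. \<kappa> * q (rowadd i' j' (s * t) x)) has_field_derivative \<kappa> * (rowop D i' j' q x * s)) (at 0)"
    by (rule DERIV_cmult)
  then show "((\<lambda>t. p (rowadd i j t y)) has_field_derivative \<kappa> * s * rowop D i' j' q x) (at 0)"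
    by (simp add: eq ac_simps)
qed

text \<open>Euler's identity in the variables of one row, from the curve that scales this row by
  \<open>1 + t\<close>.\<close>

lemma rowop_self:
  assumes p: "p \<in> polyfun (grid n D)" and i: "i < n"
    and hom: "\<And>c x. c \<noteq> 0 \<Longrightarrow> p (rowscale (scale_one i c) x) = c ^ e * p x"
  shows "rowop D i i p x = of_nat e * p x"
proof (rule DERIV_unique)
  let ?A = "\<lambda>v. if fst v = i then x v else 0"
  have eq: "rowscale (scale_one i (1 + t)) x = (\<lambda>v. x v + t * ?A v)" for t
    by (auto simp: rowscale_def fun_eq_iff algebra_simps)
  have "((\<lambda>t. p (rowscale (scale_one i (1 + t)) x)) has_field_derivative
      (\<Sum>v\<in>grid n D. ?A v * pd v p (\<lambda>v. x v + 0 * ?A v))) (at 0)"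
    unfolding eq by (rule polyfun_chain [OF p]) auto
  also have "(\<Sum>v\<in>grid n D. ?A v * pd v p (\<lambda>v. x v + 0 * ?A v)) = rowop D i i p x"
  proof -
    have "(\<Sum>v\<in>grid n D. ?A v * pd v p (\<lambda>v. x v + 0 * ?A v)) =
        (\<Sum>r<n. \<Sum>k<D. ?A (r, k) * pd (r, k) p x)"
      by (subst sum.cartesian_product) (auto intro!: sum.cong)
    also have "\<dots> = (\<Sum>r<n. if r = i then \<Sum>k<D. x (i, k) * pd (r, k) p x else 0)"
      by (intro sum.cong) auto
    finally show ?thesis using i by (simp add: shift_op_def)
  qed
  finally show "((\<lambda>t. p (rowscale (scale_one i (1 + t)) x)) has_field_derivative rowop D i i p x) (at 0)" .
  have "((\<lambda>t. (1 + t) ^ e * p x) has_field_derivative of_nat e * p x) (at 0)"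
    by (auto intro!: derivative_eq_intros)
  \<comment> \<open>Homogeneity is given for nonzero factors only, so \<open>t = - 1\<close> has to
    be avoided.\<close>
  moreover have "\<forall>\<^sub>F t in nhds 0. (1 + t) ^ e * p x = p (rowscale (scale_one i (1 + t)) x)"
  proof -
    have "\<forall>\<^sub>F t in nhds 0. t \<in> - {- 1 :: complex}"
      by (rule eventually_nhds_in_open) auto
    then show ?thesis
    proof eventually_elim
      case (elim t)
      then have "1 + t \<noteq> 0" by (metis ComplD add.commute add_eq_0_iff2 insertI1)
      then show ?case using hom [of "1 + t" x] by simp
    qed
  qed
  ultimately show "((\<lambda>t. p (rowscale (scale_one i (1 + t)) x)) has_field_derivative of_nat e * p x) (at 0)"
    by (simp only: DERIV_cong_ev [OF refl _ refl])
qed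

lemma colop_self:
  assumes p: "p \<in> polyfun (grid n D)" and a: "a < D"
    and hom: "\<And>c x. c \<noteq> 0 \<Longrightarrow> p (colscale (scale_one a c) x) = c ^ e * p x"
  shows "colop n a a p x = of_nat e * p x"
proof (rule DERIV_unique)
  let ?A = "\<lambda>v. if snd v = a then x v else 0"
  have eq: "colscale (scale_one a (1 + t)) x = (\<lambda>v. x v + t * ?A v)" for t
    by (auto simp: colscale_def fun_eq_iff algebra_simps)
  have "((\<lambda>t. p (colscale (scale_one a (1 + t)) x)) has_field_derivative
      (\<Sum>v\<in>grid n D. ?A v * pd v p (\<lambda>v. x v + 0 * ?A v))) (at 0)"
    unfolding eq by (rule polyfun_chain [OF p]) auto
  also have "(\<Sum>v\<in>grid n D. ?A v * pd v p (\<lambda>v. x v + 0 * ?A v)) = colop n a a p x"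
  proof -
    have "(\<Sum>v\<in>grid n D. ?A v * pd v p (\<lambda>v. x v + 0 * ?A v)) =
        (\<Sum>r<n. \<Sum>k<D. ?A (r, k) * pd (r, k) p x)"
      by (subst sum.cartesian_product) (auto intro!: sum.cong)
    also have "\<dots> = (\<Sum>r<n. \<Sum>k<D. if k = a then x (r, a) * pd (r, k) p x else 0)"
      by (intro sum.cong) auto
    finally show ?thesis using a by (simp add: shift_op_def)
  qed
  finally show "((\<lambda>t. p (colscale (scale_one a (1 + t)) x)) has_field_derivative colop n a a p x) (at 0)" .
  have "((\<lambda>t. (1 + t) ^ e * p x) has_field_derivative of_nat e * p x) (at 0)"
    by (auto intro!: derivative_eq_intros)
  moreover have "\<forall>\<^sub>F t in nhds 0. (1 + t) ^ e * p x = p (colscale (scale_one a (1 + t)) x)"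
  proof -
    have "\<forall>\<^sub>F t in nhds 0. t \<in> - {- 1 :: complex}"
      by (rule eventually_nhds_in_open) auto
    then show ?thesis
    proof eventually_elim
      case (elim t)
      then have "1 + t \<noteq> 0" by (metis ComplD add.commute add_eq_0_iff2 insertI1)
      then show ?case using hom [of "1 + t" x] by simp
    qed
  qed
  ultimately show "((\<lambda>t. p (colscale (scale_one a (1 + t)) x)) has_field_derivative of_nat e * p x) (at 0)"
    by (simp only: DERIV_cong_ev [OF refl _ refl])
qed

text \<open>Integrates the infinitesimal condition: along the curve \<open>p\<close> is a univariate
  polynomial with derivative 0.\<close>

lemma rowadd_invariant:
  assumes p: "p \<in> polyfun (grid n D)" and ij: "i < n" "j < n" "i \<noteq> j"
    and zero: "rowop D i j p = (\<lambda>x. 0)"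
  shows "p (rowadd i j t x) = p x"
proof -
  have "\<exists>Q. \<forall>t. rowadd i j t x v = poly Q t" for v
    by (cases "fst v = j")
      (auto simp: rowadd_def case_prod_beta intro: exI [of _ "[:x v, x (i, snd v):]"] exI [of _ "[:x v:]"])
  then obtain P where P: "\<And>t. p (rowadd i j t x) = poly P t"
    using polyfun_curve [OF p, of "\<lambda>t. rowadd i j t x"] by blast
  have "poly (pderiv P) t = 0" for t
  proof (rule DERIV_unique)
    show "((\<lambda>t. poly P t) has_field_derivative poly (pderiv P) t) (at t)" by (rule poly_DERIV)
    show "((\<lambda>t. poly P t) has_field_derivative 0) (at t)"
      using rowadd_derivative [OF p ij, of x t] by (simp add: zero P)
  qed
  then have "pderiv P = 0" by (metis poly_all_0_iff_0)
  then have "degree P = 0" by (simp add: pderiv_eq_0_iff)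
  then obtain c where "P = [:c:]" by (rule degree_eq_zeroE)
  then show ?thesis using P [of t] P [of 0] by simp
qed

section \<open>Row and column degrees, the Casimir operator\<close>

text \<open>The source column \<open>a\<close> never changes, so the additions to the other columns
  can be performed one at a time.\<close>

lemma coladd_multi:
  assumes "finite K" "a \<notin> K" and inv: "\<And>b t x. b \<in> K \<Longrightarrow> q (coladd a b t x) = q x"
  shows "q (\<lambda>(r, k). if k \<in> K then x (r, k) + u k * x (r, a) else x (r, k)) = q x"
  using assms
proof (induction K)
  case (insert b K)
  let ?y = "\<lambda>(r, k). if k \<in> K then x (r, k) + u k * x (r, a) else x (r, k)"
  have "(\<lambda>(r, k). if k \<in> insert b K then x (r, k) + u k * x (r, a) else x (r, k)) = coladd a b (u b) ?y"
    using insert by (auto simp: coladd_def fun_eq_iff)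
  then show ?case using insert by simp
qed simp

text \<open>Clearing row \<open>i\<close> with the first column, the degree in that row is at most the degree in the
  first column.\<close>

lemma row_degree_bound:
  assumes q: "q \<in> polyfun (grid n D)" and "m < e"
    and inv: "\<And>b t x. 0 < b \<Longrightarrow> b < D \<Longrightarrow> q (coladd 0 b t x) = q x"
    and row: "\<And>c x. c \<noteq> 0 \<Longrightarrow> q (rowscale (scale_one i c) x) = c ^ e * q x"
    and col: "\<And>c x. c \<noteq> 0 \<Longrightarrow> q (colscale (scale_one 0 c) x) = c ^ m * q x"
  shows "q x = 0"
proof (rule polyfun_zero_var [OF q, where v = "(i, 0)" and ?t0.0 = 0])
  fix t :: complex assume "t \<noteq> 0"
  define z where "z = x((i, 0) := t)"
  \<comment> \<open>Row \<open>i\<close> is cleared except for its entry \<open>t\<close> in column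
    0, without changing the value of \<open>q\<close>.\<close>
  define z' where "z' = (\<lambda>(r, k). if k \<in> {1..<D} then z (r, k) + (- (z (i, k) / t)) * z (r, 0) else z (r, k))"
  define y where "y = (\<lambda>s (r, k). if k = 0 \<and> r \<noteq> i then s * z' (r, k) else z' (r, k))"
  have eq: "q z' = q z"
    unfolding z'_def by (rule coladd_multi) (auto intro: inv)
  have zi: "z (i, 0) = t" by (simp add: z_def)
  have zi': "z' (i, k) = 0" if "0 < k" "k < D" for k
    using that \<open>t \<noteq> 0\<close> zi by (simp add: z'_def)
  have "\<exists>Q. \<forall>s. y s v = poly Q s" for v
    by (cases "snd v = 0 \<and> fst v \<noteq> i")
      (auto simp: y_def case_prod_beta intro: exI [of _ "[:0, z' (fst v, 0):]"] exI [of _ "[:z' v:]"])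
  then obtain P where P: "\<And>s. q (y s) = poly P s"
    using polyfun_curve [OF q, of y] by blast
  have "q z' = s ^ (e - m) * q (y s)" if "s \<noteq> 0" for s
  proof -
    \<comment> \<open>With a single nonzero entry left in row \<open>i\<close>, scaling column 0
      amounts to scaling row \<open>i\<close> and, separately, the other entries of column 0; the
      latter is what \<open>y s\<close> does.\<close>
    have "q (colscale (scale_one 0 s) z') = q (rowscale (scale_one i s) (y s))"
      by (rule polyfun_cong [OF q]) (use zi' in \<open>auto simp: colscale_def rowscale_def y_def\<close>)
    then have "s ^ m * q z' = s ^ e * q (y s)" using that row col by metis
    also have "\<dots> = s ^ m * (s ^ (e - m) * q (y s))"
      using \<open>m < e\<close> by (simp add: power_add [symmetric])
    finally show ?thesis using that by simp
  qed
  \<comment> \<open>The constant \<open>q z'\<close> is a multiple of the positive power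
    \<open>s ^ (e - m)\<close>, hence 0, as its value at \<open>s = 0\<close> shows.\<close>
  then have "monom 1 (e - m) * P - [:q z':] = 0"
    by (intro poly_zero_if_cofinite [of "{0}"]) (auto simp: poly_monom P)
  then have "poly (monom 1 (e - m) * P - [:q z':]) 0 = 0" by simp
  then have "q z' = 0" using \<open>m < e\<close> by (simp add: poly_monom power_0_left)
  then show "q (x((i, 0) := t)) = 0" using eq by (simp add: z_def)
qed

lemma prod_scale_one:
  assumes "i \<in> K" "finite K"
  shows "(\<Prod>r\<in>K. scale_one i c r) = c" "(\<Prod>r\<in>K. scale_one i c r ^ \<mu> r) = c ^ \<mu> i"
proof -
  show "(\<Prod>r\<in>K. scale_one i c r) = c" using assms by simp
  have "(\<Prod>r\<in>K. scale_one i c r ^ \<mu> r) = (\<Prod>r\<in>K. if r = i then c ^ \<mu> i else 1)"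
    by (intro prod.cong) auto
  then show "(\<Prod>r\<in>K. scale_one i c r ^ \<mu> r) = c ^ \<mu> i" using assms by simp
qed

text \<open>The polarizations of the highest weight vectors of weight \<open>\<mu>\<close> in \<open>S\<^sup>n (S\<^sup>d V)\<close>, where \<open>dim V = D\<close>.\<close>

locale hwfun =
  fixes n D d :: nat and \<mu> :: "nat \<Rightarrow> nat" and f :: "(nat \<times> nat \<Rightarrow> complex) \<Rightarrow> complex"
  assumes poly: "f \<in> polyfun (grid n D)"
    and row: "f (rowscale c x) = (\<Prod>i<n. c i) ^ d * f x"
    and perm: "\<sigma> permutes {..<n} \<Longrightarrow> f (rowperm \<sigma> x) = f x"
    and unip: "a < b \<Longrightarrow> b < D \<Longrightarrow> f (coladd a b t x) = f x"
    and col: "(\<And>k. k < D \<Longrightarrow> e k \<noteq> 0) \<Longrightarrow> f (colscale e x) = (\<Prod>k<D. e k ^ \<mu> k) * f x"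
begin

lemma row1: "i < n \<Longrightarrow> f (rowscale (scale_one i c) x) = c ^ d * f x"
  by (simp only: row prod_scale_one lessThan_iff finite_lessThan)

lemma col1: "a < D \<Longrightarrow> c \<noteq> 0 \<Longrightarrow> f (colscale (scale_one a c) x) = c ^ \<mu> a * f x"
  by (subst col) (simp split: if_splits, simp only: prod_scale_one lessThan_iff finite_lessThan)

text \<open>Scaling all entries by 2 is a row scaling and a column scaling at once; the two
  resulting powers of 2 must agree.\<close>

lemma weight_sum:
  assumes "f x \<noteq> 0"
  shows "(\<Sum>k<D. \<mu> k) = n * d"
proof -
  have "rowscale (\<lambda>_. 2) x = colscale (\<lambda>_. 2) x" by (auto simp: rowscale_def colscale_def)
  then have "(\<Prod>i<n. 2 :: complex) ^ d * f x = (\<Prod>k<D. 2 ^ \<mu> k) * f x"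
    using row [of "\<lambda>_. 2" x] col [of "\<lambda>_. 2" x] by (metis zero_neq_numeral)
  then have "(2 :: complex) ^ (n * d) = 2 ^ (\<Sum>k<D. \<mu> k)"
    using assms by (simp add: power_mult power_sum)
  then have "(2 :: nat) ^ (n * d) = 2 ^ (\<Sum>k<D. \<mu> k)"
    by (metis (mono_tags, lifting) of_nat_eq_iff of_nat_numeral of_nat_power)
  then show ?thesis by simp
qed

lemma colop_above: "a < b \<Longrightarrow> b < D \<Longrightarrow> colop n a b f x = 0"
proof (rule DERIV_unique)
  assume ab: "a < b" "b < D"
  show "((\<lambda>t. f (coladd a b t x)) has_field_derivative colop n a b f x) (at 0)"
    using coladd_derivative [OF poly, of a b x 0] ab by simp
  show "((\<lambda>t. f (coladd a b t x)) has_field_derivative 0) (at 0)"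
    using ab by (simp add: unip)
qed

lemma colop_diag: "a < D \<Longrightarrow> colop n a a f x = of_nat (\<mu> a) * f x"
  by (rule colop_self [OF poly _ col1])

lemma rowop_diag: "i < n \<Longrightarrow> rowop D i i f x = of_nat d * f x"
  by (rule rowop_self [OF poly _ row1])

text \<open>A column operator whose first index is the smaller one annihilates \<open>f\<close>. So
  for \<open>b < a\<close> the inner operator gives 0, and for \<open>a < b\<close> the product
  equals the commutator, which is diagonal.\<close>

lemma colop_colop:
  assumes "a < D" "b < D"
  shows "colop n a b (colop n b a f) x =
    ((if a = b then of_nat (\<mu> a) ^ 2 else 0) + (if a < b then of_nat (\<mu> a) - of_nat (\<mu> b) else 0)) * f x"
proof -
  consider "a = b" | "a < b" | "b < a" by linarith
  then show ?thesis
  proof cases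
    case 1
    have "colop n a a f = (\<lambda>x. of_nat (\<mu> a) * f x)" using colop_diag assms by auto
    then show ?thesis
      using 1 assms by (simp add: shift_op_cmult [OF poly] colop_diag power2_eq_square)
  next
    case 2
    then have z: "colop n a b f = (\<lambda>x. 0)" using colop_above assms by auto
    have "colop n a b (colop n b a f) x - colop n b a (colop n a b f) x = colop n a a f x - colop n b b f x"
      by (rule shift_op_commutator [OF poly]) (use assms in \<open>auto simp: inj_on_def\<close>)
    then show ?thesis using 2 assms z by (simp add: colop_diag algebra_simps)
  next
    case 3
    then have z: "colop n b a f = (\<lambda>x. 0)" using colop_above assms by auto
    then show ?thesis using 3 by simp
  qed
qed

text \<open>Representation theory of the \<open>sl\<^sub>2\<close> of two rows by hand. With
  \<open>E = rowop D i j\<close> and \<open>F = rowop D j i\<close>, the function \<open>f\<close>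
  has weight 0, and \<open>E (E f) = 0\<close> leaves the components of highest weight 0 and 2. The
  first of them is \<open>f - F (E f) / 2\<close>, called \<open>f'\<close> below; it is shown to
  vanish.\<close>

lemma rowop_rowop:
  assumes ij: "i < n" "j < n" "i \<noteq> j" and "odd d" "0 < D" "\<mu> 0 \<le> d + 1"
  shows "rowop D i j (rowop D j i f) x = 2 * f x"
proof -
  have V: "(\<lambda>a. (i, a)) ` {..<D} \<subseteq> grid n D" "(\<lambda>a. (j, a)) ` {..<D} \<subseteq> grid n D"
    using ij by auto
  have inj: "inj_on (\<lambda>a. (i, a)) {..<D}" "inj_on (\<lambda>a. (j, a)) {..<D}" by (auto simp: inj_on_def)
  define g where "g = rowop D i j f"
  define h where "h = rowop D j i f"
  define w where "w = rowop D j i g"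
  have gp: "g \<in> polyfun (grid n D)" and hp: "h \<in> polyfun (grid n D)"
    unfolding g_def h_def by (intro polyfun_shift_op poly V)+
  have wp: "w \<in> polyfun (grid n D)" unfolding w_def by (intro polyfun_shift_op gp V)

  \<comment> \<open>\<open>up\<close> and \<open>down\<close> record that \<open>rowop D k l\<close>
    raises the degree in row \<open>k\<close> and lowers the degree in row \<open>l\<close>;
    \<open>colsc\<close> and \<open>colad\<close> record that row operators respect column
    operations.\<close>
  have up: "rowop D k l p (rowscale (scale_one k c) x) = c ^ Suc e * rowop D k l p x"
    if "p \<in> polyfun (grid n D)" "k < n" "l < n" "k \<noteq> l"
      "\<And>c x. c \<noteq> 0 \<Longrightarrow> p (rowscale (scale_one k c) x) = c ^ e * p x" "c \<noteq> 0" for p k l e c x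
  proof -
    have "rowadd k l t (rowscale (scale_one k c) x) = rowscale (scale_one k c) (rowadd k l (c * t) x)" for t
      using that by (auto simp: rowadd_def rowscale_def fun_eq_iff)
    then have "rowop D k l p (rowscale (scale_one k c) x) = c ^ e * c * rowop D k l p x"
      using that by (intro rowop_intertwine [OF that(1) that(1)]) auto
    then show ?thesis by simp
  qed
  have down: "rowop D k l p (rowscale (scale_one l c) x) = c ^ e * rowop D k l p x"
    if "p \<in> polyfun (grid n D)" "k < n" "l < n" "k \<noteq> l"
      "\<And>c x. c \<noteq> 0 \<Longrightarrow> p (rowscale (scale_one l c) x) = c ^ Suc e * p x" "c \<noteq> 0" for p k l e c x
  proof -
    have "rowadd k l t (rowscale (scale_one l c) x) = rowscale (scale_one l c) (rowadd k l (1 / c * t) x)" for t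
      using that by (auto simp: rowadd_def rowscale_def fun_eq_iff field_simps)
    then have "rowop D k l p (rowscale (scale_one l c) x) = c ^ Suc e * (1 / c) * rowop D k l p x"
      using that by (intro rowop_intertwine [OF that(1) that(1)]) (auto simp del: power_Suc)
    then show ?thesis using that by simp
  qed
  have colsc: "rowop D i j p (colscale e x) = \<chi> * rowop D i j p x"
    if "p \<in> polyfun (grid n D)" "\<And>x. p (colscale e x) = \<chi> * p x" for p e \<chi> x
  proof -
    have "rowadd i j t (colscale e x) = colscale e (rowadd i j t x)" for t
      by (auto simp: rowadd_def colscale_def fun_eq_iff algebra_simps)
    then have "rowop D i j p (colscale e x) = \<chi> * 1 * rowop D i j p x"
      using that ij by (intro rowop_intertwine [OF that(1) that(1)]) auto
    then show ?thesis by simp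
  qed
  have colad: "rowop D i j p (coladd a b s x) = rowop D i j p x"
    if "p \<in> polyfun (grid n D)" "a \<noteq> b" "\<And>x. p (coladd a b s x) = p x" for p a b s x
  proof -
    have "rowadd i j t (coladd a b s x) = coladd a b s (rowadd i j t x)" for t
      using that(2) by (auto simp: rowadd_def coladd_def fun_eq_iff algebra_simps)
    then have "rowop D i j p (coladd a b s x) = 1 * 1 * rowop D i j p x"
      using that ij by (intro rowop_intertwine [OF that(1) that(1)]) auto
    then show ?thesis by simp
  qed
  have gi: "g (rowscale (scale_one i c) x) = c ^ Suc d * g x" if "c \<noteq> 0" for c x
    unfolding g_def using that ij by (intro up poly) (auto simp: row1)
  obtain d' where d': "d = Suc d'" using \<open>odd d\<close> by (metis odd_pos gr0_implies_Suc)
  have gj: "g (rowscale (scale_one j c) x) = c ^ d' * g x" if "c \<noteq> 0" for c x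
    unfolding g_def using that ij by (intro down poly) (auto simp: row1 d')
  \<comment> \<open>The degree in row \<open>i\<close> has risen to \<open>d + 2\<close>, beyond the
    degree \<open>\<mu> 0 \<le> d + 1\<close> in column 0.\<close>
  have g2: "rowop D i j g x = 0" for x
  proof (rule row_degree_bound [where q = "rowop D i j g" and n = n and D = D and x = x
        and e = "Suc (Suc d)" and m = "\<mu> 0" and i = i])
    show "rowop D i j g \<in> polyfun (grid n D)" by (intro polyfun_shift_op gp V)
    show "\<mu> 0 < Suc (Suc d)" using assms by simp
    show "rowop D i j g (coladd 0 b t x) = rowop D i j g x" if "0 < b" "b < D" for b t x
      using that by (intro colad gp) (auto simp: g_def unip intro!: colad poly)
    show "rowop D i j g (rowscale (scale_one i c) x) = c ^ Suc (Suc d) * rowop D i j g x"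
      if "c \<noteq> 0" for c x
      using that ij gi by (intro up gp) auto
    show "rowop D i j g (colscale (scale_one 0 c) x) = c ^ \<mu> 0 * rowop D i j g x"
      if "c \<noteq> 0" for c x
      using that col1 \<open>0 < D\<close> by (intro colsc gp) (auto simp: g_def intro!: colsc poly)
  qed

  \<comment> \<open>The degrees of \<open>g\<close> in the rows \<open>i\<close> and
    \<open>j\<close> are \<open>d + 1\<close> and \<open>d - 1\<close>; their difference is the
    factor 2.\<close>
  have Ew: "rowop D i j w x = 2 * g x" for x
  proof -
    have "rowop D i j (rowop D j i g) x - rowop D j i (rowop D i j g) x = rowop D i i g x - rowop D j j g x"
      by (rule shift_op_commutator [OF gp]) (use V inj in auto)
    moreover have "rowop D i j g = (\<lambda>x. 0)" using g2 by auto
    moreover have "rowop D i i g x = of_nat (Suc d) * g x" using ij gi by (intro rowop_self [OF gp]) auto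
    moreover have "rowop D j j g x = of_nat d' * g x" using ij gj by (intro rowop_self [OF gp]) auto
    ultimately show ?thesis by (simp add: w_def d' algebra_simps)
  qed
  \<comment> \<open>The row degrees of \<open>f\<close> are equal, so the commutator vanishes at
    \<open>f\<close>. This second description of \<open>w\<close> makes it symmetric under the
    exchange of the two rows.\<close>
  have w': "rowop D i j h x = w x" for x
  proof -
    have "rowop D i j (rowop D j i f) x - rowop D j i (rowop D i j f) x = rowop D i i f x - rowop D j j f x"
      by (rule shift_op_commutator [OF poly]) (use V inj in auto)
    then show ?thesis using ij by (simp add: w_def g_def h_def rowop_diag)
  qed

  define \<tau> where "\<tau> = transpose i j"
  have \<tau>: "\<tau> permutes {..<n}" "\<tau> (\<tau> k) = k" for k
    using ij by (auto simp: \<tau>_def intro: permutes_swap_id)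
  have swap: "rowop D k l p (rowperm \<tau> x) = rowop D l k q x"
    if "p \<in> polyfun (grid n D)" "q \<in> polyfun (grid n D)" "\<And>x. p (rowperm \<tau> x) = q x"
      "(k, l) = (i, j) \<or> (k, l) = (j, i)" for p q k l x
  proof -
    have "rowadd k l t (rowperm \<tau> x) = rowperm \<tau> (rowadd l k t x)" for t
      using that(4) ij by (auto simp: rowadd_def rowperm_def \<tau>_def fun_eq_iff transpose_def)
    then have "rowop D k l p (rowperm \<tau> x) = 1 * 1 * rowop D l k q x"
      using that ij by (intro rowop_intertwine [OF that(1,2)]) auto
    then show ?thesis by simp
  qed
  have gs: "g (rowperm \<tau> x) = h x" for x
    unfolding g_def h_def by (intro swap poly) (auto simp: perm \<tau>)
  have ws: "w (rowperm \<tau> x) = w x" for x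
    unfolding w_def using swap [of g h j i x] gp hp gs w' by (auto simp: w_def)

  define f' where "f' = (\<lambda>x. f x - 1 / 2 * w x)"
  have f'p: "f' \<in> polyfun (grid n D)" unfolding f'_def by (intro polyfun_diff polyfun_cmult poly wp)
  have f's: "f' (rowperm \<tau> x) = f' x" for x by (simp add: f'_def ws perm \<tau>)
  have Ef': "rowop D i j f' = (\<lambda>x. 0)"
    unfolding f'_def by (simp only: shift_op_diff [OF poly polyfun_cmult [OF wp]] shift_op_cmult [OF wp] Ew)
      (simp add: g_def)
  have Ff': "rowop D j i f' = (\<lambda>x. 0)"
  proof
    fix x
    have "rowperm \<tau> (rowperm \<tau> x) = x" by (auto simp: rowperm_def \<tau> fun_eq_iff)
    then show "rowop D j i f' x = 0"
      using swap [of f' f' j i "rowperm \<tau> x"] f'p f's Ef' by simp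
  qed
  have wi: "w (rowscale (scale_one i c) x) = c ^ d * w x" if "c \<noteq> 0" for c x
    unfolding w_def using that ij gi by (intro down gp) auto
  \<comment> \<open>Annihilated by both operators, \<open>f'\<close> is invariant under both kinds
    of transvections. The product of these three is the exchange of the rows followed by a sign in
    row \<open>i\<close>, which costs \<open>(- 1) ^ d = - 1\<close>.\<close>
  have "f' x = f' (rowadd i j 1 (rowadd j i (- 1) (rowadd i j 1 x)))"
    using ij f'p Ef' Ff' by (simp add: rowadd_invariant)
  also have "rowadd i j 1 (rowadd j i (- 1) (rowadd i j 1 x)) = rowscale (scale_one i (- 1)) (rowperm \<tau> x)"
    using ij by (auto simp: rowadd_def rowperm_def rowscale_def \<tau>_def fun_eq_iff transpose_def)
  also have "f' \<dots> = (- 1) ^ d * f' (rowperm \<tau> x)"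
    using ij by (simp add: f'_def row1 wi algebra_simps)
  also have "\<dots> = - f' x" using \<open>odd d\<close> by (simp add: f's)
  finally have "f' x = 0" by simp
  then show ?thesis using w' [of x] by (simp add: f'_def h_def mult.commute)
qed

text \<open>The products of row operators act on \<open>f\<close> by \<open>d^2\<close> for equal
  indices and by 2 otherwise. The Casimir identity then compares two integer multiples of
  \<open>f x\<close>, which is nonzero.\<close>

lemma casimir_value:
  assumes "odd d" "0 < D" "\<mu> 0 \<le> d + 1" and f0: "f x \<noteq> 0"
  shows "int n * int d ^ 2 + 2 * int n * (int n - 1) - int n * int n * int d =
    (\<Sum>a<D. int (\<mu> a) ^ 2) + (\<Sum>a<D. \<Sum>b<D. if a < b then int (\<mu> a) - int (\<mu> b) else 0) - int D * (\<Sum>a<D. int (\<mu> a))"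
    (is "?L = ?R")
proof -
  have rr: "rowop D i j (rowop D j i f) x = (if i = j then of_nat d ^ 2 else 2) * f x" if "i < n" "j < n" for i j
  proof (cases "i = j")
    case True
    have "rowop D i i f = (\<lambda>x. of_nat d * f x)" using rowop_diag that by auto
    then show ?thesis
      using True that by (simp add: shift_op_cmult [OF poly] rowop_diag power2_eq_square)
  next
    case False
    then show ?thesis using rowop_rowop that assms by simp
  qed
  have "(\<Sum>i<n. \<Sum>j<n. rowop D i j (rowop D j i f) x) = (\<Sum>i<n. \<Sum>j<n. (if j = i then of_nat d ^ 2 - 2 else 0) + 2) * f x"
    by (auto simp: rr sum_distrib_right intro!: sum.cong)
  also have "\<dots> = of_int (int n * int d ^ 2 + 2 * int n * (int n - 1)) * f x"
    by (simp add: sum.distrib algebra_simps)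
  finally have L: "(\<Sum>i<n. \<Sum>j<n. rowop D i j (rowop D j i f) x) - of_nat n * (\<Sum>i<n. rowop D i i f x) = of_int ?L * f x"
    by (simp add: rowop_diag algebra_simps)
  have cast: "(if a < b then of_nat (\<mu> a) - of_nat (\<mu> b) else 0 :: complex) =
      of_int (if a < b then int (\<mu> a) - int (\<mu> b) else 0)" for a b by simp
  have "(\<Sum>a<D. \<Sum>b<D. colop n a b (colop n b a f) x) =
    (\<Sum>a<D. \<Sum>b<D. (if a = b then of_nat (\<mu> a) ^ 2 else 0) + (if a < b then of_nat (\<mu> a) - of_nat (\<mu> b) else 0)) * f x"
    by (simp add: colop_colop sum_distrib_right)
  also have "\<dots> = of_int ((\<Sum>a<D. int (\<mu> a) ^ 2) + (\<Sum>a<D. \<Sum>b<D. if a < b then int (\<mu> a) - int (\<mu> b) else 0)) * f x"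
    by (simp add: sum.distrib cast)
  finally have R: "(\<Sum>a<D. \<Sum>b<D. colop n a b (colop n b a f) x) - of_nat D * (\<Sum>a<D. colop n a a f x) = of_int ?R * f x"
    by (simp add: colop_diag algebra_simps sum_distrib_left)
  have "of_int ?L * f x = of_int ?R * f x"
    using casimir_eq [OF poly, of x] unfolding L R .
  then show ?thesis using f0 by (simp only: mult_cancel_right of_int_eq_iff) simp
qed

end

text \<open>Abel summation: \<open>\<delta>\<close> has nonpositive partial sums \<open>S k\<close> and \<open>c\<close> descends in steps of at
  least 2, so pairing them loses \<open>2 * S k\<close> at every step.\<close>

lemma abel_summation_bound:
  fixes \<delta> c :: "nat \<Rightarrow> int"
  assumes "\<And>k. k \<le> D \<Longrightarrow> (\<Sum>a<k. \<delta> a) \<le> 0" "\<And>k. k < D \<Longrightarrow> c (Suc k) + 2 \<le> c k"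
  shows "(\<Sum>a<Suc D. \<delta> a * c a) \<le> (\<Sum>a<Suc D. \<delta> a) * c D + 2 * (\<Sum>k<Suc D. \<Sum>a<k. \<delta> a)"
  using assms
proof (induction D)
  case (Suc D)
  define S where "S = (\<Sum>a<Suc D. \<delta> a)"
  have "S \<le> 0" using Suc.prems(1) [of "Suc D"] by (simp add: S_def)
  then have "S * c D \<le> S * (c (Suc D) + 2)"
    using Suc.prems(2) [of D] by (intro mult_left_mono_neg) auto
  moreover have "(\<Sum>a<Suc D. \<delta> a * c a) \<le> S * c D + 2 * (\<Sum>k<Suc D. \<Sum>a<k. \<delta> a)"
    unfolding S_def using Suc by simp
  moreover have "(\<Sum>a<Suc (Suc D). \<delta> a * c a) = (\<Sum>a<Suc D. \<delta> a * c a) + \<delta> (Suc D) * c (Suc D)"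
    "(\<Sum>a<Suc (Suc D). \<delta> a) = S + \<delta> (Suc D)"
    "(\<Sum>k<Suc (Suc D). \<Sum>a<k. \<delta> a) = (\<Sum>k<Suc D. \<Sum>a<k. \<delta> a) + S"
    by (simp_all add: S_def)
  ultimately show ?case by (simp only: distrib_right distrib_left)
qed simp

section \<open>Extremality of the weight in the dominance order\<close>

definition min_weight :: "nat \<Rightarrow> nat \<Rightarrow> nat" where
  "min_weight n k = (if k < n - 1 then n + 2 else if k = n - 1 then 2 else 0)"

lemma sum_min_weight:
  assumes "1 \<le> n"
  shows "(\<Sum>a<k. min_weight n a) = (if k < n then k * (n + 2) else n * (n + 1))"
proof (induction k)
  case (Suc k)
  obtain p where p: "n = Suc p" using assms by (cases n) auto
  consider "Suc k < n" | "Suc k = n" | "Suc k > n" by linarith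
  then show ?case
    by cases (use Suc p in \<open>auto simp: min_weight_def\<close>)
qed (use assms in simp)

text \<open>The same number as the row-side value \<open>n * d^2 + 2 * n * (n - 1) - n^2 * d\<close>
  at \<open>d = n + 1\<close>.\<close>

lemma sum_casimir_min_weight:
  assumes "1 \<le> n" "n \<le> D"
  shows "(\<Sum>a<D. int (min_weight n a) ^ 2 - (2 * int a + 1) * int (min_weight n a)) = 3 * int n ^ 2 - int n"
proof -
  obtain p where p: "n = Suc p" using assms by (cases n) auto
  let ?g = "\<lambda>a. int (min_weight n a) ^ 2 - (2 * int a + 1) * int (min_weight n a)"
  have "(\<Sum>a<D. ?g a) = (\<Sum>a<n. ?g a)"
    using assms by (intro sum.mono_neutral_right) (auto simp: min_weight_def)
  also have "\<dots> = (\<Sum>a<p. ?g a) + ?g p" by (simp add: p)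
  also have "(\<Sum>a<p. ?g a) = (\<Sum>a<p. (int n + 2) ^ 2 - (2 * int a + 1) * (int n + 2))"
    by (intro sum.cong) (auto simp: min_weight_def p)
  also have "\<dots> = int p * (int n + 2) ^ 2 - (int n + 2) * (\<Sum>a<p. 2 * int a + 1)"
    by (simp add: sum_subtractf sum_distrib_left mult.commute)
  also have "(\<Sum>a<p. 2 * int a + 1) = int p ^ 2"
    by (induction p) (auto simp: power2_eq_square algebra_simps)
  also have "?g p = 4 - (2 * int p + 1) * 2" by (simp add: min_weight_def p)
  finally show ?thesis by (simp add: p power2_eq_square algebra_simps)
qed

text \<open>\<open>\<mu> a\<close> occurs with a plus sign for the \<open>D - 1 - a\<close> later
  indices and with a minus sign for the \<open>a\<close> earlier ones; the coefficients are those of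
  the sum of the positive roots.\<close>

lemma sum_upper_differences:
  fixes \<mu> :: "nat \<Rightarrow> int"
  shows "(\<Sum>a<D. \<Sum>b<D. if a < b then \<mu> a - \<mu> b else 0) = (\<Sum>a<D. (int D - 1 - 2 * int a) * \<mu> a)"
proof -
  have c1: "(\<Sum>b<D. if a < b then \<mu> a else 0) = (int D - 1 - int a) * \<mu> a" if "a < D" for a
  proof -
    have "(\<Sum>b<D. if a < b then \<mu> a else 0) = (\<Sum>b\<in>{a<..<D}. \<mu> a)"
      by (rule sum.mono_neutral_cong_right) auto
    then show ?thesis using that by (simp add: of_nat_diff)
  qed
  have c2: "(\<Sum>a<D. if a < b then \<mu> b else 0) = int b * \<mu> b" if "b < D" for b
  proof -
    have "(\<Sum>a<D. if a < b then \<mu> b else 0) = (\<Sum>a\<in>{..<b}. \<mu> b)"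
      using that by (intro sum.mono_neutral_cong_right) auto
    then show ?thesis by simp
  qed
  have "(\<Sum>a<D. \<Sum>b<D. if a < b then \<mu> a - \<mu> b else 0) =
      (\<Sum>a<D. \<Sum>b<D. (if a < b then \<mu> a else 0) - (if a < b then \<mu> b else 0))"
    by (intro sum.cong) auto
  also have "\<dots> = (\<Sum>a<D. \<Sum>b<D. if a < b then \<mu> a else 0) - (\<Sum>b<D. \<Sum>a<D. if a < b then \<mu> b else 0)"
    by (simp add: sum_subtractf) (rule sum.swap)
  also have "\<dots> = (\<Sum>a<D. (int D - 1 - int a) * \<mu> a) - (\<Sum>b<D. int b * \<mu> b)"
    by (intro arg_cong2 [where f = "(-)"] sum.cong) (auto simp: c1 c2)
  finally show ?thesis by (simp add: sum_subtractf [symmetric] algebra_simps)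
qed

text \<open>\<open>\<mu>\<close> is dominated by \<open>min_weight n\<close>, and a strict descent
  in dominance would strictly lower the Casimir value. Writing the difference of the two values as a
  sum of \<open>\<delta> a * c a\<close>, by the difference of two squares, makes it accessible to
  Abel summation.\<close>

lemma min_weight_extremal:
  fixes \<mu> :: "nat \<Rightarrow> nat"
  assumes n: "1 \<le> n" "n \<le> D" and anti: "\<And>a b. a \<le> b \<Longrightarrow> \<mu> b \<le> \<mu> a" and "\<mu> 0 \<le> n + 2"
    and total: "(\<Sum>k<D. \<mu> k) = n * (n + 1)"
    and casimir: "(\<Sum>a<D. int (\<mu> a) ^ 2 - (2 * int a + 1) * int (\<mu> a)) = 3 * int n ^ 2 - int n"
    and k: "k < D"
  shows "\<mu> k = min_weight n k"
proof -
  define \<delta> where "\<delta> a = int (\<mu> a) - int (min_weight n a)" for a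
  define c where "c a = int (\<mu> a) + int (min_weight n a) - (2 * int a + 1)" for a
  define S where "S k = (\<Sum>a<k. \<delta> a)" for k
  have S: "S k = int (\<Sum>a<k. \<mu> a) - int (\<Sum>a<k. min_weight n a)" for k
    by (simp add: S_def \<delta>_def sum_subtractf)
  have S_le: "S k \<le> 0" if "k \<le> D" for k
  proof (cases "k < n")
    case True
    have "(\<Sum>a<k. \<mu> a) \<le> (\<Sum>a<k. n + 2)"
      using anti [of 0] \<open>\<mu> 0 \<le> n + 2\<close> by (intro sum_mono) (meson le_trans zero_le)
    then show ?thesis
      using True n by (simp only: S sum_min_weight if_True sum_constant card_lessThan of_nat_id of_nat_le_iff diff_le_0_iff_le)
  next
    case False
    have "(\<Sum>a<k. \<mu> a) \<le> (\<Sum>a<D. \<mu> a)" using that by (intro sum_mono2) auto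
    then show ?thesis
      using False n total by (simp only: S sum_min_weight if_False of_nat_le_iff diff_le_0_iff_le)
  qed
  have SD: "S D = 0" using n total sum_min_weight [OF n(1), of D] by (simp only: S) simp
  obtain D' where D': "D = Suc D'" using n by (cases D) auto
  have mw: "min_weight n (Suc a) \<le> min_weight n a" for a by (auto simp: min_weight_def)
  have "(\<Sum>a<D. \<delta> a * c a) \<le> S D * c D' + 2 * (\<Sum>k<D. S k)"
    unfolding D' S_def
  proof (rule abel_summation_bound)
    show "(\<Sum>a<k. \<delta> a) \<le> 0" if "k \<le> D'" for k using S_le [of k] that by (simp add: S_def D')
    \<comment> \<open>The term \<open>2 * int a + 1\<close> alone yields the descent by 2; the two
      weights are antitone.\<close>
    show "c (Suc k) + 2 \<le> c k" for k using anti [of k "Suc k"] mw [of k] by (simp add: c_def)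
  qed
  moreover have "(\<Sum>a<D. \<delta> a * c a) = 0"
  proof -
    have "(\<Sum>a<D. \<delta> a * c a) = (\<Sum>a<D. int (\<mu> a) ^ 2 - (2 * int a + 1) * int (\<mu> a)) -
        (\<Sum>a<D. int (min_weight n a) ^ 2 - (2 * int a + 1) * int (min_weight n a))"
      unfolding sum_subtractf [symmetric]
      by (intro sum.cong) (auto simp: \<delta>_def c_def power2_eq_square algebra_simps)
    then show ?thesis by (simp only: casimir sum_casimir_min_weight [OF n])
  qed
  \<comment> \<open>The Casimir difference 0 is at most twice a sum of nonpositive numbers, so every
    partial sum \<open>S k\<close> is 0.\<close>
  ultimately have "0 \<le> (\<Sum>k<D. S k)" by (simp add: SD)
  then have "0 \<le> - (\<Sum>k<D. - S k)" by (simp add: sum_negf)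
  then have "(\<Sum>k<D. - S k) = 0" using S_le by (intro antisym sum_nonneg) auto
  then have "S k = 0" if "k < D" for k
    using that S_le by (subst (asm) sum_nonneg_eq_0_iff) auto
  then have "S k = 0" if "k \<le> D" for k using that SD by (cases "k = D") auto
  then have "S k = 0" "S (Suc k) = 0" using k by auto
  then have "\<delta> k = 0" by (simp add: S_def)
  then show ?thesis by (simp add: \<delta>_def)
qed

context hwfun
begin

lemma weight_eq_min_weight:
  assumes "even n" "1 \<le> n" "n \<le> D" "d = n + 1" and anti: "\<And>a b. a \<le> b \<Longrightarrow> \<mu> b \<le> \<mu> a" and "\<mu> 0 \<le> n + 2"
    and "f x \<noteq> 0" "k < D"
  shows "\<mu> k = min_weight n k"
proof (rule min_weight_extremal [where D = D])
  show tot: "(\<Sum>k<D. \<mu> k) = n * (n + 1)" using weight_sum assms by simp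
  then have tot': "(\<Sum>k<D. int (\<mu> k)) = int n * (int n + 1)" by (metis of_nat_1 of_nat_add of_nat_mult of_nat_sum)
  have "int n * int d ^ 2 + 2 * int n * (int n - 1) - int n * int n * int d =
    (\<Sum>a<D. int (\<mu> a) ^ 2) + (\<Sum>a<D. (int D - 1 - 2 * int a) * int (\<mu> a)) - int D * (\<Sum>a<D. int (\<mu> a))"
    using casimir_value [of x] assms by (simp add: sum_upper_differences)
  \<comment> \<open>The dimension cancels:
    \<open>(D - 1 - 2 * a) - D = - (2 * a + 1)\<close>.\<close>
  also have "\<dots> = (\<Sum>a<D. int (\<mu> a) ^ 2 - (2 * int a + 1) * int (\<mu> a))"
    by (simp add: sum_distrib_left sum.distrib [symmetric] sum_subtractf [symmetric] algebra_simps)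
  finally show "(\<Sum>a<D. int (\<mu> a) ^ 2 - (2 * int a + 1) * int (\<mu> a)) = 3 * int n ^ 2 - int n"
    using \<open>d = n + 1\<close> by (simp add: power2_eq_square algebra_simps)
qed (use assms in auto)

text \<open>On the first \<open>n - 1\<close> columns a function of weight \<open>min_weight n\<close> is invariant under the
  special linear group.\<close>

lemma lower_unip:
  assumes "k < s" "s < D" and eq: "\<mu> k = \<mu> s"
  shows "f (coladd s k t x) = f x"
proof -
  have "\<exists>Q. \<forall>t. coladd a b t y v = poly Q t" for a b y v
    by (cases "snd v = b")
      (auto simp: coladd_def case_prod_beta intro: exI [of _ "[:y v, y (fst v, a):]"] exI [of _ "[:y v:]"])
  then have curve: "\<exists>P. \<forall>t. f (coladd a b t y) = poly P t" for a b y
    using polyfun_curve [OF poly, of "\<lambda>t. coladd a b t y"] by blast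
  obtain P where P: "\<And>t. f (coladd s k t x) = poly P t" using curve by blast
  define z where "z = (\<lambda>(r, j). if j = k then x (r, s) else if j = s then x (r, k) else x (r, j))"
  obtain R where R: "\<And>t. f (coladd s k t z) = poly R t" using curve by blast
  define N where "N = \<mu> s"
  \<comment> \<open>An identity in \<open>SL\<^sub>2\<close> of the columns \<open>k\<close> and
    \<open>s\<close>: up to an upper transvection and a diagonal matrix, the lower transvection with
    parameter \<open>a\<close> is the one with parameter \<open>1 / a\<close> applied after
    exchanging the columns. The equality of the two weights cancels the powers of
    \<open>a\<close>.\<close>
  have PR: "poly P a = (- 1) ^ N * poly R (1 / a)" if "a \<noteq> 0" for a
  proof -
    define y where "y = coladd s k a x"
    have "f y = f (coladd k s (- 1 / a) y)" using assms by (simp add: unip)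
    also have "coladd k s (- 1 / a) y =
      colscale (scale_one k a) (colscale (scale_one s (- 1 / a)) (coladd s k (1 / a) z))"
      using \<open>k < s\<close> that by (auto simp: y_def z_def coladd_def colscale_def fun_eq_iff field_simps)
    also have "f \<dots> = a ^ N * ((- 1 / a) ^ N * f (coladd s k (1 / a) z))"
      using assms that by (simp add: col1 N_def)
    also have "\<dots> = (- 1) ^ N * f (coladd s k (1 / a) z)"
      using that by (simp add: field_simps flip: power_mult_distrib)
    finally show ?thesis by (simp add: P R y_def)
  qed
  have "degree P = 0"
  proof (rule ccontr)
    assume "degree P \<noteq> 0"
    \<comment> \<open>A polynomial in \<open>a\<close> that is also a polynomial in
      \<open>1 / a\<close> is constant; multiplication by \<open>a ^ degree R\<close> turns this
      into a comparison of degrees.\<close>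
    define S where "S = monom 1 (degree R) * P - smult ((- 1) ^ N) (reflect_poly R)"
    have "poly S a = 0" if "a \<notin> {0}" for a
      using that PR [of a] poly_reflect_poly_nz [of a R]
      by (simp add: S_def poly_monom inverse_eq_divide)
    then have "S = 0" by (intro poly_zero_if_cofinite [of "{0}"]) auto
    then have "monom 1 (degree R) * P = smult ((- 1) ^ N) (reflect_poly R)" by (simp add: S_def)
    then have "degree (monom 1 (degree R) * P) \<le> degree R"
      by (metis degree_smult_le degree_reflect_poly_le le_trans)
    moreover have "P \<noteq> 0" using \<open>degree P \<noteq> 0\<close> by auto
    ultimately show False using \<open>degree P \<noteq> 0\<close> by (simp add: degree_mult_eq degree_monom_eq)
  qed
  then obtain c where "P = [:c:]" by (rule degree_eq_zeroE)
  then show ?thesis using P [of t] P [of 0] by simp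
qed

end

text \<open>A matrix whose orbit under row scalings and the parabolic group of column operations is dense
  in the first \<open>n\<close> columns.\<close>

definition base_matrix :: "nat \<Rightarrow> nat \<times> nat \<Rightarrow> complex" where
  "base_matrix n = (\<lambda>(i, k). if i < n - 1 then (if k = i then 1 else 0) else (if k < n then 1 else 0))"

text \<open>Generic matrices are carried to \<open>base_matrix n\<close>, up to the columns of index
  at least \<open>n\<close>, by operations that change \<open>f\<close> by nonzero factors at most.
  The exceptional matrices are reached along polynomial curves.\<close>

lemma hwfun_min_weight_zero:
  assumes hw: "hwfun n D d (min_weight n) f" and n: "1 \<le> n" "n \<le> D" and zero: "f (base_matrix n) = 0"
  shows "f x = 0"
proof -
  interpret hwfun n D d "min_weight n" f by (rule hw)
  \<comment> \<open>The columns of index at least \<open>n\<close> have weight 0, so scaling them by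
    \<open>t\<close> has no effect on \<open>f\<close>; at \<open>t = 0\<close> they
    disappear.\<close>
  have trunc: "f (\<lambda>(r, k). if k < n then y (r, k) else 0) = f y" for y
  proof -
    define \<gamma> where "\<gamma> t = (\<lambda>(r, k). if k < n then y (r, k) else t * y (r, k))" for t :: complex
    have "\<exists>Q. \<forall>t. \<gamma> t v = poly Q t" for v
      by (cases "snd v < n")
        (auto simp: \<gamma>_def case_prod_beta intro: exI [of _ "[:y v:]"] exI [of _ "[:0, y v:]"])
    then obtain P where P: "\<And>t. f (\<gamma> t) = poly P t"
      using polyfun_curve [OF poly, of \<gamma>] by blast
    have "f (\<gamma> t) = f y" if "t \<noteq> 0" for t
    proof -
      let ?e = "\<lambda>k. if k < n then 1 else t"
      have "\<gamma> t = colscale ?e y" by (auto simp: \<gamma>_def colscale_def)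
      then have "f (\<gamma> t) = (\<Prod>k<D. ?e k ^ min_weight n k) * f y" using that by (simp add: col)
      moreover have "(\<Prod>k<D. ?e k ^ min_weight n k) = 1"
        using n by (intro prod.neutral) (auto simp: min_weight_def)
      ultimately show ?thesis by simp
    qed
    then have "P - [:f y:] = 0" by (intro poly_zero_if_cofinite [of "{0}"]) (auto simp: P)
    then have "f (\<gamma> 0) = f y" by (simp add: P)
    moreover have "\<gamma> 0 = (\<lambda>(r, k). if k < n then y (r, k) else 0)" by (auto simp: \<gamma>_def)
    ultimately show ?thesis by simp
  qed

  have colinv: "f (coladd s k t y) = f y" if "s < n - 1" "k < D" "k \<noteq> s" for s k t y
  proof (cases "s < k")
    case False
    then show ?thesis using that n by (intro lower_unip) (auto simp: min_weight_def)
  qed (use that unip in auto)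

  \<comment> \<open>\<open>unit s\<close> makes the rows from \<open>s\<close> to
    \<open>n - 2\<close> unit vectors. The induction weakens this hypothesis by one row per step,
    until nothing is required at \<open>s = n - 1\<close>.\<close>
  define unit where "unit s y \<longleftrightarrow> (\<forall>i k. s \<le> i \<longrightarrow> i < n - 1 \<longrightarrow> k < D \<longrightarrow> y (i, k) = (if k = i then 1 else 0))"
    for s and y :: "nat \<times> nat \<Rightarrow> complex"
  have "\<forall>y. unit s y \<longrightarrow> f y = 0" if "s \<le> n - 1" for s
    using that
  proof (induction s)
    case 0
    show ?case
    proof (intro allI impI)
      fix y assume y: "unit 0 y"
      \<comment> \<open>The last row moves towards the row of ones, so its first \<open>n\<close>
        entries are nonzero for all but finitely many \<open>t\<close>.\<close>
      define \<gamma> where "\<gamma> t = (\<lambda>(r, k). if r = n - 1 \<and> k < n then y (r, k) + t * (1 - y (r, k)) else y (r, k))"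
        for t :: complex
      define w where "w t k = y (n - 1, k) + t * (1 - y (n - 1, k))" for t k
      define T where "T = (\<Union>k<n. {t. w t k = 0})"
      have "f (\<gamma> 0) = 0"
      proof (rule polyfun_curve_zero [OF poly, where \<gamma> = \<gamma>])
        show "\<exists>Q. \<forall>t. \<gamma> t v = poly Q t" for v
          by (cases "fst v = n - 1 \<and> snd v < n")
            (auto simp: \<gamma>_def case_prod_beta intro: exI [of _ "[:y (n - 1, snd v), 1 - y (n - 1, snd v):]"] exI [of _ "[:y v:]"])
        have "finite {t. w t k = 0}" for k
        proof -
          have "{t. w t k = 0} = {t. poly [:y (n - 1, k), 1 - y (n - 1, k):] t = 0}" by (auto simp: w_def)
          moreover have "[:y (n - 1, k), 1 - y (n - 1, k):] \<noteq> 0" by auto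
          ultimately show ?thesis using poly_roots_finite by metis
        qed
        then show "finite T" by (simp add: T_def)
        fix t assume "t \<notin> T"
        then have nz: "w t k \<noteq> 0" if "k < n" for k using that by (auto simp: T_def)
        \<comment> \<open>The column factors turn the row of ones into the last row
          \<open>w t\<close>; the row factors restore the unit vectors above it.\<close>
        let ?e = "\<lambda>k. if k < n then w t k else 1"
        let ?c = "\<lambda>r. if r < n - 1 then 1 / w t r else 1"
        have "f (\<gamma> t) = f (\<lambda>(r, k). if k < n then \<gamma> t (r, k) else 0)" by (rule trunc [symmetric])
        also have "\<dots> = f (rowscale ?c (colscale ?e (base_matrix n)))"
          by (rule polyfun_cong [OF poly])
            (use y nz n in \<open>auto simp: \<gamma>_def rowscale_def colscale_def base_matrix_def w_def unit_def\<close>)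
        also have "\<dots> = 0"
          by (subst row, subst col) (use nz zero in auto)
        finally show "f (\<gamma> t) = 0" .
      qed
      moreover have "\<gamma> 0 = y" by (auto simp: \<gamma>_def)
      ultimately show "f y = 0" by simp
    qed
  next
    case (Suc s)
    show ?case
    proof (intro allI impI)
      fix y assume y: "unit (Suc s) y"
      show "f y = 0"
      proof (rule polyfun_zero_var [OF poly, where v = "(s, s)" and ?t0.0 = 0])
        fix t :: complex assume "t \<noteq> 0"
        define z where "z = y((s, s) := t)"
        \<comment> \<open>Column \<open>s\<close> clears the rest of row \<open>s\<close>. The unit
          rows below have 0 in column \<open>s\<close> and stay as they are.\<close>
        define z' where "z' = (\<lambda>(r, k). if k \<in> {..<D} - {s} then z (r, k) + (- (z (s, k) / t)) * z (r, s) else z (r, k))"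
        have "f z' = f z"
          unfolding z'_def by (rule coladd_multi) (use Suc.prems in \<open>auto intro: colinv\<close>)
        moreover have "unit s (colscale (scale_one s (1 / t)) z')"
          unfolding unit_def
        proof (intro allI impI)
          fix i k assume ik: "s \<le> i" "i < n - 1" "k < D"
          have "s < D" using Suc.prems n by simp
          show "colscale (scale_one s (1 / t)) z' (i, k) = (if k = i then 1 else 0)"
          proof (cases "i = s")
            case True
            then show ?thesis using ik \<open>t \<noteq> 0\<close> by (auto simp: colscale_def z'_def z_def)
          next
            case False
            then have "y (i, j) = (if j = i then 1 else 0)" if "j < D" for j
              using y ik that by (simp add: unit_def)
            then show ?thesis using False ik \<open>s < D\<close> by (auto simp: colscale_def z'_def z_def)
          qed
        qed
        then have "f (colscale (scale_one s (1 / t)) z') = 0" using Suc by simp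
        then have "f z' = 0" using col1 [of s "1 / t" z'] Suc.prems n \<open>t \<noteq> 0\<close> by auto
        ultimately show "f (y((s, s) := t)) = 0" by (simp add: z_def)
      qed
    qed
  qed
  from this [of "n - 1"] show ?thesis by (auto simp: unit_def)
qed

text \<open>The combination of \<open>f\<close> and \<open>g\<close> that vanishes at
  \<open>base_matrix n\<close> is again a highest weight function of this weight, hence
  zero.\<close>

lemma hwfun_min_weight_unique:
  assumes "hwfun n D d (min_weight n) f" "hwfun n D d (min_weight n) g" "1 \<le> n" "n \<le> D"
  shows "g (base_matrix n) * f x = f (base_matrix n) * g x"
proof -
  interpret f: hwfun n D d "min_weight n" f by fact
  interpret g: hwfun n D d "min_weight n" g by fact
  define h where "h = (\<lambda>x. g (base_matrix n) * f x - f (base_matrix n) * g x)"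
  have "hwfun n D d (min_weight n) h"
  proof
    show "h \<in> polyfun (grid n D)"
      unfolding h_def by (intro polyfun_diff polyfun_cmult f.poly g.poly)
  qed (simp_all add: h_def f.row g.row f.perm g.perm f.unip g.unip f.col g.col algebra_simps)
  then have "h x = 0" by (rule hwfun_min_weight_zero) (use assms in \<open>auto simp: h_def\<close>)
  then show ?thesis by (simp add: h_def)
qed

section \<open>The determinantal highest weight function\<close>

text \<open>The Leibniz formula for a size \<open>n\<close> that is an ordinary number; further
  columns of the grid are ignored.\<close>

definition mdet :: "nat \<Rightarrow> (nat \<times> nat \<Rightarrow> complex) \<Rightarrow> complex" where
  "mdet n x = (\<Sum>p | p permutes {..<n}. of_int (sign p) * (\<Prod>i<n. x (i, p i)))"

definition last_col :: "nat \<Rightarrow> nat \<Rightarrow> (nat \<times> nat \<Rightarrow> complex) \<Rightarrow> nat \<times> nat \<Rightarrow> complex" where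
  "last_col n i x = (\<lambda>(r, k). if k = n - 1 then (if r = i then 1 else 0) else x (r, k))"

text \<open>The determinant of \<open>last_col n i x\<close> is, up to sign, the minor of the first \<open>n - 1\<close> columns that
  omits row \<open>i\<close>; in this form the behaviour under row permutations needs no case distinctions.\<close>

definition min_hwf :: "nat \<Rightarrow> (nat \<times> nat \<Rightarrow> complex) \<Rightarrow> complex" where
  "min_hwf n x = mdet n x ^ 2 * (\<Prod>i<n. mdet n (last_col n i x))"

text \<open>Expansion along the replaced column. Neither row \<open>i\<close> nor column
  \<open>n - 1\<close> of \<open>x\<close> is left in this form, from which polynomiality and
  degrees are read off.\<close>

lemma det_last_col_sum:
  assumes "i < n"
  shows "mdet n (last_col n i x) =
    (\<Sum>p | p permutes {..<n} \<and> p i = n - 1. of_int (sign p) * (\<Prod>r\<in>{..<n} - {i}. x (r, p r)))"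
proof -
  have "(\<Prod>r<n. last_col n i x (r, p r)) = (if p i = n - 1 then \<Prod>r\<in>{..<n} - {i}. x (r, p r) else 0)"
    if p: "p permutes {..<n}" for p
  proof (cases "p i = n - 1")
    case True
    have "(\<Prod>r<n. last_col n i x (r, p r)) =
        last_col n i x (i, p i) * (\<Prod>r\<in>{..<n} - {i}. last_col n i x (r, p r))"
      using assms by (simp add: prod.remove)
    also have "last_col n i x (i, p i) = 1" using True by (simp add: last_col_def)
    also have "(\<Prod>r\<in>{..<n} - {i}. last_col n i x (r, p r)) = (\<Prod>r\<in>{..<n} - {i}. x (r, p r))"
    proof (rule prod.cong [OF refl])
      fix r assume "r \<in> {..<n} - {i}"
      then have "p r \<noteq> n - 1" using True permutes_inj [OF p] by (metis DiffD2 inj_eq insertI1)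
      then show "last_col n i x (r, p r) = x (r, p r)" by (simp add: last_col_def)
    qed
    finally show ?thesis using True by simp
  next
    case False
    obtain r where r: "p r = n - 1" using permutes_surj [OF p] by (metis surjD)
    then have "r < n" using permutes_in_image [OF p, of r] assms by auto
    moreover have "last_col n i x (r, p r) = 0" using r False by (auto simp: last_col_def)
    ultimately have "(\<Prod>r<n. last_col n i x (r, p r)) = 0" by (intro prod_zero) auto
    then show ?thesis using False by simp
  qed
  then have "mdet n (last_col n i x) = (\<Sum>p | p permutes {..<n}.
      if p i = n - 1 then of_int (sign p) * (\<Prod>r\<in>{..<n} - {i}. x (r, p r)) else 0)"
    unfolding mdet_def by (intro sum.cong) auto
  also have "\<dots> = (\<Sum>p | p permutes {..<n} \<and> p i = n - 1. of_int (sign p) * (\<Prod>r\<in>{..<n} - {i}. x (r, p r)))"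
    by (rule sum.mono_neutral_cong_right) (auto intro: finite_permutations)
  finally show ?thesis .
qed

lemma det_mat_cong:
  assumes "\<And>i k. i < n \<Longrightarrow> k < n \<Longrightarrow> x (i, k) = y (i, k)"
  shows "mdet n x = mdet n y"
  unfolding mdet_def
proof (intro sum.cong refl arg_cong2 [where f = "(*)"] prod.cong)
  fix p i assume "p \<in> {p. p permutes {..<n}}" "i \<in> {..<n}"
  then have "p i < n" using permutes_in_image [of p "{..<n}" i] by auto
  then show "x (i, p i) = y (i, p i)" using assms \<open>i \<in> {..<n}\<close> by simp
qed

lemma det_coladd:
  assumes "a < b"
  shows "mdet n (coladd a b t x) = mdet n x"
proof (cases "b < n")
  case True
  let ?\<phi> = "\<lambda>k. if k = b then a else k"
  let ?P = "{p. p permutes {..<n}}"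
  define Q where "Q = (\<Sum>p\<in>?P. of_int (sign p) * (\<Prod>i<n. x (i, ?\<phi> (p i))))"
  have "(\<Prod>i<n. coladd a b t x (i, p i)) = (\<Prod>i<n. x (i, p i)) + t * (\<Prod>i<n. x (i, ?\<phi> (p i)))"
    if p: "p permutes {..<n}" for p
  proof -
    obtain r where r: "p r = b" using permutes_surj [OF p] by (metis surjD)
    then have "r \<in> {..<n}" using permutes_in_image [OF p, of r] True by auto
    then have rem: "(\<Prod>i<n. h i) = h r * (\<Prod>i\<in>{..<n} - {r}. h i)" for h :: "nat \<Rightarrow> complex"
      by (simp add: prod.remove)
    have "p i \<noteq> b" if "i \<noteq> r" for i using that r permutes_inj [OF p] by (metis injD)
    then have "(\<Prod>i\<in>{..<n} - {r}. coladd a b t x (i, p i)) = (\<Prod>i\<in>{..<n} - {r}. x (i, p i))"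
      "(\<Prod>i\<in>{..<n} - {r}. x (i, ?\<phi> (p i))) = (\<Prod>i\<in>{..<n} - {r}. x (i, p i))"
      by (auto simp: coladd_def intro!: prod.cong)
    then show ?thesis
      unfolding rem [of "\<lambda>i. coladd a b t x (i, p i)"] rem [of "\<lambda>i. x (i, p i)"] rem [of "\<lambda>i. x (i, ?\<phi> (p i))"]
      by (simp add: r coladd_def algebra_simps)
  qed
  then have "mdet n (coladd a b t x) = mdet n x + t * Q"
    unfolding mdet_def Q_def sum_distrib_left sum.distrib [symmetric]
    by (intro sum.cong) (auto simp: algebra_simps)
  \<comment> \<open>\<open>Q\<close> is a determinant whose columns \<open>a\<close> and
    \<open>b\<close> coincide; composing with the transposition gives
    \<open>Q = - Q\<close>.\<close>
  moreover have "Q = 0"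
  proof -
    let ?\<tau> = "transpose a b"
    have \<tau>: "?\<tau> permutes {..<n}" using True assms by (intro permutes_swap_id) auto
    have "Q = (\<Sum>p\<in>?P. of_int (sign (?\<tau> \<circ> p)) * (\<Prod>i<n. x (i, ?\<phi> ((?\<tau> \<circ> p) i))))"
      unfolding Q_def by (rule setum_permutations_compose_left [OF \<tau>])
    also have "\<dots> = (\<Sum>p\<in>?P. - (of_int (sign p) * (\<Prod>i<n. x (i, ?\<phi> (p i)))))"
    proof (rule sum.cong [OF refl])
      fix p assume "p \<in> ?P"
      then have "sign (?\<tau> \<circ> p) = - sign p"
        using assms \<tau> by (subst sign_compose) (auto simp: sign_swap_id intro: permutes_imp_permutation)
      moreover have "?\<phi> ((?\<tau> \<circ> p) i) = ?\<phi> (p i)" for i by (auto simp: transpose_def)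
      ultimately show "of_int (sign (?\<tau> \<circ> p)) * (\<Prod>i<n. x (i, ?\<phi> ((?\<tau> \<circ> p) i))) =
          - (of_int (sign p) * (\<Prod>i<n. x (i, ?\<phi> (p i))))"
        by (simp only: of_int_minus mult_minus_left)
    qed
    finally show ?thesis by (simp add: Q_def sum_negf)
  qed
  ultimately show ?thesis by simp
next
  case False
  then show ?thesis by (intro det_mat_cong) (auto simp: coladd_def)
qed

lemma det_lower_triangular:
  assumes "\<And>i j. i < j \<Longrightarrow> j < n \<Longrightarrow> x (i, j) = 0"
  shows "mdet n x = (\<Prod>i<n. x (i, i))"
proof -
  have "mdet n x = (\<Sum>p\<in>{id}. of_int (sign p) * (\<Prod>i<n. x (i, p i)))"
    unfolding mdet_def
  proof (rule sum.mono_neutral_right)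
    show "finite {p. p permutes {..<n}}" by (simp add: finite_permutations)
    show "{id} \<subseteq> {p. p permutes {..<n}}" by (simp add: permutes_id)
    show "\<forall>p\<in>{p. p permutes {..<n}} - {id}. of_int (sign p) * (\<Prod>i<n. x (i, p i)) = 0"
    proof
      fix p assume p: "p \<in> {p. p permutes {..<n}} - {id}"
      then have "\<not> (\<forall>i\<in>{..<n}. p i \<le> i)" using permutes_natset_le [of p "{..<n}"] by blast
      then obtain i where i: "i < n" "i < p i" by (auto simp: not_le)
      then have "p i < n" using permutes_in_image [of p "{..<n}" i] p by auto
      then have "x (i, p i) = 0" using assms i by simp
      then have "(\<Prod>i<n. x (i, p i)) = 0" using i by (intro prod_zero) auto
      then show "of_int (sign p) * (\<Prod>i<n. x (i, p i)) = 0" by simp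
    qed
  qed
  then show ?thesis by simp
qed

lemma polyfun_det:
  assumes "n \<le> D"
  shows "(\<lambda>x. mdet n x) \<in> polyfun (grid n D)"
  unfolding mdet_def [abs_def]
proof (intro polyfun_sum polyfun.mult polyfun_prod polyfun.const polyfun.var)
  fix p i assume "p \<in> {p. p permutes {..<n}}" "i \<in> {..<n}"
  then have "p i < n" using permutes_in_image [of p "{..<n}" i] by auto
  then show "(i, p i) \<in> grid n D" using \<open>i \<in> {..<n}\<close> assms by simp
qed

lemma polyfun_det_last_col:
  assumes "n \<le> D" "i < n"
  shows "(\<lambda>x. mdet n (last_col n i x)) \<in> polyfun (grid n D)"
  unfolding det_last_col_sum [OF assms(2)]
proof (intro polyfun_sum polyfun.mult polyfun_prod polyfun.const polyfun.var)
  fix p r assume "p \<in> {p. p permutes {..<n} \<and> p i = n - 1}" "r \<in> {..<n} - {i}"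
  then have "p r < n" using permutes_in_image [of p "{..<n}" r] by auto
  then show "(r, p r) \<in> grid n D" using \<open>r \<in> {..<n} - {i}\<close> assms by simp
qed

lemma det_rowscale: "mdet n (rowscale c x) = (\<Prod>i<n. c i) * mdet n x"
  unfolding mdet_def sum_distrib_left
  by (intro sum.cong) (auto simp: rowscale_def prod.distrib)

lemma det_last_col_rowscale:
  "i < n \<Longrightarrow> mdet n (last_col n i (rowscale c x)) = (\<Prod>r\<in>{..<n} - {i}. c r) * mdet n (last_col n i x)"
  unfolding det_last_col_sum sum_distrib_left
  by (intro sum.cong) (auto simp: rowscale_def prod.distrib)

lemma det_colscale: "mdet n (colscale e x) = (\<Prod>k<n. e k) * mdet n x"
  unfolding mdet_def sum_distrib_left
proof (intro sum.cong refl)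
  fix p assume "p \<in> {p. p permutes {..<n}}"
  then have "(\<Prod>i<n. e (p i)) = (\<Prod>k<n. e k)" using prod.permute [of p "{..<n}" e] by simp
  then show "of_int (sign p) * (\<Prod>i<n. colscale e x (i, p i)) = (\<Prod>k<n. e k) * (of_int (sign p) * (\<Prod>i<n. x (i, p i)))"
    by (simp add: colscale_def prod.distrib)
qed

lemma det_last_col_colscale:
  assumes "i < n"
  shows "mdet n (last_col n i (colscale e x)) = (\<Prod>k<n - 1. e k) * mdet n (last_col n i x)"
  unfolding det_last_col_sum [OF assms] sum_distrib_left
proof (intro sum.cong refl)
  fix p assume p: "p \<in> {p. p permutes {..<n} \<and> p i = n - 1}"
  then have "bij_betw p ({..<n} - {i}) ({..<n} - {n - 1})"
    using assms by (intro bij_betw_DiffI permutes_imp_bij) (auto simp: bij_betw_def)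
  moreover have "{..<n} - {n - 1} = {..<n - 1}" by auto
  ultimately have "(\<Prod>r\<in>{..<n} - {i}. e (p r)) = (\<Prod>k<n - 1. e k)"
    by (simp add: prod.reindex_bij_betw)
  then show "of_int (sign p) * (\<Prod>r\<in>{..<n} - {i}. colscale e x (r, p r)) =
      (\<Prod>k<n - 1. e k) * (of_int (sign p) * (\<Prod>r\<in>{..<n} - {i}. x (r, p r)))"
    by (simp add: colscale_def prod.distrib)
qed

lemma det_rowperm:
  assumes \<sigma>: "\<sigma> permutes {..<n}"
  shows "mdet n (rowperm \<sigma> x) = of_int (sign \<sigma>) * mdet n x"
proof -
  let ?P = "{p. p permutes {..<n}}"
  have "mdet n (rowperm \<sigma> x) = (\<Sum>p\<in>?P. of_int (sign (p \<circ> \<sigma>)) * (\<Prod>i<n. rowperm \<sigma> x (i, (p \<circ> \<sigma>) i)))"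
    unfolding mdet_def by (rule sum_permutations_compose_right [OF \<sigma>])
  also have "\<dots> = (\<Sum>p\<in>?P. of_int (sign \<sigma>) * (of_int (sign p) * (\<Prod>i<n. x (i, p i))))"
  proof (rule sum.cong [OF refl])
    fix p assume "p \<in> ?P"
    then have "sign (p \<circ> \<sigma>) = sign p * sign \<sigma>"
      using \<sigma> by (intro sign_compose) (auto intro: permutes_imp_permutation)
    moreover have "(\<Prod>i<n. rowperm \<sigma> x (i, (p \<circ> \<sigma>) i)) = (\<Prod>i<n. x (i, p i))"
      using prod.permute [OF \<sigma>, of "\<lambda>i. x (i, p i)"] by (simp add: rowperm_def comp_def)
    ultimately show "of_int (sign (p \<circ> \<sigma>)) * (\<Prod>i<n. rowperm \<sigma> x (i, (p \<circ> \<sigma>) i)) =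
        of_int (sign \<sigma>) * (of_int (sign p) * (\<Prod>i<n. x (i, p i)))"
      by simp
  qed
  finally show ?thesis by (simp add: mdet_def sum_distrib_left)
qed

lemma min_hwf_rowperm:
  assumes "\<sigma> permutes {..<n}" "even n"
  shows "min_hwf n (rowperm \<sigma> x) = min_hwf n x"
proof -
  \<comment> \<open>The unit vector of the replaced column is subject to the permutation, too: the
    one at \<open>i\<close> comes from the one at \<open>\<sigma> i\<close>.\<close>
  have "last_col n i (rowperm \<sigma> x) = rowperm \<sigma> (last_col n (\<sigma> i) x)" for i
    using permutes_inj [OF assms(1)] by (auto simp: last_col_def rowperm_def fun_eq_iff dest: injD)
  then have "(\<Prod>i<n. mdet n (last_col n i (rowperm \<sigma> x))) =
      of_int (sign \<sigma>) ^ n * (\<Prod>i<n. mdet n (last_col n (\<sigma> i) x))"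
    by (simp add: det_rowperm assms prod.distrib)
  also have "(\<Prod>i<n. mdet n (last_col n (\<sigma> i) x)) = (\<Prod>i<n. mdet n (last_col n i x))"
    using prod.permute [OF assms(1), of "\<lambda>i. mdet n (last_col n i x)"] by simp
  also have "of_int (sign \<sigma>) ^ n = (1 :: complex)" using assms(2) by (auto simp: sign_def)
  finally show ?thesis
    by (auto simp: min_hwf_def det_rowperm assms power_mult_distrib sign_def)
qed

lemma last_col_coladd:
  assumes "a < b"
  shows "mdet n (last_col n i (coladd a b t x)) = mdet n (last_col n i x)"
proof (cases "b < n - 1")
  case True
  then have "last_col n i (coladd a b t x) = coladd a b t (last_col n i x)"
    using assms by (auto simp: last_col_def coladd_def fun_eq_iff)
  then show ?thesis using det_coladd [OF assms] by simp
next
  case False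
  \<comment> \<open>Column \<open>b\<close> is either the overwritten one or outside the
    determinant.\<close>
  then show ?thesis by (intro det_mat_cong) (auto simp: last_col_def coladd_def)
qed

text \<open>The exponents: a row contributes to both factors of the square and to all but one of the
  \<open>n\<close> minors, which gives \<open>2 + (n - 1)\<close>. A column before the last
  contributes to all \<open>n + 2\<close> determinants, column \<open>n - 1\<close> to the square
  only.\<close>

lemma hwfun_min_hwf:
  assumes n: "even n" "1 \<le> n" "n \<le> D"
  shows "hwfun n D (n + 1) (min_weight n) (min_hwf n)"
proof
  show "min_hwf n \<in> polyfun (grid n D)"
    unfolding min_hwf_def power2_eq_square
    by (intro polyfun.mult polyfun_prod polyfun_det polyfun_det_last_col n) auto
  show "min_hwf n (rowperm \<sigma> x) = min_hwf n x" if "\<sigma> permutes {..<n}" for \<sigma> x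
    using that n(1) by (rule min_hwf_rowperm)
  show "min_hwf n (coladd a b t x) = min_hwf n x" if "a < b" "b < D" for a b t x
    using that by (simp add: min_hwf_def det_coladd last_col_coladd)
  show "min_hwf n (rowscale c x) = (\<Prod>i<n. c i) ^ (n + 1) * min_hwf n x" for c x
  proof -
    have "(\<Prod>i<n. \<Prod>r\<in>{..<n} - {i}. c r) = (\<Prod>i<n. \<Prod>r\<in>{r. r \<in> {..<n} \<and> r \<noteq> i}. c r)"
      by (intro prod.cong) auto
    also have "\<dots> = (\<Prod>r<n. \<Prod>i\<in>{i. i \<in> {..<n} \<and> r \<noteq> i}. c r)"
      by (rule prod.swap_restrict) auto
    also have "\<dots> = (\<Prod>r<n. c r ^ (n - 1))"
    proof (rule prod.cong [OF refl])
      fix r assume "r \<in> {..<n}"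
      then have "{i. i \<in> {..<n} \<and> r \<noteq> i} = {..<n} - {r}" "card ({..<n} - {r}) = n - 1" by auto
      then show "(\<Prod>i\<in>{i. i \<in> {..<n} \<and> r \<noteq> i}. c r) = c r ^ (n - 1)" by simp
    qed
    finally have "(\<Prod>i<n. \<Prod>r\<in>{..<n} - {i}. c r) = (\<Prod>i<n. c i) ^ (n - 1)" by (simp add: prod_power_distrib)
    then have "min_hwf n (rowscale c x) = (\<Prod>i<n. c i) ^ 2 * (\<Prod>i<n. c i) ^ (n - 1) * min_hwf n x"
      by (simp add: min_hwf_def det_rowscale det_last_col_rowscale prod.distrib power_mult_distrib)
    also have "(\<Prod>i<n. c i) ^ 2 * (\<Prod>i<n. c i) ^ (n - 1) = (\<Prod>i<n. c i) ^ (n + 1)"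
      using n by (simp flip: power_add)
    finally show ?thesis .
  qed
  show "min_hwf n (colscale e x) = (\<Prod>k<D. e k ^ min_weight n k) * min_hwf n x" for e x
  proof -
    obtain p where p: "n = Suc p" using n by (cases n) auto
    have "(\<Prod>k<D. e k ^ min_weight n k) = (\<Prod>k<n. e k ^ min_weight n k)"
      using n by (intro prod.mono_neutral_right) (auto simp: min_weight_def)
    also have "\<dots> = (\<Prod>k<p. e k ^ min_weight n k) * e p ^ 2" by (simp add: p min_weight_def)
    also have "(\<Prod>k<p. e k ^ min_weight n k) = (\<Prod>k<p. e k) ^ (n + 2)"
      by (subst prod_power_distrib) (auto simp: min_weight_def p intro!: prod.cong)
    also have "(\<Prod>k<p. e k) ^ (n + 2) * e p ^ 2 = (\<Prod>k<n. e k) ^ 2 * (\<Prod>k<n - 1. e k) ^ n"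
      by (simp add: p power_mult_distrib power2_eq_square)
    finally show ?thesis
      by (simp add: min_hwf_def det_colscale det_last_col_colscale prod.distrib power_mult_distrib)
  qed
qed

lemma min_hwf_base_matrix:
  assumes "1 \<le> n"
  shows "min_hwf n (base_matrix n) \<noteq> 0"
proof -
  have "mdet n (base_matrix n) = (\<Prod>i<n. base_matrix n (i, i))"
    using assms by (intro det_lower_triangular) (auto simp: base_matrix_def)
  also have "\<dots> \<noteq> 0" using assms by (auto simp: base_matrix_def)
  finally have 1: "mdet n (base_matrix n) \<noteq> 0" .
  have 2: "mdet n (last_col n i (base_matrix n)) \<noteq> 0" if "i < n" for i
  proof -
    \<comment> \<open>Subtracting column \<open>i\<close> from the replaced last column removes the
      entry 1 in row \<open>i\<close> and puts \<open>- 1\<close> into the last row, which makes the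
      matrix lower triangular.\<close>
    define y where "y = (if i < n - 1 then coladd i (n - 1) (- 1) (last_col n i (base_matrix n))
      else last_col n i (base_matrix n))"
    have "mdet n (last_col n i (base_matrix n)) = mdet n y"
      by (simp add: y_def det_coladd)
    also have "\<dots> = (\<Prod>r<n. y (r, r))"
      using that by (intro det_lower_triangular) (auto simp: y_def base_matrix_def last_col_def coladd_def)
    also have "\<dots> \<noteq> 0"
      using that by (auto simp: y_def base_matrix_def last_col_def coladd_def)
    finally show ?thesis .
  qed
  show ?thesis using 1 2 by (auto simp: min_hwf_def)
qed

section \<open>Polynomials of prescribed row degrees\<close>

definition mono_fun :: "nat \<Rightarrow> (nat \<Rightarrow> nat list) \<Rightarrow> (nat \<times> nat \<Rightarrow> complex) \<Rightarrow> complex" where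
  "mono_fun n ws x = (\<Prod>i<n. \<Prod>k\<leftarrow>ws i. x (i, k))"

text \<open>Keeps an expansion into monomials at hand, which can be lifted to
  \<open>S\<^sup>n (S\<^sup>d V)\<close> term by term; mere homogeneity of a function cannot. The
  word \<open>ws i\<close> lists the columns used in row \<open>i\<close>, with repetitions.\<close>

inductive_set rowpoly :: "nat \<Rightarrow> nat \<Rightarrow> (nat \<Rightarrow> nat) \<Rightarrow> ((nat \<times> nat \<Rightarrow> complex) \<Rightarrow> complex) set"
  for n D \<delta> where
  mono: "(\<And>i. i < n \<Longrightarrow> length (ws i) = \<delta> i \<and> set (ws i) \<subseteq> {..<D}) \<Longrightarrow> mono_fun n ws \<in> rowpoly n D \<delta>"
| zero: "(\<lambda>x. 0) \<in> rowpoly n D \<delta>"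
| add: "p \<in> rowpoly n D \<delta> \<Longrightarrow> q \<in> rowpoly n D \<delta> \<Longrightarrow> (\<lambda>x. p x + q x) \<in> rowpoly n D \<delta>"
| cmult: "p \<in> rowpoly n D \<delta> \<Longrightarrow> (\<lambda>x. c * p x) \<in> rowpoly n D \<delta>"

lemma rowpoly_sum:
  assumes "\<And>k. k \<in> K \<Longrightarrow> p k \<in> rowpoly n D \<delta>"
  shows "(\<lambda>x. \<Sum>k\<in>K. p k x) \<in> rowpoly n D \<delta>"
  using assms
proof (induction K rule: infinite_finite_induct)
  case (insert k K)
  then show ?case by (auto intro: rowpoly.add)
qed (auto intro: rowpoly.zero)

lemma rowpoly_mult:
  assumes "p \<in> rowpoly n D \<delta>" "q \<in> rowpoly n D \<epsilon>"
  shows "(\<lambda>x. p x * q x) \<in> rowpoly n D (\<lambda>i. \<delta> i + \<epsilon> i)"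
  using assms(1)
proof induction
  case (mono ws)
  from assms(2) show ?case
  proof induction
    case (mono us)
    have "(\<lambda>x. mono_fun n ws x * mono_fun n us x) = mono_fun n (\<lambda>i. ws i @ us i)"
      by (auto simp: mono_fun_def prod.distrib)
    then show ?case
      using mono \<open>\<And>i. i < n \<Longrightarrow> length (ws i) = \<delta> i \<and> set (ws i) \<subseteq> {..<D}\<close>
      by (simp only:) (rule rowpoly.mono, auto)
  next
    case (add p q)
    then show ?case by (simp only: distrib_left rowpoly.add)
  next
    case (cmult p c)
    then show ?case by (simp only: mult.left_commute [of _ c] rowpoly.cmult)
  qed (simp add: rowpoly.zero)
next
  case (add p q)
  then show ?case by (simp only: distrib_right rowpoly.add)
next
  case (cmult p c)
  then show ?case by (simp only: mult.assoc rowpoly.cmult)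
qed (simp add: rowpoly.zero)

lemma rowpoly_prod:
  assumes "finite K" "\<And>k. k \<in> K \<Longrightarrow> p k \<in> rowpoly n D (\<delta> k)"
  shows "(\<lambda>x. \<Prod>k\<in>K. p k x) \<in> rowpoly n D (\<lambda>i. \<Sum>k\<in>K. \<delta> k i)"
  using assms
proof (induction K)
  case empty
  have "(\<lambda>x. 1) = mono_fun n (\<lambda>i. [])" by (auto simp: mono_fun_def)
  then show ?case by (simp only: prod.empty sum.empty) (rule rowpoly.mono, auto)
next
  case (insert k K)
  then show ?case
    using rowpoly_mult [of "p k" n D "\<delta> k" "\<lambda>x. \<Prod>k\<in>K. p k x" "\<lambda>i. \<Sum>k\<in>K. \<delta> k i"] by simp
qed

lemma rowpoly_cong:
  assumes "p \<in> rowpoly n D \<delta>" "\<And>i. i < n \<Longrightarrow> \<delta> i = \<epsilon> i"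
  shows "p \<in> rowpoly n D \<epsilon>"
  using assms(1)
proof induction
  case (mono ws)
  then show ?case using assms(2) by (intro rowpoly.mono) auto
qed (auto intro: rowpoly.intros)

lemma rowpoly_det:
  assumes "n \<le> D"
  shows "(\<lambda>x. mdet n x) \<in> rowpoly n D (\<lambda>_. 1)"
  unfolding mdet_def [abs_def]
proof (intro rowpoly_sum rowpoly.cmult)
  fix p assume "p \<in> {p. p permutes {..<n}}"
  then have "p i < n" if "i < n" for i using permutes_in_image [of p "{..<n}" i] that by auto
  moreover have "(\<lambda>x. \<Prod>i<n. x (i, p i)) = mono_fun n (\<lambda>i. [p i])" by (auto simp: mono_fun_def)
  ultimately show "(\<lambda>x. \<Prod>i<n. x (i, p i)) \<in> rowpoly n D (\<lambda>_. 1)"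
    using assms by (simp only:) (rule rowpoly.mono, auto intro: order_less_le_trans)
qed

lemma rowpoly_det_last_col:
  assumes "n \<le> D" "i < n"
  shows "(\<lambda>x. mdet n (last_col n i x)) \<in> rowpoly n D (\<lambda>r. if r = i then 0 else 1)"
  unfolding det_last_col_sum [OF assms(2)]
proof (intro rowpoly_sum rowpoly.cmult)
  fix p assume "p \<in> {p. p permutes {..<n} \<and> p i = n - 1}"
  then have "p r < n" if "r < n" for r using permutes_in_image [of p "{..<n}" r] that by auto
  moreover have "(\<lambda>x. \<Prod>r\<in>{..<n} - {i}. x (r, p r)) = mono_fun n (\<lambda>r. if r = i then [] else [p r])"
    using assms(2) by (auto simp: mono_fun_def prod.remove [of "{..<n}" i] intro!: prod.cong)
  ultimately show "(\<lambda>x. \<Prod>r\<in>{..<n} - {i}. x (r, p r)) \<in> rowpoly n D (\<lambda>r. if r = i then 0 else 1)"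
    using assms by (simp only:) (rule rowpoly.mono, auto intro: order_less_le_trans)
qed

lemma rowpoly_min_hwf:
  assumes "n \<le> D"
  shows "min_hwf n \<in> rowpoly n D (\<lambda>_. n + 1)"
proof -
  have "(\<lambda>x. mdet n x * mdet n x * (\<Prod>i<n. mdet n (last_col n i x)))
      \<in> rowpoly n D (\<lambda>r. (1 + 1) + (\<Sum>i<n. if r = i then 0 else 1))"
    using assms by (intro rowpoly_mult rowpoly_det rowpoly_prod rowpoly_det_last_col) auto
  then have "(\<lambda>x. mdet n x * mdet n x * (\<Prod>i<n. mdet n (last_col n i x)))
      \<in> rowpoly n D (\<lambda>_. n + 1)"
  proof (rule rowpoly_cong)
    fix r assume "r < n"
    have "(\<Sum>i<n. if r = i then 0 else 1 :: nat) = (\<Sum>i\<in>{..<n} - {r}. 1)"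
      by (rule sum.mono_neutral_cong_right) auto
    then show "(1 + 1) + (\<Sum>i<n. if r = i then 0 else 1) = n + 1" using \<open>r < n\<close> by simp
  qed
  then show ?thesis by (simp add: min_hwf_def [abs_def] power2_eq_square)
qed

section \<open>Complete reducibility\<close>

lemma (in vector_space) dim_strict_mono:
  assumes "subspace N" "subspace W" "N \<subseteq> W" "N \<noteq> W" and fin: "finite B" "W \<subseteq> span B"
  shows "dim N < dim W"
proof -
  obtain C where C: "C \<subseteq> N" "independent C" "N \<subseteq> span C"
    using maximal_independent_subset_extend [of "{}" N] independent_empty by auto
  obtain C' where C': "C \<subseteq> C'" "C' \<subseteq> W" "independent C'" "W \<subseteq> span C'"
    using maximal_independent_subset_extend [OF subset_trans [OF C(1) assms(3)] C(2)] by blast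
  have "finite C'" using independent_span_bound [OF fin(1) C'(3)] C' fin by auto
  moreover have "C \<noteq> C'"
  proof
    assume "C = C'"
    then have "W \<subseteq> N" using C' C span_minimal [OF C(1) assms(1)] by auto
    then show False using assms by auto
  qed
  ultimately have "card C < card C'" using C' by (intro psubset_card_mono) auto
  moreover have "dim N = card C" using C by (intro dim_unique) auto
  moreover have "dim W = card C'" using C' by (intro dim_unique) auto
  ultimately show ?thesis by simp
qed

text \<open>Coefficients are indexed by \<open>A\<close> and not by the image: in the applications
  different indices may name the same vector.\<close>

lemma (in vector_space) span_image_sum:
  assumes "finite A" "x \<in> span (f ` A)"
  shows "\<exists>c. x = (\<Sum>a\<in>A. scale (c a) (f a))"
proof -
  let ?S = "range (\<lambda>c. \<Sum>a\<in>A. scale (c a) (f a))"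
  have "subspace ?S"
  proof (rule subspaceI)
    show "0 \<in> ?S" by (rule range_eqI [of _ _ "\<lambda>_. 0"]) simp
    fix x y assume "x \<in> ?S" "y \<in> ?S"
    then obtain c d where "x = (\<Sum>a\<in>A. scale (c a) (f a))" "y = (\<Sum>a\<in>A. scale (d a) (f a))" by auto
    then show "x + y \<in> ?S"
      by (intro range_eqI [of _ _ "\<lambda>a. c a + d a"]) (simp add: scale_left_distrib sum.distrib)
  next
    fix k x assume "x \<in> ?S"
    then obtain c where "x = (\<Sum>a\<in>A. scale (c a) (f a))" by auto
    then show "scale k x \<in> ?S"
      by (intro range_eqI [of _ _ "\<lambda>a. k * c a"]) (simp add: scale_sum_right)
  qed
  moreover have "f ` A \<subseteq> ?S"
  proof
    fix y assume "y \<in> f ` A"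
    then obtain b where b: "b \<in> A" "y = f b" by auto
    have "(\<Sum>a\<in>A. scale (if a = b then 1 else 0) (f a)) = (\<Sum>a\<in>A. if a = b then f a else 0)"
      by (intro sum.cong) auto
    then show "y \<in> ?S"
      using assms b by (intro range_eqI [of _ _ "\<lambda>a. if a = b then 1 else 0"]) simp
  qed
  ultimately have "span (f ` A) \<subseteq> ?S" by (rule span_minimal [rotated])
  then show ?thesis using assms(2) by auto
qed

lemma (in vector_space) span_Union_sum:
  assumes "finite D" "\<And>N. N \<in> D \<Longrightarrow> subspace N" "x \<in> span (\<Union>D)"
  shows "\<exists>f. (\<forall>N\<in>D. f N \<in> N) \<and> x = (\<Sum>N\<in>D. f N)"
proof -
  let ?S = "{x. \<exists>f. (\<forall>N\<in>D. f N \<in> N) \<and> x = (\<Sum>N\<in>D. f N)}"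
  have "subspace ?S"
  proof (rule subspaceI)
    show "0 \<in> ?S" using assms(2) by (auto intro!: exI [of _ "\<lambda>_. 0"] subspace_0)
    fix x y assume "x \<in> ?S" "y \<in> ?S"
    then obtain f g where "\<forall>N\<in>D. f N \<in> N" "x = (\<Sum>N\<in>D. f N)" "\<forall>N\<in>D. g N \<in> N" "y = (\<Sum>N\<in>D. g N)" by auto
    then show "x + y \<in> ?S"
      using assms(2) by (auto intro!: exI [of _ "\<lambda>N. f N + g N"] subspace_add simp: sum.distrib)
  next
    fix k x assume "x \<in> ?S"
    then obtain f where "\<forall>N\<in>D. f N \<in> N" "x = (\<Sum>N\<in>D. f N)" by auto
    then show "scale k x \<in> ?S"
      using assms(2) by (auto intro!: exI [of _ "\<lambda>N. scale k (f N)"] subspace_scale simp: scale_sum_right)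
  qed
  moreover have "\<Union>D \<subseteq> ?S"
  proof
    fix y assume "y \<in> \<Union>D"
    then obtain N where N: "N \<in> D" "y \<in> N" by auto
    then show "y \<in> ?S"
      using assms by (auto intro!: exI [of _ "\<lambda>N'. if N' = N then y else 0"] subspace_0)
  qed
  ultimately have "span (\<Union>D) \<subseteq> ?S" by (rule span_minimal [rotated])
  then show ?thesis using assms(3) by auto
qed

lemma GL_module_Int:
  assumes "vector_space t" "GL_module s t \<rho> N" "GL_module s t \<rho> W"
  shows "GL_module s t \<rho> (N \<inter> W)"
proof -
  interpret vector_space t by fact
  show ?thesis using assms(2,3) by (auto simp: GL_module_def subspace_inter)
qed

text \<open>Induction on the dimension. Complements are given inside \<open>M\<close> only; by the
  modular law, intersecting one with \<open>W\<close> yields a complement inside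
  \<open>W\<close>.\<close>

lemma irreducible_decomposition_exists:
  fixes t :: "complex \<Rightarrow> 'w \<Rightarrow> 'w :: ab_group_add"
  assumes vs: "vector_space t" and fin: "finite B" "M \<subseteq> module.span t B"
    and compl: "\<And>N. GL_module s t \<rho> N \<Longrightarrow> N \<subseteq> M \<Longrightarrow>
      \<exists>N'. GL_module s t \<rho> N' \<and> N' \<subseteq> M \<and> N \<inter> N' = {0} \<and> (\<forall>x\<in>M. \<exists>a\<in>N. \<exists>b\<in>N'. x = a + b)"
    and W: "GL_module s t \<rho> W" "W \<subseteq> M"
  shows "\<exists>D. irreducible_decomposition s t \<rho> W D"
proof -
  interpret vector_space t by fact
  show ?thesis
    using W
  proof (induction "dim W" arbitrary: W rule: less_induct)
    case less
    have sW: "subspace W" using less.prems by (simp add: GL_module_def)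
    show ?case
    proof (cases "GL_irreducible s t \<rho> W \<or> W = {0}")
      case True
      show ?thesis
      proof (cases "W = {0}")
        case True
        then have "irreducible_decomposition s t \<rho> W {}" by (simp add: irreducible_decomposition_def)
        then show ?thesis by blast
      next
        case False
        then have "GL_irreducible s t \<rho> W" using \<open>GL_irreducible s t \<rho> W \<or> W = {0}\<close> by blast
        then have "irreducible_decomposition s t \<rho> W {W}"
          using span_eq_iff [of W] sW by (simp add: irreducible_decomposition_def)
        then show ?thesis by blast
      qed
    next
      case False
      then obtain N where N: "GL_module s t \<rho> N" "N \<subseteq> W" "N \<noteq> {0}" "N \<noteq> W"
        using less.prems unfolding GL_irreducible_def by blast
      obtain N' where N': "GL_module s t \<rho> N'" "N' \<subseteq> M" "N \<inter> N' = {0}"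
        "\<forall>x\<in>M. \<exists>a\<in>N. \<exists>b\<in>N'. x = a + b"
        using compl [OF N(1) subset_trans [OF N(2) less.prems(2)]] by (elim exE conjE) (rule that)
      define P where "P = N' \<inter> W"
      have P: "GL_module s t \<rho> P" "P \<subseteq> W"
        unfolding P_def using GL_module_Int [OF vs N'(1) less.prems(1)] by auto
      have sN: "subspace N" and sP: "subspace P" using N P by (auto simp: GL_module_def)
      have NP: "N \<inter> P = {0}" using N'(3) subspace_0 [OF sW] by (auto simp: P_def)
      have sum: "\<exists>a\<in>N. \<exists>b\<in>P. x = a + b" if xW: "x \<in> W" for x
      proof -
        obtain a b where ab: "a \<in> N" "b \<in> N'" "x = a + b"
          using bspec [OF N'(4) subsetD [OF less.prems(2) xW]] by (elim bexE) (rule that)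
        then have "b = x - a" by simp
        then have "b \<in> W" using subspace_diff [OF sW xW subsetD [OF N(2) ab(1)]] by simp
        then show ?thesis using ab by (auto simp: P_def)
      qed
      have "P \<noteq> W"
      proof
        assume "P = W"
        then have "N \<subseteq> {0}" using NP N(2) by auto
        then show False using N(3) subspace_0 [OF sN] by auto
      qed
      have "W \<subseteq> span B" using fin(2) less.prems(2) by (rule subset_trans [rotated])
      then have dims: "dim N < dim W" "dim P < dim W"
        using dim_strict_mono [OF sN sW N(2,4) fin(1)] dim_strict_mono [OF sP sW P(2) \<open>P \<noteq> W\<close> fin(1)]
        by auto
      obtain D1 D2 where D1: "irreducible_decomposition s t \<rho> N D1" and D2: "irreducible_decomposition s t \<rho> P D2"
        using less.hyps [OF dims(1) N(1) subset_trans [OF N(2) less.prems(2)]]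
          less.hyps [OF dims(2) P(1) subset_trans [OF P(2) less.prems(2)]] by (elim exE) (rule that)
      have sub1: "K \<subseteq> N" if "K \<in> D1" for K
        using D1 that span_superset [of "\<Union>D1"] by (auto simp: irreducible_decomposition_def)
      have sub2: "K \<subseteq> P" if "K \<in> D2" for K
        using D2 that span_superset [of "\<Union>D2"] by (auto simp: irreducible_decomposition_def)
      \<comment> \<open>A decomposition is a set, so a summand common to both parts would be counted
        once; it would lie in \<open>N \<inter> P = {0}\<close>.\<close>
      have disj: "D1 \<inter> D2 = {}"
      proof (rule ccontr)
        assume "D1 \<inter> D2 \<noteq> {}"
        then obtain K where K: "K \<in> D1" "K \<in> D2" by auto
        then have "K \<subseteq> {0}" using sub1 sub2 NP by blast
        moreover have "GL_irreducible s t \<rho> K" using D1 K by (auto simp: irreducible_decomposition_def)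
        then have "0 \<in> K" "K \<noteq> {0}" using subspace_0 by (auto simp: GL_irreducible_def GL_module_def)
        ultimately show False by auto
      qed
      have fD: "finite D1" "finite D2" using D1 D2 by (auto simp: irreducible_decomposition_def)
      have "irreducible_decomposition s t \<rho> W (D1 \<union> D2)"
        unfolding irreducible_decomposition_def
      proof (intro conjI allI impI)
        show "finite (D1 \<union> D2)" using fD by simp
        show "\<forall>K\<in>D1 \<union> D2. GL_irreducible s t \<rho> K"
          using D1 D2 by (auto simp: irreducible_decomposition_def)
        show "span (\<Union>(D1 \<union> D2)) = W"
        proof
          show "span (\<Union>(D1 \<union> D2)) \<subseteq> W"
            using sub1 sub2 N(2) P(2) by (intro span_minimal sW) blast
          show "W \<subseteq> span (\<Union>(D1 \<union> D2))"
          proof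
            fix x assume "x \<in> W"
            then obtain a b where ab: "a \<in> N" "b \<in> P" "x = a + b" using sum by blast
            then have "a \<in> span (\<Union>D1)" "b \<in> span (\<Union>D2)"
              using D1 D2 by (auto simp: irreducible_decomposition_def)
            then have "a \<in> span (\<Union>(D1 \<union> D2))" "b \<in> span (\<Union>(D1 \<union> D2))"
              using span_mono [of "\<Union>D1" "\<Union>(D1 \<union> D2)"] span_mono [of "\<Union>D2" "\<Union>(D1 \<union> D2)"] by auto
            then show "x \<in> span (\<Union>(D1 \<union> D2))" using ab span_add by auto
          qed
        qed
        fix f assume f: "(\<forall>K\<in>D1 \<union> D2. f K \<in> K) \<and> (\<Sum>K\<in>D1 \<union> D2. f K) = 0"
        define a where "a = (\<Sum>K\<in>D1. f K)"
        define b where "b = (\<Sum>K\<in>D2. f K)"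
        have "a \<in> N" unfolding a_def using f sub1 by (intro subspace_sum sN) auto
        have "b \<in> P" unfolding b_def using f sub2 by (intro subspace_sum sP) auto
        have "a + b = 0" using f sum.union_disjoint [OF fD disj, of f] by (simp add: a_def b_def)
        then have "a = - b" by (simp add: eq_neg_iff_add_eq_0)
        then have "a \<in> P" using \<open>b \<in> P\<close> subspace_neg [OF sP] by auto
        then have "a = 0" using \<open>a \<in> N\<close> NP by auto
        then have "b = 0" using \<open>a + b = 0\<close> by simp
        show "\<forall>K\<in>D1 \<union> D2. f K = 0"
          using D1 D2 f \<open>a = 0\<close> \<open>b = 0\<close> by (simp add: irreducible_decomposition_def a_def b_def ball_Un)
      qed
      then show ?thesis by blast
    qed
  qed
qed

section \<open>Invariant complements\<close>

definition cip :: "'k set \<Rightarrow> ('k \<Rightarrow> complex) \<Rightarrow> ('k \<Rightarrow> complex) \<Rightarrow> complex" where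
  "cip K T U = (\<Sum>k\<in>K. T k * cnj (U k))"

lemma cip_add_left: "cip K (T + S) U = cip K T U + cip K S U"
  and cip_diff_left: "cip K (T - S) U = cip K T U - cip K S U"
  and cip_add_right: "cip K U (T + S) = cip K U T + cip K U S"
  and cip_scale_left: "cip K (fscale c T) U = c * cip K T U"
  and cip_scale_right: "cip K U (fscale c T) = cnj c * cip K U T"
  by (simp_all add: cip_def fscale_def algebra_simps sum.distrib sum_subtractf sum_distrib_left)

lemma cip_commute: "cip K T U = cnj (cip K U T)"
  by (simp add: cip_def mult.commute)

lemma cip_self_zero:
  assumes "finite K" "cip K T T = 0" "k \<in> K"
  shows "T k = 0"
proof -
  have "(\<Sum>k\<in>K. (cmod (T k))\<^sup>2) = 0"
    using assms(2) by (simp add: cip_def complex_norm_square [symmetric] flip: of_real_power of_real_sum)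
  then show ?thesis using assms by (subst (asm) sum_nonneg_eq_0_iff) auto
qed

text \<open>Gram-Schmidt: the projection to \<open>span B\<close> is corrected along
  \<open>e\<close>, the part of \<open>b\<close> orthogonal to \<open>span B\<close>.\<close>

lemma cip_projection:
  fixes T :: "'k \<Rightarrow> complex"
  assumes K: "finite K" and "finite B"
  shows "\<exists>S\<in>module.span fscale B. \<forall>U\<in>module.span fscale B. cip K (T - S) U = 0"
  using assms(2)
proof (induction B arbitrary: T)
  case empty
  interpret vector_space "fscale :: complex \<Rightarrow> ('k \<Rightarrow> complex) \<Rightarrow> _" by (rule vector_space_fscale)
  show ?case by (auto simp: cip_def)
next
  case (insert b B)
  interpret vector_space "fscale :: complex \<Rightarrow> ('k \<Rightarrow> complex) \<Rightarrow> _" by (rule vector_space_fscale)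
  obtain p where p: "p \<in> span B" "\<And>U. U \<in> span B \<Longrightarrow> cip K (b - p) U = 0" using insert.IH by blast
  obtain S where S: "S \<in> span B" "\<And>U. U \<in> span B \<Longrightarrow> cip K (T - S) U = 0" using insert.IH by blast
  define e where "e = b - p"
  \<comment> \<open>The form ignores values outside \<open>K\<close>, so \<open>cip K e e\<close>
    can be 0 for a nonzero \<open>e\<close>. Division by zero then makes \<open>c\<close> zero,
    which is right because such an \<open>e\<close> is orthogonal to everything.\<close>
  define c where "c = cip K T e / cip K e e"
  have "cip K S e = 0" using p(2) [OF S(1)] cip_commute [of K S e] by (simp add: e_def)
  moreover have "cip K T e = c * cip K e e"
  proof (cases "cip K e e = 0")
    case True
    then have "e k = 0" if "k \<in> K" for k using cip_self_zero [OF K] that by blast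
    then have "cip K T e = 0" by (simp add: cip_def)
    then show ?thesis using True by simp
  qed (simp add: c_def)
  ultimately have Te: "cip K (T - (S + fscale c e)) e = 0"
    by (simp add: cip_diff_left cip_add_left cip_scale_left)
  have TU: "cip K (T - (S + fscale c e)) U = 0" if "U \<in> span B" for U
    using S(2) [OF that] p(2) [OF that] by (simp add: e_def cip_diff_left cip_add_left cip_scale_left)
  show ?case
  proof (intro bexI ballI)
    have "span B \<subseteq> span (insert b B)" by (rule span_mono) auto
    then show "S + fscale c e \<in> span (insert b B)"
      unfolding e_def using S p by (auto intro!: span_add span_scale span_diff intro: span_base)
    fix U assume "U \<in> span (insert b B)"
    then obtain k where k: "U - fscale k b \<in> span B" by (auto simp: span_insert)
    have "U = fscale k e + (fscale k p + (U - fscale k b))" by (simp add: e_def scale_right_diff_distrib)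
    moreover have "fscale k p + (U - fscale k b) \<in> span B" using p k by (intro span_add span_scale)
    ultimately show "cip K (T - (S + fscale c e)) U = 0"
      using Te TU by (metis cip_add_right cip_scale_right add_0 mult_zero_right)
  qed
qed

text \<open>Weyl's unitarian trick without integration: the matrices by which the group acts on a finite
  spanning family are closed under conjugate transposition, so orthogonal complements in the
  coefficient space are invariant.\<close>

lemma GL_module_complement:
  fixes t :: "complex \<Rightarrow> 'w \<Rightarrow> 'w :: ab_group_add" and e :: "'k \<Rightarrow> 'w"
  assumes vs: "vector_space t" and K: "finite K" and M: "GL_module s t \<rho> M" "M = module.span t (e ` K)"
    and act: "\<And>g k. g \<in> GL s \<Longrightarrow> k \<in> K \<Longrightarrow> \<rho> g (e k) = (\<Sum>l\<in>K. t (A g l k) (e l))"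
    and adj: "\<And>g. g \<in> GL s \<Longrightarrow> \<exists>h\<in>GL s. \<forall>k\<in>K. \<forall>l\<in>K. A h k l = cnj (A g l k)"
    and N: "GL_module s t \<rho> N" "N \<subseteq> M"
  shows "\<exists>N'. GL_module s t \<rho> N' \<and> N' \<subseteq> M \<and> N \<inter> N' = {0} \<and> (\<forall>x\<in>M. \<exists>a\<in>N. \<exists>b\<in>N'. x = a + b)"
proof -
  interpret vector_space t by fact
  interpret F: vector_space "fscale :: complex \<Rightarrow> ('k \<Rightarrow> complex) \<Rightarrow> _" by (rule vector_space_fscale)
  \<comment> \<open>The family \<open>e\<close> may be linearly dependent, so the argument takes
    place in the coefficient space, which \<open>\<pi>\<close> maps onto \<open>M\<close>. On
    \<open>supp\<close> the Hermitian form is definite.\<close>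
  define \<pi> where "\<pi> T = (\<Sum>k\<in>K. t (T k) (e k))" for T
  define supp where "supp = {T :: 'k \<Rightarrow> complex. \<forall>k. k \<notin> K \<longrightarrow> T k = 0}"
  have \<pi>_add: "\<pi> (T + S) = \<pi> T + \<pi> S" for T S by (simp add: \<pi>_def scale_left_distrib sum.distrib)
  have \<pi>_diff: "\<pi> (T - S) = \<pi> T - \<pi> S" for T S by (simp add: \<pi>_def scale_left_diff_distrib sum_subtractf)
  have \<pi>_scale: "\<pi> (fscale c T) = t c (\<pi> T)" for c T by (simp add: \<pi>_def fscale_def scale_sum_right)
  have \<pi>_0: "\<pi> 0 = 0" by (simp add: \<pi>_def)
  have sM: "subspace M" and sN: "subspace N" using M N by (auto simp: GL_module_def)
  have eM: "e k \<in> M" if "k \<in> K" for k using M(2) that by (simp add: span_base)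
  have \<pi>_M: "\<pi> T \<in> M" for T unfolding \<pi>_def using eM by (intro subspace_sum subspace_scale sM) auto
  define act' where "act' g T = (\<lambda>l. if l \<in> K then \<Sum>k\<in>K. A g l k * T k else 0)" for g T
  have \<rho>_sum: "\<rho> g (\<Sum>k\<in>L. t (T k) (e k)) = (\<Sum>k\<in>L. t (T k) (\<rho> g (e k)))" if "g \<in> GL s" "finite L" "L \<subseteq> K" for g T L
    using that(2,3)
  proof (induction L)
    case empty
    have "\<rho> g (t 0 0) = t 0 (\<rho> g 0)" using M(1) that(1) subspace_0 [OF sM] unfolding GL_module_def by blast
    then show ?case by simp
  next
    case (insert k L)
    have "t (T k) (e k) \<in> M" "(\<Sum>k\<in>L. t (T k) (e k)) \<in> M"
      using insert eM by (auto intro!: subspace_sum subspace_scale sM)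
    then have "\<rho> g (t (T k) (e k) + (\<Sum>k\<in>L. t (T k) (e k))) = t (T k) (\<rho> g (e k)) + \<rho> g (\<Sum>k\<in>L. t (T k) (e k))"
      using M(1) that(1) eM insert.prems unfolding GL_module_def by auto
    then show ?case using insert by simp
  qed
  have \<rho>_\<pi>: "\<rho> g (\<pi> T) = \<pi> (act' g T)" if "g \<in> GL s" for g T
  proof -
    have "\<rho> g (\<pi> T) = (\<Sum>k\<in>K. \<Sum>l\<in>K. t (T k * A g l k) (e l))"
      using \<rho>_sum [OF that K order_refl] act [OF that] by (simp add: \<pi>_def scale_sum_right)
    also have "\<dots> = (\<Sum>l\<in>K. \<Sum>k\<in>K. t (T k * A g l k) (e l))" by (rule sum.swap)
    also have "\<dots> = \<pi> (act' g T)" by (simp add: \<pi>_def act'_def scale_sum_left mult.commute)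
    finally show ?thesis .
  qed
  have act'_supp: "act' g T \<in> supp" for g T by (simp add: act'_def supp_def)
  \<comment> \<open>\<open>P\<close> is the full preimage of \<open>N\<close> in \<open>supp\<close>
    and contains the kernel of \<open>\<pi>\<close> there. Hence an element of its orthogonal
    complement \<open>R\<close> that \<open>\<pi>\<close> sends into \<open>N\<close> is 0.\<close>
  define P where "P = {T \<in> supp. \<pi> T \<in> N}"
  define R where "R = {T \<in> supp. \<forall>S\<in>P. cip K T S = 0}"
  have ss: "F.subspace supp"
    by (rule F.subspaceI) (auto simp: supp_def fscale_def)
  have sP: "F.subspace P"
    by (rule F.subspaceI)
      (auto simp: P_def \<pi>_0 \<pi>_add \<pi>_scale subspace_0 [OF sN] F.subspace_0 [OF ss]
        intro: subspace_add [OF sN] subspace_scale [OF sN] F.subspace_add [OF ss] F.subspace_scale [OF ss])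
  obtain B where B: "finite B" "F.span B = P"
  proof -
    obtain B where B: "B \<subseteq> P" "F.independent B" "P \<subseteq> F.span B"
      using F.maximal_independent_subset_extend [of "{}" P] F.independent_empty by auto
    let ?\<delta> = "\<lambda>k l. if l = k then 1 else 0 :: complex"
    have "P \<subseteq> F.span (?\<delta> ` K)"
    proof
      fix T assume "T \<in> P"
      have "(\<Sum>k\<in>L. fscale (T k) (?\<delta> k)) l = (if l \<in> L then T l else 0)" if "finite L" for L l
        using that by induction (auto simp: fscale_def)
      then have "T = (\<Sum>k\<in>K. fscale (T k) (?\<delta> k))"
        using \<open>T \<in> P\<close> K by (auto simp: P_def supp_def fun_eq_iff)
      also have "\<dots> \<in> F.span (?\<delta> ` K)" by (intro F.span_sum F.span_scale F.span_base) auto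
      finally show "T \<in> F.span (?\<delta> ` K)" .
    qed
    then have "finite B" using F.independent_span_bound [of "?\<delta> ` K" B] B K by auto
    moreover have "F.span B = P" using B F.span_minimal [OF B(1) sP] by auto
    ultimately show ?thesis using that by blast
  qed
  have RN: "T = 0" if "T \<in> R" "\<pi> T \<in> N" for T
  proof -
    have "T \<in> P" "T \<in> supp" using that by (auto simp: R_def P_def)
    then have "cip K T T = 0" using that by (auto simp: R_def)
    then show ?thesis using cip_self_zero [OF K, of T] \<open>T \<in> supp\<close> by (auto simp: supp_def fun_eq_iff)
  qed
  have act'_R: "act' g T \<in> R" if g: "g \<in> GL s" and T: "T \<in> R" for g T
  proof -
    obtain h where h: "h \<in> GL s" "\<And>k l. k \<in> K \<Longrightarrow> l \<in> K \<Longrightarrow> A h k l = cnj (A g l k)" using adj [OF g] by metis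
    have "cip K (act' g T) S = 0" if S: "S \<in> P" for S
    proof -
      have "cip K (act' g T) S = (\<Sum>l\<in>K. \<Sum>k\<in>K. A g l k * T k * cnj (S l))"
        by (simp add: cip_def act'_def sum_distrib_right)
      also have "\<dots> = (\<Sum>k\<in>K. \<Sum>l\<in>K. A g l k * T k * cnj (S l))" by (rule sum.swap)
      \<comment> \<open>The conjugate transpose passes to the other argument, where it is again the
        action of a group element and preserves \<open>P\<close>.\<close>
      also have "\<dots> = cip K T (act' h S)"
        by (simp add: cip_def act'_def h(2) sum_distrib_left ac_simps)
      also have "act' h S \<in> P"
        using S h(1) N(1) act'_supp by (auto simp: P_def GL_module_def simp flip: \<rho>_\<pi>)
      then have "cip K T (act' h S) = 0" using \<open>T \<in> R\<close> by (auto simp: R_def)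
      finally show ?thesis .
    qed
    then show ?thesis using act'_supp by (auto simp: R_def)
  qed
  have sR: "F.subspace R"
    by (rule F.subspaceI)
      (auto simp: R_def supp_def cip_add_left cip_scale_left, auto simp: cip_def fscale_def)
  have "subspace (\<pi> ` R)"
  proof (rule subspaceI)
    show "0 \<in> \<pi> ` R" using F.subspace_0 [OF sR] \<pi>_0 by force
    fix x y assume "x \<in> \<pi> ` R" "y \<in> \<pi> ` R"
    then show "x + y \<in> \<pi> ` R" using F.subspace_add [OF sR] by (auto simp flip: \<pi>_add)
  next
    fix c x assume "x \<in> \<pi> ` R"
    then show "t c x \<in> \<pi> ` R" using F.subspace_scale [OF sR] by (auto simp flip: \<pi>_scale)
  qed
  moreover have "\<pi> ` R \<subseteq> M" using \<pi>_M by auto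
  moreover have "\<forall>g\<in>GL s. \<forall>x\<in>\<pi> ` R. \<rho> g x \<in> \<pi> ` R" using act'_R \<rho>_\<pi> by auto
  ultimately have mod: "GL_module s t \<rho> (\<pi> ` R)"
    using M(1) unfolding GL_module_def by (meson subsetD)
  have "N \<inter> \<pi> ` R = {0}"
  proof
    show "N \<inter> \<pi> ` R \<subseteq> {0}" using RN \<pi>_0 by auto
    show "{0} \<subseteq> N \<inter> \<pi> ` R" using subspace_0 [OF sN] F.subspace_0 [OF sR] \<pi>_0 by force
  qed
  moreover have "\<exists>a\<in>N. \<exists>b\<in>\<pi> ` R. x = a + b" if xM: "x \<in> M" for x
  proof -
    obtain T0 where T0: "x = \<pi> T0" using span_image_sum [OF K, of x e] xM M(2) by (auto simp: \<pi>_def)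
    define T where "T = (\<lambda>k. if k \<in> K then T0 k else 0)"
    have T: "x = \<pi> T" "T \<in> supp" by (auto simp: T0 T_def \<pi>_def supp_def)
    obtain S where S: "S \<in> P" "\<And>U. U \<in> P \<Longrightarrow> cip K (T - S) U = 0"
      using cip_projection [OF K B(1), of T] B(2) by auto
    have "T - S \<in> R" using S T by (auto simp: R_def P_def supp_def)
    moreover have "\<pi> S \<in> N" using S by (simp add: P_def)
    moreover have "x = \<pi> S + \<pi> (T - S)" using T by (simp add: \<pi>_diff)
    ultimately show ?thesis by blast
  qed
  ultimately show ?thesis using mod \<open>\<pi> ` R \<subseteq> M\<close> by blast
qed

section \<open>Bases and coordinates\<close>

lemma sum_fun_apply: "(\<Sum>i\<in>A. f i) x = (\<Sum>i\<in>A. f i x)"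
  by (induction A rule: infinite_finite_induct) auto

lemma linear_formI:
  fixes t :: "complex \<Rightarrow> 'w \<Rightarrow> 'w :: ab_group_add"
  assumes "vector_space t" "\<And>x y. \<phi> (x + y) = \<phi> x + \<phi> y" "\<And>c x. \<phi> (t c x) = c * \<phi> x"
  shows "Vector_Spaces.linear t (*) \<phi>"
proof -
  have "vector_space ((*) :: complex \<Rightarrow> _)" by unfold_locales (auto simp: algebra_simps)
  then show ?thesis using assms by (simp add: Vector_Spaces.linear_iff)
qed

lemma linear_form_sum:
  fixes t :: "complex \<Rightarrow> 'w \<Rightarrow> 'w :: ab_group_add"
  assumes "Vector_Spaces.linear t (*) \<phi>"
  shows "\<phi> (\<Sum>a\<in>A. t (c a) (f a)) = (\<Sum>a\<in>A. c a * \<phi> (f a))"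
proof -
  interpret Vector_Spaces.linear t "(*)" \<phi> by fact
  show ?thesis by (simp add: sum scale)
qed

lemma sym_prod_sum:
  fixes t :: "complex \<Rightarrow> 'w \<Rightarrow> 'w :: ab_group_add"
  assumes "finite B" and w: "\<And>i. i < n \<Longrightarrow> w i = (\<Sum>b\<in>B. t (c i b) (e b))"
  shows "sym_prod t (map w [0..<n]) =
    (\<Sum>J\<in>PiE {..<n} (\<lambda>_. B). fscale (\<Prod>i<n. c i (J i)) (sym_prod t (map (\<lambda>i. e (J i)) [0..<n])))"
proof
  fix \<alpha>
  show "sym_prod t (map w [0..<n]) \<alpha> =
    (\<Sum>J\<in>PiE {..<n} (\<lambda>_. B). fscale (\<Prod>i<n. c i (J i)) (sym_prod t (map (\<lambda>i. e (J i)) [0..<n]))) \<alpha>"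
  proof (cases "Vector_Spaces.linear t (*) \<alpha>")
    case True
    have "sym_prod t (map w [0..<n]) \<alpha> = (\<Prod>i<n. \<alpha> (w i))"
      using True by (simp add: sym_prod_def comp_def prod.list_conv_set_nth flip: atLeast0LessThan)
    also have "\<dots> = (\<Prod>i<n. \<Sum>b\<in>B. c i b * \<alpha> (e b))"
      by (intro prod.cong refl) (simp add: w linear_form_sum [OF True])
    also have "\<dots> = (\<Sum>J\<in>PiE {..<n} (\<lambda>_. B). \<Prod>i<n. c i (J i) * \<alpha> (e (J i)))"
      using assms(1) by (intro prod_sum_PiE) auto
    also have "\<dots> = (\<Sum>J\<in>PiE {..<n} (\<lambda>_. B). fscale (\<Prod>i<n. c i (J i)) (sym_prod t (map (\<lambda>i. e (J i)) [0..<n]))) \<alpha>"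
      using True
      by (simp add: sum_fun_apply fscale_def sym_prod_def prod.distrib comp_def prod.list_conv_set_nth flip: atLeast0LessThan)
    finally show ?thesis .
  qed (simp add: sum_fun_apply fscale_def sym_prod_def)
qed

lemma sum_alternating_supersets:
  assumes "finite N" "U \<subseteq> N"
  shows "(\<Sum>S\<in>{S. S \<subseteq> N \<and> U \<subseteq> S}. (- 1) ^ (card N - card S)) = (if U = N then 1 else 0 :: complex)"
proof (cases "U = N")
  case True
  then have "{S. S \<subseteq> N \<and> U \<subseteq> S} = {N}" by auto
  then show ?thesis using True by simp
next
  case False
  let ?A = "{S. S \<subseteq> N \<and> U \<subseteq> S}"
  have "(- 1 :: complex) ^ (card N - card S) = (- 1) ^ card N * (- 1) ^ card S" if "S \<in> ?A" for S
  proof -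
    have "card S \<le> card N" using that assms by (auto intro: card_mono)
    then have "(- 1 :: complex) ^ (card N - card S) * (- 1) ^ card S = (- 1) ^ card N"
      by (simp flip: power_add)
    moreover have "(- 1 :: complex) ^ card S * (- 1) ^ card S = 1"
      by (simp flip: power_mult_distrib)
    ultimately show ?thesis by (metis mult.assoc mult.right_neutral)
  qed
  then have "(\<Sum>S\<in>?A. (- 1 :: complex) ^ (card N - card S)) = (- 1) ^ card N * (\<Sum>S\<in>?A. (- 1) ^ card S)"
    by (simp add: sum_distrib_left)
  also have "(\<Sum>S\<in>?A. (- 1 :: complex) ^ card S) = 0"
    using card_subsupersets_even_odd [of N U] False assms
    by (intro sum_alternating_cancels) (auto simp: conj_assoc)
  finally show ?thesis using False by simp
qed

text \<open>Ryser's formula for the permanent. After expansion over all maps \<open>\<phi>\<close>,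
  the alternating sum over the sets that contain the image of \<open>\<phi>\<close> leaves the
  surjective ones, which are the permutations.\<close>

lemma permanent_inclusion_exclusion:
  fixes a :: "nat \<Rightarrow> nat \<Rightarrow> complex"
  shows "(\<Sum>S\<in>Pow {..<n}. (- 1) ^ (n - card S) * (\<Prod>i<n. \<Sum>r\<in>S. a i r)) =
    (\<Sum>\<sigma> | \<sigma> permutes {..<n}. \<Prod>i<n. a i (\<sigma> i))"
proof -
  let ?P = "PiE {..<n} (\<lambda>_. {..<n})"
  have fin: "finite ?P" by (intro finite_PiE) auto
  have "(\<Sum>S\<in>Pow {..<n}. (- 1) ^ (n - card S) * (\<Prod>i<n. \<Sum>r\<in>S. a i r)) =
    (\<Sum>S\<in>Pow {..<n}. \<Sum>\<phi>\<in>?P. if \<phi> ` {..<n} \<subseteq> S then (- 1) ^ (n - card S) * (\<Prod>i<n. a i (\<phi> i)) else 0)"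
  proof (rule sum.cong [OF refl])
    fix S assume S: "S \<in> Pow {..<n}"
    then have "finite S" by (auto intro: finite_subset)
    then have "(\<Prod>i<n. \<Sum>r\<in>S. a i r) = (\<Sum>\<phi>\<in>PiE {..<n} (\<lambda>_. S). \<Prod>i<n. a i (\<phi> i))"
      by (intro prod_sum_PiE) auto
    then have "(- 1) ^ (n - card S) * (\<Prod>i<n. \<Sum>r\<in>S. a i r) =
        (\<Sum>\<phi>\<in>PiE {..<n} (\<lambda>_. S). (- 1) ^ (n - card S) * (\<Prod>i<n. a i (\<phi> i)))"
      by (simp add: sum_distrib_left)
    also have "\<dots> = (\<Sum>\<phi>\<in>?P. if \<phi> ` {..<n} \<subseteq> S then (- 1) ^ (n - card S) * (\<Prod>i<n. a i (\<phi> i)) else 0)"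
      using S fin by (intro sum.mono_neutral_cong_left) (auto simp: PiE_def Pi_def)
    finally show "(- 1) ^ (n - card S) * (\<Prod>i<n. \<Sum>r\<in>S. a i r) =
        (\<Sum>\<phi>\<in>?P. if \<phi> ` {..<n} \<subseteq> S then (- 1) ^ (n - card S) * (\<Prod>i<n. a i (\<phi> i)) else 0)" .
  qed
  also have "\<dots> = (\<Sum>\<phi>\<in>?P. \<Sum>S\<in>Pow {..<n}. if \<phi> ` {..<n} \<subseteq> S then (- 1) ^ (n - card S) * (\<Prod>i<n. a i (\<phi> i)) else 0)"
    by (rule sum.swap)
  also have "\<dots> = (\<Sum>\<phi>\<in>?P. if \<phi> ` {..<n} = {..<n} then \<Prod>i<n. a i (\<phi> i) else 0)"
  proof (rule sum.cong [OF refl])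
    fix \<phi> assume "\<phi> \<in> ?P"
    then have im: "\<phi> ` {..<n} \<subseteq> {..<n}" by auto
    have "(\<Sum>S\<in>Pow {..<n}. if \<phi> ` {..<n} \<subseteq> S then (- 1) ^ (n - card S) * (\<Prod>i<n. a i (\<phi> i)) else 0) =
        (\<Sum>S\<in>{S. S \<subseteq> {..<n} \<and> \<phi> ` {..<n} \<subseteq> S}. (- 1) ^ (n - card S) * (\<Prod>i<n. a i (\<phi> i)))"
      by (rule sum.mono_neutral_cong_right) auto
    also have "\<dots> = (\<Sum>S\<in>{S. S \<subseteq> {..<n} \<and> \<phi> ` {..<n} \<subseteq> S}. (- 1) ^ (card {..<n} - card S)) * (\<Prod>i<n. a i (\<phi> i))"
      by (simp add: sum_distrib_right)
    finally show "(\<Sum>S\<in>Pow {..<n}. if \<phi> ` {..<n} \<subseteq> S then (- 1) ^ (n - card S) * (\<Prod>i<n. a i (\<phi> i)) else 0) =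
        (if \<phi> ` {..<n} = {..<n} then \<Prod>i<n. a i (\<phi> i) else 0)"
      by (simp only: sum_alternating_supersets [OF finite_lessThan im]) simp
  qed
  also have "\<dots> = (\<Sum>\<phi>\<in>{\<phi> \<in> ?P. \<phi> ` {..<n} = {..<n}}. \<Prod>i<n. a i (\<phi> i))"
    using fin by (intro sum.mono_neutral_cong_right) auto
  also have "\<dots> = (\<Sum>\<sigma> | \<sigma> permutes {..<n}. \<Prod>i<n. a i (\<sigma> i))"
  proof (rule sum.reindex_bij_witness [where j = "\<lambda>\<phi> x. if x < n then \<phi> x else x" and i = "\<lambda>\<sigma>. restrict \<sigma> {..<n}"])
    fix \<phi> assume \<phi>: "\<phi> \<in> {\<phi> \<in> ?P. \<phi> ` {..<n} = {..<n}}"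
    then show "restrict (\<lambda>x. if x < n then \<phi> x else x) {..<n} = \<phi>" by (auto simp: PiE_def extensional_def)
    have "inj_on \<phi> {..<n}" using \<phi> by (intro eq_card_imp_inj_on) auto
    then have "bij_betw \<phi> {..<n} {..<n}" using \<phi> by (auto simp: bij_betw_def)
    then have "bij_betw (\<lambda>x. if x < n then \<phi> x else x) {..<n} {..<n}"
      by (subst bij_betw_cong [where g = \<phi>]) auto
    then show "(\<lambda>x. if x < n then \<phi> x else x) \<in> {\<sigma>. \<sigma> permutes {..<n}}"
      by (auto intro!: bij_imp_permutes split: if_splits)
  next
    fix \<sigma> assume "\<sigma> \<in> {\<sigma>. \<sigma> permutes {..<n}}"
    then have \<sigma>: "\<sigma> permutes {..<n}" by simp
    show "(\<lambda>x. if x < n then restrict \<sigma> {..<n} x else x) = \<sigma>"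
      using permutes_not_in [OF \<sigma>] by auto
    show "restrict \<sigma> {..<n} \<in> {\<phi> \<in> ?P. \<phi> ` {..<n} = {..<n}}"
      using permutes_image [OF \<sigma>] permutes_in_image [OF \<sigma>] by auto
  qed auto
  finally show ?thesis .
qed

locale based_space = vector_space s for s :: "complex \<Rightarrow> 'v \<Rightarrow> 'v :: ab_group_add" +
  fixes es :: "'v list"
  assumes ob: "ordered_basis s es"
begin

abbreviation "D \<equiv> length es"

definition crd :: "nat \<Rightarrow> 'v \<Rightarrow> complex" where
  "crd k v = representation (set es) v (es ! k)"

lemma basis: "distinct es" "independent (set es)" "span (set es) = UNIV"
  using ob by (auto simp: ordered_basis_def)

lemma crd_add: "crd k (u + v) = crd k u + crd k v"
  by (simp add: crd_def representation_add basis)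

lemma crd_scale: "crd k (s c v) = c * crd k v"
  by (simp add: crd_def representation_scale basis)

lemma crd_sum: "crd k (\<Sum>a\<in>A. v a) = (\<Sum>a\<in>A. crd k (v a))"
  by (simp add: crd_def representation_sum basis)

lemma crd_basis: "k < D \<Longrightarrow> l < D \<Longrightarrow> crd k (es ! l) = (if k = l then 1 else 0)"
  using basis(1) by (simp add: crd_def representation_basis basis nth_eq_iff_index_eq)

lemma crd_expand: "v = (\<Sum>k<D. s (crd k v) (es ! k))"
proof -
  have "(\<Sum>b\<in>set es. s (representation (set es) v b) b) = v"
    by (rule sum_representation_eq) (use basis in auto)
  moreover have "(\<Sum>k<D. s (crd k v) (es ! k)) = (\<Sum>b\<in>set es. s (representation (set es) v b) b)"
    unfolding crd_def
    by (rule sum.reindex_bij_betw [of "(!) es"]) (use basis in \<open>auto intro: bij_betw_nth\<close>)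
  ultimately show ?thesis by simp
qed

lemma linear_form_expand:
  "Vector_Spaces.linear s (*) \<alpha> \<Longrightarrow> \<alpha> v = (\<Sum>k<D. crd k v * \<alpha> (es ! k))"
  by (subst crd_expand [of v]) (rule linear_form_sum)

definition form :: "(nat \<Rightarrow> complex) \<Rightarrow> 'v \<Rightarrow> complex" where
  "form y v = (\<Sum>k<D. crd k v * y k)"

lemma linear_form: "Vector_Spaces.linear s (*) (form y)"
  by (rule linear_formI)
    (auto simp: form_def crd_add crd_scale algebra_simps sum.distrib sum_distrib_left vector_space_axioms)

lemma form_basis: "k < D \<Longrightarrow> form y (es ! k) = y k"
  by (simp add: form_def crd_basis if_distrib [of "\<lambda>c. c * _"] cong: if_cong)

lemma linear_form_eq: "Vector_Spaces.linear s (*) \<alpha> \<Longrightarrow> \<alpha> = form (\<lambda>k. \<alpha> (es ! k))"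
  by (rule ext) (unfold form_def, rule linear_form_expand)

definition gmat :: "(nat \<Rightarrow> nat \<Rightarrow> complex) \<Rightarrow> 'v \<Rightarrow> 'v" where
  "gmat G v = (\<Sum>l<D. s (crd l v) (\<Sum>k<D. s (G k l) (es ! k)))"

lemma linear_gmat: "Vector_Spaces.linear s s (gmat G)"
proof -
  have "gmat G (u + v) = gmat G u + gmat G v" for u v
    by (simp add: gmat_def crd_add scale_left_distrib sum.distrib)
  moreover have "gmat G (s c v) = s c (gmat G v)" for c v
    by (simp add: gmat_def crd_scale scale_sum_right mult.assoc)
  ultimately show ?thesis by (simp add: Vector_Spaces.linear_iff vector_space_axioms)
qed

lemma gmat_basis: "l < D \<Longrightarrow> gmat G (es ! l) = (\<Sum>k<D. s (G k l) (es ! k))"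
  by (simp add: gmat_def crd_basis if_distrib [of "\<lambda>c. s c _"] cong: if_cong)

lemma crd_gmat: "k < D \<Longrightarrow> crd k (gmat G v) = (\<Sum>l<D. G k l * crd l v)"
  by (simp add: gmat_def crd_sum crd_scale crd_basis if_distrib [of "\<lambda>c. _ * c"] mult.commute cong: if_cong)

lemma gmat_inverse:
  assumes "\<And>k l. k < D \<Longrightarrow> l < D \<Longrightarrow> (\<Sum>j<D. G k j * H j l) = (if k = l then 1 else 0)"
  shows "gmat G (gmat H v) = v"
proof -
  have "crd k (gmat G (gmat H v)) = crd k v" if "k < D" for k
  proof -
    have "crd k (gmat G (gmat H v)) = (\<Sum>j<D. \<Sum>l<D. G k j * H j l * crd l v)"
      using that by (simp add: crd_gmat sum_distrib_left mult.assoc)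
    also have "\<dots> = (\<Sum>l<D. \<Sum>j<D. G k j * H j l * crd l v)" by (rule sum.swap)
    also have "\<dots> = (\<Sum>l<D. (if k = l then 1 else 0) * crd l v)"
      using that by (simp add: assms flip: sum_distrib_right)
    also have "\<dots> = crd k v" using that by (simp add: if_distrib [of "\<lambda>c. c * _"] cong: if_cong)
    finally show ?thesis .
  qed
  then have "(\<Sum>k<D. s (crd k (gmat G (gmat H v))) (es ! k)) = (\<Sum>k<D. s (crd k v) (es ! k))" by simp
  then show ?thesis by (simp only: crd_expand [symmetric])
qed

lemma gmat_GL:
  assumes "\<And>k l. k < D \<Longrightarrow> l < D \<Longrightarrow> (\<Sum>j<D. G k j * H j l) = (if k = l then 1 else 0)"
    "\<And>k l. k < D \<Longrightarrow> l < D \<Longrightarrow> (\<Sum>j<D. H k j * G j l) = (if k = l then 1 else 0)"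
  shows "gmat G \<in> GL s"
proof -
  have "gmat G \<circ> gmat H = id" "gmat H \<circ> gmat G = id"
    using gmat_inverse [of G H] gmat_inverse [of H G] assms by (auto simp: fun_eq_iff)
  then show ?thesis using linear_gmat o_bij by (auto simp: GL_def)
qed

text \<open>The conjugate transpose of an invertible matrix is invertible; its inverse is the
  conjugate transpose of the matrix of \<open>inv g\<close>. This feeds the closure hypothesis of
  \<open>GL_module_complement\<close>.\<close>

lemma GL_adjoint:
  assumes "g \<in> GL s"
  shows "\<exists>h\<in>GL s. \<forall>k<D. \<forall>l<D. crd k (h (es ! l)) = cnj (crd l (g (es ! k)))"
proof -
  have g: "Vector_Spaces.linear s s g" "bij g" using assms by (auto simp: GL_def)
  interpret g: Vector_Spaces.linear s s g by (rule g)
  have inv: "Vector_Spaces.linear s s (inv g)"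
  proof -
    have "inv g (x + y) = inv g x + inv g y" "inv g (s c x) = s c (inv g x)" for x y c
      using g(2) by (metis bij_inv_eq_iff g.add, metis bij_inv_eq_iff g.scale)
    then show ?thesis by (simp add: Vector_Spaces.linear_iff vector_space_axioms)
  qed
  have mm: "(\<Sum>j<D. crd k (a (es ! j)) * crd j (b (es ! l))) = (if k = l then 1 else 0)"
    if "Vector_Spaces.linear s s a" "\<And>v. a (b v) = v" "k < D" "l < D" for a b k l
  proof -
    interpret a: Vector_Spaces.linear s s a by (rule that)
    have "es ! l = a (\<Sum>j<D. s (crd j (b (es ! l))) (es ! j))"
      using that(2) crd_expand [of "b (es ! l)"] by simp
    also have "\<dots> = (\<Sum>j<D. s (crd j (b (es ! l))) (a (es ! j)))" by (simp add: a.sum a.scale)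
    finally have "crd k (es ! l) = crd k (\<Sum>j<D. s (crd j (b (es ! l))) (a (es ! j)))"
      by (rule arg_cong)
    also have "\<dots> = (\<Sum>j<D. crd j (b (es ! l)) * crd k (a (es ! j)))"
      by (simp add: crd_sum crd_scale)
    finally show ?thesis using that by (simp add: crd_basis mult.commute)
  qed
  define G where "G k l = cnj (crd l (g (es ! k)))" for k l
  define H where "H k l = cnj (crd l (inv g (es ! k)))" for k l
  have "gmat G \<in> GL s"
  proof (rule gmat_GL [where H = H])
    fix k l assume kl: "k < D" "l < D"
    have "(\<Sum>j<D. G k j * H j l) = cnj (\<Sum>j<D. crd l (inv g (es ! j)) * crd j (g (es ! k)))"
      by (simp add: G_def H_def mult.commute)
    also have "(\<Sum>j<D. crd l (inv g (es ! j)) * crd j (g (es ! k))) = (if l = k then 1 else 0)"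
      using kl g(2) by (intro mm inv) (auto simp: bij_is_inj)
    finally show "(\<Sum>j<D. G k j * H j l) = (if k = l then 1 else 0)" by simp
    have "(\<Sum>j<D. H k j * G j l) = cnj (\<Sum>j<D. crd l (g (es ! j)) * crd j (inv g (es ! k)))"
      by (simp add: G_def H_def mult.commute)
    also have "(\<Sum>j<D. crd l (g (es ! j)) * crd j (inv g (es ! k))) = (if l = k then 1 else 0)"
      using kl g(2) by (intro mm g(1)) (auto simp: bij_is_surj surj_f_inv_f)
    finally show "(\<Sum>j<D. H k j * G j l) = (if k = l then 1 else 0)" by simp
  qed
  moreover have "crd k (gmat G (es ! l)) = G k l" if "k < D" "l < D" for k l
    using that by (simp add: crd_gmat crd_basis if_distrib [of "\<lambda>c. _ * c"] cong: if_cong)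
  ultimately show ?thesis by (auto simp: G_def intro!: bexI [of _ "gmat G"])
qed

end

section \<open>Polarization\<close>

interpretation fs: vector_space fscale by (rule vector_space_fscale)

locale sym_power = based_space s es
  for s :: "complex \<Rightarrow> 'v \<Rightarrow> 'v :: ab_group_add" and es +
  fixes n d :: nat
begin

definition M where "M = Sym fscale n (Sym s d UNIV)"

definition act :: "('v \<Rightarrow> 'v) \<Rightarrow> (((('v \<Rightarrow> complex) \<Rightarrow> complex) \<Rightarrow> complex) \<Rightarrow> complex) \<Rightarrow> ((('v \<Rightarrow> complex) \<Rightarrow> complex) \<Rightarrow> complex) \<Rightarrow> complex"
  where "act g = Sym_map (Sym_map g)"

lemma GL_module_M: "GL_module s fscale act M"
  unfolding M_def act_def by (rule GL_module_Sym_Sym)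

text \<open>Indices are arbitrary tuples, not sorted ones, so products recur under several indices;
  the family serves as a spanning family and not as a basis.\<close>

definition mon :: "(nat \<Rightarrow> nat) \<Rightarrow> ('v \<Rightarrow> complex) \<Rightarrow> complex" where
  "mon J = sym_prod s (map (\<lambda>j. es ! J j) [0..<d])"

definition mon2 :: "(nat \<Rightarrow> nat \<Rightarrow> nat) \<Rightarrow> ((('v \<Rightarrow> complex) \<Rightarrow> complex) \<Rightarrow> complex) \<Rightarrow> complex" where
  "mon2 I = sym_prod fscale (map (\<lambda>i. mon (I i)) [0..<n])"

definition Jdx where "Jdx = PiE {..<d} (\<lambda>_. {..<D})"
definition Idx where "Idx = PiE {..<n} (\<lambda>_. Jdx)"

lemma finite_Jdx: "finite Jdx" and finite_Idx: "finite Idx"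
  by (auto simp: Jdx_def Idx_def intro!: finite_PiE)

lemma Idx_less: "I \<in> Idx \<Longrightarrow> i < n \<Longrightarrow> j < d \<Longrightarrow> I i j < D"
  by (force simp: Idx_def Jdx_def PiE_def Pi_def)

lemma sym_prod_vectors:
  "sym_prod s (map w [0..<d]) = (\<Sum>J\<in>Jdx. fscale (\<Prod>j<d. crd (J j) (w j)) (mon J))"
  unfolding Jdx_def mon_def by (rule sym_prod_sum [where c = "\<lambda>j k. crd k (w j)"]) (rule finite_lessThan, rule crd_expand)

lemma Sym_expand:
  assumes "p \<in> Sym s d UNIV"
  shows "\<exists>c. p = (\<Sum>J\<in>Jdx. fscale (c J) (mon J))"
proof -
  have "{sym_prod s ws | ws. length ws = d \<and> set ws \<subseteq> UNIV} \<subseteq> fs.span (mon ` Jdx)"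
  proof
    fix q assume "q \<in> {sym_prod s ws | ws. length ws = d \<and> set ws \<subseteq> UNIV}"
    then obtain ws where q: "q = sym_prod s ws" and "length ws = d" by blast
    then have "ws = map ((!) ws) [0..<d]" by (metis map_nth)
    then have "q = (\<Sum>J\<in>Jdx. fscale (\<Prod>j<d. crd (J j) (ws ! j)) (mon J))"
      using sym_prod_vectors [of "(!) ws"] q by simp
    also have "\<dots> \<in> fs.span (mon ` Jdx)" by (intro fs.span_sum fs.span_scale fs.span_base) auto
    finally show "q \<in> fs.span (mon ` Jdx)" .
  qed
  then have "p \<in> fs.span (mon ` Jdx)"
    using assms fs.span_minimal [OF _ fs.subspace_span] unfolding Sym_def by blast
  then show ?thesis by (rule fs.span_image_sum [OF finite_Jdx])
qed

lemma mon_Sym: "mon J \<in> Sym s d UNIV"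
  unfolding Sym_def mon_def by (intro fs.span_base CollectI exI conjI) auto

lemma mon2_M: "mon2 I \<in> M"
  unfolding M_def Sym_def [of fscale] mon2_def
  by (intro fs.span_base CollectI exI conjI refl) (auto simp: mon_Sym)

lemma subspace_M: "fs.subspace M"
  using GL_module_M by (simp add: GL_module_def)

lemma sym_prod_Syms:
  assumes "\<And>i. i < n \<Longrightarrow> w i = (\<Sum>J\<in>Jdx. fscale (c i J) (mon J))"
  shows "sym_prod fscale (map w [0..<n]) = (\<Sum>I\<in>Idx. fscale (\<Prod>i<n. c i (I i)) (mon2 I))"
  unfolding Idx_def mon2_def by (rule sym_prod_sum [where c = c and e = mon and w = w, OF finite_Jdx]) (rule assms)

lemma M_span: "M = fs.span (mon2 ` Idx)"
proof
  have "{sym_prod fscale ws | ws. length ws = n \<and> set ws \<subseteq> Sym s d UNIV} \<subseteq> fs.span (mon2 ` Idx)"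
  proof
    fix q assume "q \<in> {sym_prod fscale ws | ws. length ws = n \<and> set ws \<subseteq> Sym s d UNIV}"
    then obtain ws where q: "q = sym_prod fscale ws" and ws: "length ws = n" "set ws \<subseteq> Sym s d UNIV" by blast
    have "\<forall>i\<in>{..<n}. \<exists>c. ws ! i = (\<Sum>J\<in>Jdx. fscale (c J) (mon J))"
    proof
      fix i assume "i \<in> {..<n}"
      then have "ws ! i \<in> set ws" using ws(1) by simp
      then show "\<exists>c. ws ! i = (\<Sum>J\<in>Jdx. fscale (c J) (mon J))"
        by (rule Sym_expand [OF subsetD [OF ws(2)]])
    qed
    from bchoice [OF this] obtain c where c: "\<forall>i\<in>{..<n}. ws ! i = (\<Sum>J\<in>Jdx. fscale (c i J) (mon J))" ..
    then have "ws ! i = (\<Sum>J\<in>Jdx. fscale (c i J) (mon J))" if "i < n" for i by (rule bspec) (simp add: that)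
    then have "sym_prod fscale (map ((!) ws) [0..<n]) = (\<Sum>I\<in>Idx. fscale (\<Prod>i<n. c i (I i)) (mon2 I))"
      by (rule sym_prod_Syms)
    moreover have "ws = map ((!) ws) [0..<n]" using ws by (metis map_nth)
    ultimately have "q = (\<Sum>I\<in>Idx. fscale (\<Prod>i<n. c i (I i)) (mon2 I))" using q by simp
    also have "\<dots> \<in> fs.span (mon2 ` Idx)" by (intro fs.span_sum fs.span_scale fs.span_base) auto
    finally show "q \<in> fs.span (mon2 ` Idx)" .
  qed
  then show "M \<subseteq> fs.span (mon2 ` Idx)"
    unfolding M_def Sym_def [of fscale] by (rule fs.span_minimal [OF _ fs.subspace_span])
  show "fs.span (mon2 ` Idx) \<subseteq> M" using mon2_M by (intro fs.span_minimal subspace_M) auto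
qed

lemma M_expand: "F \<in> M \<Longrightarrow> \<exists>T. F = (\<Sum>I\<in>Idx. fscale (T I) (mon2 I))"
  unfolding M_span by (rule fs.span_image_sum [OF finite_Idx])

text \<open>The matrix of \<open>g\<close> on the tensor power of \<open>V\<close> with
  \<open>n * d\<close> factors. Its entries are products of entries of \<open>g\<close>, so it is
  polynomial in \<open>g\<close> and compatible with conjugate transposition.\<close>

definition mcoef :: "('v \<Rightarrow> 'v) \<Rightarrow> (nat \<Rightarrow> nat \<Rightarrow> nat) \<Rightarrow> (nat \<Rightarrow> nat \<Rightarrow> nat) \<Rightarrow> complex" where
  "mcoef g K I = (\<Prod>i<n. \<Prod>j<d. crd (K i j) (g (es ! I i j)))"

lemma act_mon2:
  assumes g: "g \<in> GL s"
  shows "act g (mon2 I) = (\<Sum>K\<in>Idx. fscale (mcoef g K I) (mon2 K))"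
proof -
  have "Sym_map g (mon J) = (\<Sum>K\<in>Jdx. fscale (\<Prod>j<d. crd (K j) (g (es ! J j))) (mon K))" for J
    unfolding mon_def [of J] Sym_map_sym_prod [OF g] map_map comp_def by (rule sym_prod_vectors)
  then have "sym_prod fscale (map (\<lambda>i. Sym_map g (mon (I i))) [0..<n]) =
      (\<Sum>K\<in>Idx. fscale (\<Prod>i<n. \<Prod>j<d. crd (K i j) (g (es ! I i j))) (mon2 K))"
    by (intro sym_prod_Syms)
  then show ?thesis
    unfolding act_def mon2_def [of I] Sym_map_sym_prod [OF GL_Sym_map [OF g]] map_map comp_def mcoef_def .
qed

lemma act_scale: "act g (fscale c F) = fscale c (act g F)"
  by (simp add: act_def Sym_map_def fscale_def)

lemma act_sum: "act g (\<Sum>a\<in>A. F a) = (\<Sum>a\<in>A. act g (F a))"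
  by (rule ext) (simp add: act_def Sym_map_def sum_fun_apply)

lemma complete_reducibility: "\<exists>\<D>. irreducible_decomposition s fscale act M \<D>"
proof (rule irreducible_decomposition_exists [OF vector_space_fscale finite_imageI [OF finite_Idx]
      eq_refl [OF M_span] _ GL_module_M order_refl])
  fix N assume N: "GL_module s fscale act N" "N \<subseteq> M"
  show "\<exists>N'. GL_module s fscale act N' \<and> N' \<subseteq> M \<and> N \<inter> N' = {0} \<and> (\<forall>x\<in>M. \<exists>a\<in>N. \<exists>b\<in>N'. x = a + b)"
  proof (rule GL_module_complement [OF vector_space_fscale finite_Idx GL_module_M M_span act_mon2 _ N])
    fix g assume "g \<in> GL s"
    then obtain h where h: "h \<in> GL s" "\<forall>k<D. \<forall>l<D. crd k (h (es ! l)) = cnj (crd l (g (es ! k)))"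
      using GL_adjoint by blast
    have "mcoef h K I = cnj (mcoef g I K)" if "K \<in> Idx" "I \<in> Idx" for K I
      using that h(2) Idx_less by (auto simp: mcoef_def intro!: prod.cong)
    then show "\<exists>h\<in>GL s. \<forall>K\<in>Idx. \<forall>I\<in>Idx. mcoef h K I = cnj (mcoef g I K)" using h(1) by blast
  qed
qed

lemma polynomial_submodule:
  assumes N: "GL_module s fscale act N" "N \<subseteq> M"
  shows "polynomial_GL_module s fscale act N"
  unfolding polynomial_GL_module_def
proof (intro conjI ballI allI impI)
  show "GL_module s fscale act N" by fact
  have sN: "fs.subspace N" using N by (simp add: GL_module_def)
  obtain B where B: "B \<subseteq> N" "fs.independent B" "N \<subseteq> fs.span B"
    using fs.maximal_independent_subset_extend [of "{}" N] fs.independent_empty by auto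
  have "finite B"
    using fs.independent_span_bound [of "mon2 ` Idx" B] B N M_span finite_Idx by auto
  moreover have "fs.span B = N" using B fs.span_minimal [OF B(1) sN] by auto
  ultimately show "\<exists>B. finite B \<and> fs.span B = N" by blast
next
  fix F and \<phi> :: "(((('v \<Rightarrow> complex) \<Rightarrow> complex) \<Rightarrow> complex) \<Rightarrow> complex) \<Rightarrow> complex"
  assume F: "F \<in> N" and \<phi>: "Vector_Spaces.linear fscale (*) \<phi>"
  obtain T where T: "F = (\<Sum>I\<in>Idx. fscale (T I) (mon2 I))" using M_expand F N by blast
  have sum_poly: "(\<lambda>g. \<Sum>a\<in>A. p a g) \<in> poly_funs s" if "\<And>a. a \<in> A \<Longrightarrow> p a \<in> poly_funs s" for p and A :: "'z set"
    using that
    by (induction A rule: infinite_finite_induct) (auto intro: poly_funs.const poly_funs.add)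
  have prod_poly: "(\<lambda>g. \<Prod>a\<in>A. p a g) \<in> poly_funs s" if "\<And>a. a \<in> A \<Longrightarrow> p a \<in> poly_funs s" for p and A :: "'z set"
    using that
    by (induction A rule: infinite_finite_induct) (auto intro: poly_funs.const poly_funs.mult)
  have lin: "Vector_Spaces.linear s (*) (crd k)" for k
    by (rule linear_formI) (auto simp: crd_add crd_scale vector_space_axioms)
  show "\<exists>p\<in>poly_funs s. \<forall>g\<in>GL s. \<phi> (act g F) = p g"
  proof (intro bexI ballI)
    fix g assume "g \<in> GL s"
    then have "act g F = (\<Sum>I\<in>Idx. fscale (T I) (\<Sum>K\<in>Idx. fscale (mcoef g K I) (mon2 K)))"
      by (simp add: T act_sum act_scale act_mon2)
    then show "\<phi> (act g F) = (\<Sum>I\<in>Idx. T I * (\<Sum>K\<in>Idx. mcoef g K I * \<phi> (mon2 K)))"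
      by (simp add: linear_form_sum [OF \<phi>])
  next
    show "(\<lambda>g. \<Sum>I\<in>Idx. T I * (\<Sum>K\<in>Idx. mcoef g K I * \<phi> (mon2 K))) \<in> poly_funs s"
      unfolding mcoef_def
      by (intro sum_poly prod_poly poly_funs.mult poly_funs.const poly_funs.entry lin)
  qed
qed

text \<open>Elements of \<open>M\<close> are functions of linear forms on
  \<open>S\<^sup>d V\<close>. Evaluation at a linear form on \<open>V\<close> is such a form, and
  sums of evaluations are the arguments that inclusion-exclusion asks for.\<close>

definition ev :: "nat set \<Rightarrow> (nat \<times> nat \<Rightarrow> complex) \<Rightarrow> (('v \<Rightarrow> complex) \<Rightarrow> complex) \<Rightarrow> complex" where
  "ev S x = (\<lambda>p. \<Sum>i\<in>S. p (form (\<lambda>k. x (i, k))))"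

text \<open>The full polarization of \<open>F\<close>, evaluated at the \<open>n\<close> linear forms on \<open>V\<close> whose coordinates are
  the rows of \<open>x\<close>.\<close>

definition polar :: "(((('v \<Rightarrow> complex) \<Rightarrow> complex) \<Rightarrow> complex) \<Rightarrow> complex) \<Rightarrow> (nat \<times> nat \<Rightarrow> complex) \<Rightarrow> complex"
  where
  "polar F x = (\<Sum>S\<in>Pow {..<n}. (- 1) ^ (n - card S) * F (ev S x))"

lemma linear_ev: "Vector_Spaces.linear fscale (*) (ev S x)"
  by (rule linear_formI [OF vector_space_fscale])
    (auto simp: ev_def fscale_def sum.distrib sum_distrib_left)

lemma mon_form: "J \<in> Jdx \<Longrightarrow> mon J (form y) = (\<Prod>j<d. y (J j))"
  by (auto simp: mon_def sym_prod_def linear_form Jdx_def comp_def prod.list_conv_set_nth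
      form_basis PiE_def Pi_def simp flip: atLeast0LessThan intro!: prod.cong)

lemma mon_nonlinear: "\<not> Vector_Spaces.linear s (*) \<alpha> \<Longrightarrow> mon J \<alpha> = 0"
  by (simp add: mon_def sym_prod_def)

lemma mon2_linear: "Vector_Spaces.linear fscale (*) \<Phi> \<Longrightarrow> mon2 I \<Phi> = (\<Prod>i<n. \<Phi> (mon (I i)))"
  by (simp add: mon2_def sym_prod_def comp_def prod.list_conv_set_nth flip: atLeast0LessThan)

lemma Idx_Jdx: "I \<in> Idx \<Longrightarrow> i < n \<Longrightarrow> I i \<in> Jdx"
  by (auto simp: Idx_def)

text \<open>Ryser's formula turns the polarization of a product into the row symmetrization of a
  monomial; degrees and symmetries of \<open>polar F\<close> are read off from this.\<close>

lemma polar_mon2: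
  assumes "I \<in> Idx"
  shows "polar (mon2 I) x = (\<Sum>\<sigma> | \<sigma> permutes {..<n}. \<Prod>i<n. \<Prod>j<d. x (\<sigma> i, I i j))"
proof -
  have "mon2 I (ev S x) = (\<Prod>i<n. \<Sum>r\<in>S. \<Prod>j<d. x (r, I i j))" for S
    unfolding mon2_linear [OF linear_ev]
    by (intro prod.cong refl) (use assms Idx_Jdx in \<open>auto simp: ev_def mon_form\<close>)
  then show ?thesis
    unfolding polar_def by (simp only: permanent_inclusion_exclusion)
qed

lemma polar_add: "polar (F + G) x = polar F x + polar G x"
  and polar_diff: "polar (F - G) x = polar F x - polar G x"
  and polar_scale: "polar (fscale c F) x = c * polar F x"
  by (simp_all add: polar_def fscale_def algebra_simps sum.distrib sum_subtractf sum_distrib_left)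

lemma polar_zero: "polar 0 x = 0"
  by (simp add: polar_def)

lemma polar_sum: "polar (\<Sum>a\<in>A. F a) x = (\<Sum>a\<in>A. polar (F a) x)"
  by (induction A rule: infinite_finite_induct) (simp_all only: sum.infinite sum.empty sum.insert polar_zero polar_add not_False_eq_True)

lemma polar_expand:
  assumes "F = (\<Sum>I\<in>Idx. fscale (T I) (mon2 I))"
  shows "polar F x = (\<Sum>I\<in>Idx. T I * (\<Sum>\<sigma> | \<sigma> permutes {..<n}. \<Prod>i<n. \<Prod>j<d. x (\<sigma> i, I i j)))"
  by (simp add: assms polar_sum polar_scale polar_mon2)

lemma polar_polyfun:
  assumes "F \<in> M"
  shows "polar F \<in> polyfun (grid n D)"
proof -
  obtain T where T: "F = (\<Sum>I\<in>Idx. fscale (T I) (mon2 I))" using M_expand assms by blast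
  have "polar F = (\<lambda>x. \<Sum>I\<in>Idx. T I * (\<Sum>\<sigma> | \<sigma> permutes {..<n}. \<Prod>i<n. \<Prod>j<d. x (\<sigma> i, I i j)))"
    using polar_expand [OF T] by auto
  also have "\<dots> \<in> polyfun (grid n D)"
  proof (intro polyfun_sum polyfun_cmult polyfun_prod polyfun.var)
    fix I \<sigma> i j
    assume I: "I \<in> Idx" and \<sigma>: "\<sigma> \<in> {\<sigma>. \<sigma> permutes {..<n}}" and i: "i \<in> {..<n}" and j: "j \<in> {..<d}"
    then have "\<sigma> i < n" using permutes_in_image [of \<sigma> "{..<n}" i] by auto
    then show "(\<sigma> i, I i j) \<in> grid n D" using Idx_less I i j by auto
  qed
  finally show ?thesis .
qed

lemma polar_rowscale:
  assumes "F \<in> M"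
  shows "polar F (rowscale c x) = (\<Prod>i<n. c i) ^ d * polar F x"
proof -
  obtain T where T: "F = (\<Sum>I\<in>Idx. fscale (T I) (mon2 I))" using M_expand assms by blast
  have "(\<Prod>i<n. \<Prod>j<d. rowscale c x (\<sigma> i, I i j)) = (\<Prod>i<n. c i) ^ d * (\<Prod>i<n. \<Prod>j<d. x (\<sigma> i, I i j))"
    if "\<sigma> permutes {..<n}" for \<sigma> I
  proof -
    have "(\<Prod>i<n. c (\<sigma> i) ^ d) = (\<Prod>i<n. c i ^ d)"
      using prod.permute [OF that, of "\<lambda>i. c i ^ d"] by simp
    then show ?thesis by (simp add: rowscale_def prod.distrib prod_power_distrib)
  qed
  then show ?thesis by (simp add: polar_expand [OF T] sum_distrib_left ac_simps)
qed

lemma polar_rowperm: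
  assumes "F \<in> M" "\<tau> permutes {..<n}"
  shows "polar F (rowperm \<tau> x) = polar F x"
proof -
  obtain T where T: "F = (\<Sum>I\<in>Idx. fscale (T I) (mon2 I))" using M_expand assms by blast
  have "(\<Sum>\<sigma> | \<sigma> permutes {..<n}. \<Prod>i<n. \<Prod>j<d. rowperm \<tau> x (\<sigma> i, I i j)) =
      (\<Sum>\<sigma> | \<sigma> permutes {..<n}. \<Prod>i<n. \<Prod>j<d. x (\<sigma> i, I i j))" for I
    using setum_permutations_compose_left [OF assms(2), of "\<lambda>\<sigma>. \<Prod>i<n. \<Prod>j<d. x (\<sigma> i, I i j)"]
    by (simp add: rowperm_def)
  then show ?thesis by (simp add: polar_expand [OF T])
qed

text \<open>A row of \<open>x\<close> is a linear form on \<open>V\<close>; composing it with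
  \<open>g\<close> multiplies it from the right by the matrix of \<open>g\<close>. So the group acts
  by column operations.\<close>

definition mat_act :: "('v \<Rightarrow> 'v) \<Rightarrow> (nat \<times> nat \<Rightarrow> complex) \<Rightarrow> nat \<times> nat \<Rightarrow> complex" where
  "mat_act g x = (\<lambda>(i, l). \<Sum>k<D. x (i, k) * crd k (g (es ! l)))"

lemma polar_act:
  assumes "g \<in> GL s"
  shows "polar (act g F) x = polar F (mat_act g x)"
proof -
  have g: "Vector_Spaces.linear s s g" using assms by (simp add: GL_def)
  have "form y \<circ> g = form (\<lambda>l. \<Sum>k<D. y k * crd k (g (es ! l)))" for y
  proof -
    have "Vector_Spaces.linear s (*) (form y \<circ> g)" using g linear_form by (rule Vector_Spaces.linear_compose)
    then have "form y \<circ> g = form (\<lambda>l. (form y \<circ> g) (es ! l))" by (rule linear_form_eq)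
    also have "(\<lambda>l. (form y \<circ> g) (es ! l)) = (\<lambda>l. \<Sum>k<D. y k * crd k (g (es ! l)))"
      by (simp add: form_def mult.commute)
    finally show ?thesis .
  qed
  then have "ev S x \<circ> Sym_map g = ev S (mat_act g x)" for S
    by (auto simp: ev_def Sym_map_def mat_act_def)
  then show ?thesis by (simp add: polar_def act_def Sym_map_def)
qed

lemma polar_cong:
  assumes "F \<in> M" "\<And>i k. i < n \<Longrightarrow> k < D \<Longrightarrow> x (i, k) = y (i, k)"
  shows "polar F x = polar F y"
  by (rule polyfun_cong [OF polar_polyfun [OF assms(1)]]) (use assms(2) in auto)

text \<open>\<open>\<Phi>\<close> is arbitrary on the ambient function space, but on the
  \<open>mon J\<close> it is a combination of evaluations: a linear relation that holds under all
  evaluations is a relation between the functions \<open>mon J\<close> themselves, and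
  \<open>\<Phi>\<close> respects it.\<close>

lemma linear_form_evaluations:
  assumes \<Phi>: "Vector_Spaces.linear fscale (*) \<Phi>"
  shows "\<exists>Z a. finite Z \<and> (\<forall>J\<in>Jdx. \<Phi> (mon J) = (\<Sum>z\<in>Z. a z * mon J (form z)))"
proof -
  define vz where "vz z = (\<lambda>J. if J \<in> Jdx then mon J (form z) else 0)" for z
  define v0 where "v0 = (\<lambda>J. if J \<in> Jdx then \<Phi> (mon J) else 0)"
  have "v0 \<in> fs.span (range vz)"
  proof (rule ccontr)
    \<comment> \<open>Otherwise a functional \<open>\<psi>\<close> would vanish on all
      \<open>vz z\<close> but not at \<open>v0\<close>; its coordinates \<open>c\<close> would form
      a relation between the \<open>mon J\<close> that \<open>\<Phi>\<close> violates.\<close>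
    assume v0: "v0 \<notin> fs.span (range vz)"
    obtain B where B: "B \<subseteq> range vz" "fs.independent B" "range vz \<subseteq> fs.span B"
      using fs.maximal_independent_subset_extend [of "{}" "range vz"] fs.independent_empty by auto
    have "v0 \<notin> fs.span B" using v0 fs.span_mono [OF B(1)] by auto
    then have ind: "fs.independent (insert v0 B)" using B(2) by (rule fs.independent_insertI)
    have vm: "vector_space ((*) :: complex \<Rightarrow> _)" by unfold_locales (auto simp: algebra_simps)
    interpret vp: vector_space_pair "fscale :: complex \<Rightarrow> ((nat \<Rightarrow> nat) \<Rightarrow> complex) \<Rightarrow> _" "(*) :: complex \<Rightarrow> _"
      using vm vector_space_fscale by (simp add: vector_space_pair_def)
    obtain \<psi> where \<psi>: "Vector_Spaces.linear fscale (*) \<psi>" "\<forall>x\<in>insert v0 B. \<psi> x = (if x = v0 then 1 else 0)"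
      using vp.linear_independent_extend [OF ind, of "\<lambda>x. if x = v0 then 1 else 0"] by blast
    have "v0 \<notin> B" using \<open>v0 \<notin> fs.span B\<close> fs.span_base by blast
    then have "\<psi> b = 0" if "b \<in> B" for b using \<psi>(2) that by auto
    then have \<psi>z: "\<psi> (vz z) = 0" for z
      using vp.linear_eq_0_on_span [OF \<psi>(1), of B] B(3) by blast
    define c where "c J = \<psi> (\<lambda>K. if K = J then 1 else 0)" for J
    have \<psi>_sum: "\<psi> v = (\<Sum>J\<in>Jdx. v J * c J)" if "\<And>J. J \<notin> Jdx \<Longrightarrow> v J = 0" for v
    proof -
      have "v = (\<Sum>J\<in>Jdx. fscale (v J) (\<lambda>K. if K = J then 1 else 0))"
      proof
        fix K
        have "(\<Sum>J\<in>Jdx. fscale (v J) (\<lambda>K. if K = J then 1 else 0)) K = (\<Sum>J\<in>Jdx. if K = J then v J else 0)"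
          unfolding sum_fun_apply fscale_def by (rule sum.cong) simp_all
        then show "v K = (\<Sum>J\<in>Jdx. fscale (v J) (\<lambda>K. if K = J then 1 else 0)) K"
          using that [of K] finite_Jdx by simp
      qed
      then have "\<psi> v = \<psi> (\<Sum>J\<in>Jdx. fscale (v J) (\<lambda>K. if K = J then 1 else 0))" by (rule arg_cong)
      then show ?thesis by (simp only: linear_form_sum [OF \<psi>(1)] c_def)
    qed
    have "(\<Sum>J\<in>Jdx. fscale (c J) (mon J)) = 0"
    proof
      fix \<alpha>
      show "(\<Sum>J\<in>Jdx. fscale (c J) (mon J)) \<alpha> = 0 \<alpha>"
      proof (cases "Vector_Spaces.linear s (*) \<alpha>")
        case True
        then obtain y where y: "\<alpha> = form y" using linear_form_eq by blast
        have "\<psi> (vz y) = (\<Sum>J\<in>Jdx. c J * mon J \<alpha>)"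
          by (subst \<psi>_sum) (auto simp: vz_def y mult.commute)
        then show ?thesis using \<psi>z by (simp add: sum_fun_apply fscale_def)
      qed (simp add: sum_fun_apply fscale_def mon_nonlinear)
    qed
    then have "\<Phi> (\<Sum>J\<in>Jdx. fscale (c J) (mon J)) = 0"
      using linear_form_sum [OF \<Phi>, of "\<lambda>_. 0" "\<lambda>_. 0" "{}"] by simp
    then have "(\<Sum>J\<in>Jdx. c J * \<Phi> (mon J)) = 0" by (simp add: linear_form_sum [OF \<Phi>])
    moreover have "\<psi> v0 = (\<Sum>J\<in>Jdx. c J * \<Phi> (mon J))"
      by (subst \<psi>_sum) (auto simp: v0_def mult.commute)
    ultimately show False using \<psi>(2) by auto
  qed
  then obtain S r where S: "finite S" "S \<subseteq> range vz" "v0 = (\<Sum>a\<in>S. fscale (r a) a)"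
    unfolding fs.span_explicit by auto
  then obtain Z where Z: "S = vz ` Z" "inj_on vz Z" using subset_image_inj by metis
  then have "finite Z" using S(1) by (simp add: finite_image_iff)
  moreover have "\<Phi> (mon J) = (\<Sum>z\<in>Z. r (vz z) * mon J (form z))" if "J \<in> Jdx" for J
  proof -
    have "v0 J = (\<Sum>z\<in>Z. r (vz z) * vz z J)"
      using S(3) Z by (simp add: sum.reindex sum_fun_apply fscale_def)
    then show ?thesis using that by (simp add: v0_def vz_def)
  qed
  ultimately show ?thesis by (intro exI [of _ Z] exI [of _ "\<lambda>z. r (vz z)"]) auto
qed

text \<open>Every value of \<open>F\<close> is a combination of products of evaluations, and
  averaging over the permutations of the \<open>n\<close> factors turns the coefficients into values
  of \<open>polar F\<close>. Consequently identities in \<open>M\<close> can be checked on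
  polynomial functions.\<close>

lemma polar_inject:
  assumes "F \<in> M" and zero: "\<And>x. polar F x = 0"
  shows "F = 0"
proof
  fix \<Phi>
  obtain T where T: "F = (\<Sum>I\<in>Idx. fscale (T I) (mon2 I))" using M_expand assms by blast
  show "F \<Phi> = 0 \<Phi>"
  proof (cases "Vector_Spaces.linear fscale (*) \<Phi>")
    case False
    then show ?thesis by (simp add: T sum_fun_apply fscale_def mon2_def sym_prod_def)
  next
    case True
    obtain Z a where Z: "finite Z" "\<forall>J\<in>Jdx. \<Phi> (mon J) = (\<Sum>z\<in>Z. a z * mon J (form z))"
      using linear_form_evaluations [OF True] by (elim exE conjE) (rule that)
    let ?P = "PiE {..<n} (\<lambda>_. Z)"
    let ?S = "{\<sigma>. \<sigma> permutes {..<n}}"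
    define w where "w \<phi> = (\<Sum>I\<in>Idx. T I * (\<Prod>i<n. mon (I i) (form (\<phi> i))))" for \<phi>
    define A where "A \<phi> = (\<Prod>i<n. a (\<phi> i))" for \<phi>
    have "mon2 I \<Phi> = (\<Sum>\<phi>\<in>?P. A \<phi> * (\<Prod>i<n. mon (I i) (form (\<phi> i))))" if "I \<in> Idx" for I
    proof -
      have "mon2 I \<Phi> = (\<Prod>i<n. \<Sum>z\<in>Z. a z * mon (I i) (form z))"
        unfolding mon2_linear [OF True] using that Idx_Jdx by (intro prod.cong refl bspec [OF Z(2)]) auto
      also have "\<dots> = (\<Sum>\<phi>\<in>?P. \<Prod>i<n. a (\<phi> i) * mon (I i) (form (\<phi> i)))"
        using Z(1) by (intro prod_sum_PiE) auto
      finally show ?thesis by (simp add: A_def prod.distrib)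
    qed
    then have "F \<Phi> = (\<Sum>I\<in>Idx. \<Sum>\<phi>\<in>?P. A \<phi> * (T I * (\<Prod>i<n. mon (I i) (form (\<phi> i)))))"
      by (simp add: T sum_fun_apply fscale_def sum_distrib_left ac_simps)
    also have "\<dots> = (\<Sum>\<phi>\<in>?P. A \<phi> * w \<phi>)"
      by (subst sum.swap) (simp add: w_def sum_distrib_left)
    finally have F: "F \<Phi> = (\<Sum>\<phi>\<in>?P. A \<phi> * w \<phi>)" .
    \<comment> \<open>The symmetrized \<open>w\<close> is the polarization of \<open>F\<close> at
      the matrix with rows \<open>\<phi> i\<close>.\<close>
    have w0: "(\<Sum>\<sigma>\<in>?S. w (\<phi> \<circ> \<sigma>)) = 0" for \<phi>
    proof -
      have "(\<Sum>\<sigma>\<in>?S. w (\<phi> \<circ> \<sigma>)) = (\<Sum>\<sigma>\<in>?S. \<Sum>I\<in>Idx. T I * (\<Prod>i<n. \<Prod>j<d. \<phi> (\<sigma> i) (I i j)))"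
        unfolding w_def by (intro sum.cong refl arg_cong2 [where f = "(*)"] prod.cong) (auto simp: mon_form Idx_Jdx)
      also have "\<dots> = (\<Sum>I\<in>Idx. \<Sum>\<sigma>\<in>?S. T I * (\<Prod>i<n. \<Prod>j<d. \<phi> (\<sigma> i) (I i j)))"
        by (rule sum.swap)
      also have "\<dots> = polar F (\<lambda>(i, k). \<phi> i k)"
        by (simp add: polar_expand [OF T] sum_distrib_left)
      finally show ?thesis by (simp add: zero)
    qed
    \<comment> \<open>The weights \<open>A\<close> are symmetric, so \<open>w\<close> may be
      replaced by its permuted versions; their sum over all permutations is 0.\<close>
    have reindex: "(\<Sum>\<phi>\<in>?P. A \<phi> * w \<phi>) = (\<Sum>\<phi>\<in>?P. A \<phi> * w (\<phi> \<circ> \<sigma>))" if "\<sigma> \<in> ?S" for \<sigma>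
    proof -
      have \<sigma>: "\<sigma> permutes {..<n}" using that by simp
      then have inv: "inv \<sigma> permutes {..<n}" by (rule permutes_inv)
      have comp: "\<phi> \<circ> \<tau> \<in> ?P" if "\<phi> \<in> ?P" "\<tau> permutes {..<n}" for \<phi> \<tau>
        using that permutes_in_image [OF that(2)] permutes_not_in [OF that(2)]
        by (auto simp: PiE_def Pi_def extensional_def)
      have "(\<Sum>\<phi>\<in>?P. A (\<phi> \<circ> \<sigma>) * w (\<phi> \<circ> \<sigma>)) = (\<Sum>\<phi>\<in>?P. A \<phi> * w \<phi>)"
        by (rule sum.reindex_bij_witness [where i = "\<lambda>\<phi>. \<phi> \<circ> inv \<sigma>" and j = "\<lambda>\<phi>. \<phi> \<circ> \<sigma>"])
          (use comp [OF _ \<sigma>] comp [OF _ inv] in \<open>auto simp: o_assoc [symmetric] permutes_inv_o [OF \<sigma>]\<close>)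
      moreover have "A (\<phi> \<circ> \<sigma>) = A \<phi>" for \<phi>
        using prod.permute [OF \<sigma>, of "\<lambda>i. a (\<phi> i)"] by (simp add: A_def comp_def)
      ultimately show ?thesis by simp
    qed
    have "of_nat (card ?S) * F \<Phi> = (\<Sum>\<sigma>\<in>?S. F \<Phi>)" by simp
    also have "\<dots> = (\<Sum>\<sigma>\<in>?S. \<Sum>\<phi>\<in>?P. A \<phi> * w (\<phi> \<circ> \<sigma>))"
      unfolding F by (intro sum.cong refl reindex)
    also have "\<dots> = (\<Sum>\<phi>\<in>?P. A \<phi> * (\<Sum>\<sigma>\<in>?S. w (\<phi> \<circ> \<sigma>)))"
      by (subst sum.swap) (simp add: sum_distrib_left)
    also have "\<dots> = 0" by (simp add: w0)
    finally have "of_nat (card ?S) * F \<Phi> = 0" .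
    moreover have "card ?S = fact n" by (rule card_permutations) auto
    ultimately show ?thesis by simp
  qed
qed

end

section \<open>Highest weight vectors\<close>

context hwfun
begin

lemma unip_multi:
  assumes "c \<le> b" "b < D"
  shows "f (\<lambda>(r, k). if k = b then x (r, b) + (\<Sum>a<c. u a * x (r, a)) else x (r, k)) = f x"
  using assms(1)
proof (induction c)
  case 0
  have "(\<lambda>(r, k). if k = b then x (r, b) + (\<Sum>a<0. u a * x (r, a)) else x (r, k)) = x" by auto
  then show ?case by simp
next
  case (Suc c)
  let ?y = "\<lambda>(r, k). if k = b then x (r, b) + (\<Sum>a<c. u a * x (r, a)) else x (r, k)"
  have "(\<lambda>(r, k). if k = b then x (r, b) + (\<Sum>a<Suc c. u a * x (r, a)) else x (r, k)) = coladd c b (u c) ?y"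
    using Suc.prems by (auto simp: coladd_def fun_eq_iff)
  then show ?case using Suc assms(2) by (simp add: unip)
qed

text \<open>The columns are transformed from the last to the first: the new column \<open>b\<close>
  involves only earlier columns, which are still the original ones. In \<open>Y c\<close> the
  columns from \<open>c\<close> on are done.\<close>

lemma unip_matrix:
  assumes G: "\<And>k l. k < D \<Longrightarrow> l \<le> k \<Longrightarrow> G k l = (if k = l then 1 else 0)"
  shows "f (\<lambda>(r, l). \<Sum>k<D. x (r, k) * G k l) = f x"
proof -
  define z where "z = (\<lambda>(r, l). \<Sum>k<D. x (r, k) * G k l)"
  define Y where "Y c = (\<lambda>(r, l). if c \<le> l then z (r, l) else x (r, l))" for c
  have "f (Y (D - c)) = f x" if "c \<le> D" for c
    using that
  proof (induction c)
    case 0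
    show ?case by (rule polyfun_cong [OF poly]) (auto simp: Y_def)
  next
    case (Suc c)
    define b where "b = D - Suc c"
    have b: "b < D" "D - c = Suc b" using Suc.prems by (auto simp: b_def)
    let ?y = "Y (Suc b)"
    have "z (r, b) = x (r, b) + (\<Sum>a<b. G a b * x (r, a))" for r
    proof -
      have "z (r, b) = (\<Sum>k<Suc b. x (r, k) * G k b)"
        unfolding z_def prod.case by (rule sum.mono_neutral_right) (use b G in auto)
      also have "\<dots> = x (r, b) + (\<Sum>a<b. G a b * x (r, a))" using b G by (simp add: mult.commute)
      finally show ?thesis .
    qed
    then have "Y b = (\<lambda>(r, k). if k = b then ?y (r, b) + (\<Sum>a<b. G a b * ?y (r, a)) else ?y (r, k))"
      by (auto simp: Y_def fun_eq_iff)
    then have "f (Y b) = f ?y" using unip_multi [of b b ?y "\<lambda>a. G a b"] b(1) by simp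
    then show ?case using Suc b by (simp add: b_def)
  qed
  from this [of D] show ?thesis by (simp add: Y_def z_def case_prod_beta)
qed

end

context sym_power
begin

lemma act_M: "g \<in> GL s \<Longrightarrow> F \<in> M \<Longrightarrow> act g F \<in> M"
  using GL_module_M by (auto simp: GL_module_def)

lemma hwv_hwfun:
  assumes F: "F \<in> M" and hwv: "highest_weight_vector s fscale act es lam F"
  shows "hwfun n D d (padded_part lam) (polar F)"
proof
  show "polar F \<in> polyfun (grid n D)" by (rule polar_polyfun [OF F])
  show "polar F (rowscale c x) = (\<Prod>i<n. c i) ^ d * polar F x" for c x by (rule polar_rowscale [OF F])
  show "polar F (rowperm \<sigma> x) = polar F x" if "\<sigma> permutes {..<n}" for \<sigma> x by (rule polar_rowperm [OF F that])
next
  fix a b t x assume ab: "a < b" "b < D"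
  \<comment> \<open>A transvection that adds \<open>t\<close> times \<open>es ! a\<close> to
    \<open>es ! b\<close>. It is upper unitriangular because \<open>a < b\<close>, and on matrices
    it becomes \<open>coladd a b t\<close>.\<close>
  define g where "g = (\<lambda>t v. v + s (t * crd b v) (es ! a))"
  have ba: "crd b (es ! a) = 0" using ab by (simp add: crd_basis)
  have inv: "g t' (g t'' v) = v" if "t' + t'' = 0" for t' t'' v
  proof -
    have "g t' (g t'' v) = v + s ((t' + t'') * crd b v) (es ! a)"
      by (simp add: g_def crd_add crd_scale ba scale_left_distrib distrib_right add.assoc add.commute)
    then show ?thesis using that by simp
  qed
  have "Vector_Spaces.linear s s (g t)"
    by (simp add: Vector_Spaces.linear_iff vector_space_axioms g_def crd_add crd_scale
        distrib_left scale_left_distrib scale_right_distrib algebra_simps)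
  moreover have "g t \<circ> g (- t) = id" "g (- t) \<circ> g t = id" using inv by (auto simp: fun_eq_iff)
  ultimately have GL: "g t \<in> GL s" using o_bij by (auto simp: GL_def)
  have "g t (es ! j) - es ! j \<in> span (set (take j es))" if "j < D" for j
  proof (cases "j = b")
    case True
    then have "es ! a \<in> set (take j es)" using ab by (auto simp: in_set_conv_nth intro!: exI [of _ a])
    then show ?thesis by (simp add: g_def span_scale span_base)
  next
    case False
    then have "crd b (es ! j) = 0" using that ab by (simp add: crd_basis)
    then show ?thesis by (simp add: g_def span_zero)
  qed
  then have "act (g t) F = F" using hwv GL by (auto simp: highest_weight_vector_def)
  then have "polar F x = polar F (mat_act (g t) x)" using polar_act [OF GL, of F x] by simp
  also have "\<dots> = polar F (coladd a b t x)"
  proof (rule polar_cong [OF F])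
    fix i l assume "i < n" "l < D"
    have "mat_act (g t) x (i, l) = (\<Sum>k<D. (if k = l then x (i, k) else 0) + (if k = a then (if l = b then t * x (i, a) else 0) else 0))"
      unfolding mat_act_def prod.case
      by (rule sum.cong [OF refl]) (use ab \<open>l < D\<close> in \<open>auto simp: g_def crd_add crd_scale crd_basis\<close>)
    also have "\<dots> = coladd a b t x (i, l)"
      using ab \<open>l < D\<close> by (simp add: sum.distrib coladd_def)
    finally show "mat_act (g t) x (i, l) = coladd a b t x (i, l)" .
  qed
  finally show "polar F (coladd a b t x) = polar F x" by simp
next
  fix e :: "nat \<Rightarrow> complex" and x assume e: "\<And>k. k < D \<Longrightarrow> e k \<noteq> 0"
  define g where "g = gmat (\<lambda>k l. if k = l then e l else 0)"
  have GL: "g \<in> GL s"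
    unfolding g_def
    by (rule gmat_GL [where H = "\<lambda>k l. if k = l then 1 / e l else 0"])
      (use e in \<open>auto simp: if_distrib [of "\<lambda>c. _ * c"] if_distrib [of "\<lambda>c. c * _"] cong: if_cong\<close>)
  have ge: "g (es ! l) = s (e l) (es ! l)" if "l < D" for l
  proof -
    have "g (es ! l) = (\<Sum>k<D. if k = l then s (e l) (es ! l) else 0)"
      unfolding g_def gmat_basis [OF that] by (rule sum.cong) auto
    then show ?thesis using that by simp
  qed
  then have "act g F = fscale (\<Prod>i<D. e i ^ padded_part lam i) F"
    using hwv GL by (auto simp: highest_weight_vector_def)
  then have "(\<Prod>k<D. e k ^ padded_part lam k) * polar F x = polar F (mat_act g x)"
    using polar_act [OF GL, of F x] by (simp add: polar_scale)
  also have "\<dots> = polar F (colscale e x)"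
  proof (rule polar_cong [OF F])
    fix i l assume "i < n" "l < D"
    have "mat_act g x (i, l) = (\<Sum>k<D. if k = l then e l * x (i, l) else 0)"
      unfolding mat_act_def prod.case
      by (rule sum.cong [OF refl]) (use \<open>l < D\<close> in \<open>auto simp: ge crd_scale crd_basis\<close>)
    then show "mat_act g x (i, l) = colscale e x (i, l)" using \<open>l < D\<close> by (simp add: colscale_def)
  qed
  finally show "polar F (colscale e x) = (\<Prod>k<D. e k ^ padded_part lam k) * polar F x" by simp
qed

text \<open>Injectivity of \<open>polar\<close> on \<open>M\<close> allows both conditions on
  \<open>F\<close> to be checked after polarization, where an upper unitriangular \<open>g\<close>
  is covered by \<open>unip_matrix\<close>.\<close>

lemma hwfun_hwv:
  assumes F: "F \<in> M" "F \<noteq> 0" and hw: "hwfun n D d (padded_part lam) (polar F)"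
  shows "highest_weight_vector s fscale act es lam F"
  unfolding highest_weight_vector_def
proof (intro conjI ballI allI impI)
  interpret hwfun n D d "padded_part lam" "polar F" by (rule hw)
  show "F \<noteq> 0" by fact
  fix g assume g: "g \<in> GL s"
  then have lin: "Vector_Spaces.linear s s g" and "bij g" by (auto simp: GL_def)
  {
    assume uni: "\<forall>j<D. g (es ! j) - es ! j \<in> span (set (take j es))"
    have "polar (act g F - F) x = 0" for x
    proof -
      have "crd k (g (es ! l)) = (if k = l then 1 else 0)" if "k < D" "l \<le> k" for k l
      proof -
        have "subspace {v. crd k v = 0}"
          using crd_scale [of k 0 0] by (auto simp: subspace_def crd_add crd_scale)
        moreover have "set (take l es) \<subseteq> {v. crd k v = 0}"
          using that by (auto simp: in_set_conv_nth crd_basis)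
        ultimately have "span (set (take l es)) \<subseteq> {v. crd k v = 0}" by (intro span_minimal)
        moreover have "g (es ! l) - es ! l \<in> span (set (take l es))" using uni that by simp
        ultimately have "crd k (g (es ! l) - es ! l) = 0" by blast
        then have "crd k (g (es ! l)) = crd k (es ! l)"
          using crd_add [of k "g (es ! l) - es ! l" "es ! l"] by simp
        then show ?thesis using that by (simp add: crd_basis)
      qed
      then have "polar F (\<lambda>(r, l). \<Sum>k<D. x (r, k) * crd k (g (es ! l))) = polar F x"
        by (rule unip_matrix)
      then show ?thesis using polar_act [OF g, of F x] by (simp add: polar_diff mat_act_def)
    qed
    then have "act g F - F = 0"
      using act_M [OF g F(1)] F(1) fs.subspace_diff [OF subspace_M] by (intro polar_inject) auto
    then show "act g F = F" by simp
  next
    fix c assume c: "\<forall>i<D. g (es ! i) = s (c i) (es ! i)"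
    \<comment> \<open>\<open>col\<close> asks for nonzero factors; bijectivity of \<open>g\<close>
      provides them.\<close>
    have c0: "c i \<noteq> 0" if "i < D" for i
    proof
      assume "c i = 0"
      then have "g (es ! i) = 0" using c that by simp
      also have "0 = g 0" using module_hom.zero [OF module_hom_linearI [OF lin]] by simp
      finally have "es ! i = 0" using \<open>bij g\<close> by (metis bij_pointE)
      then have "crd i (es ! i) = 0" using crd_scale [of i 0 0] by simp
      then show False using that by (simp add: crd_basis)
    qed
    let ?\<chi> = "\<Prod>i<D. c i ^ padded_part lam i"
    have "polar (act g F - fscale ?\<chi> F) x = 0" for x
    proof -
      have "polar F (mat_act g x) = polar F (colscale c x)"
      proof (rule polar_cong [OF F(1)])
        fix i l assume "i < n" "l < D"
        have "mat_act g x (i, l) = (\<Sum>k<D. if k = l then c l * x (i, l) else 0)"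
          unfolding mat_act_def prod.case
          by (rule sum.cong [OF refl]) (use \<open>l < D\<close> c in \<open>auto simp: crd_scale crd_basis\<close>)
        then show "mat_act g x (i, l) = colscale c x (i, l)" using \<open>l < D\<close> by (simp add: colscale_def)
      qed
      then show ?thesis using polar_act [OF g, of F x] c0 by (simp add: polar_diff polar_scale col)
    qed
    then have "act g F - fscale ?\<chi> F = 0"
      using act_M [OF g F(1)] F(1) fs.subspace_diff [OF subspace_M] fs.subspace_scale [OF subspace_M]
      by (intro polar_inject) auto
    then show "act g F = fscale ?\<chi> F" by simp
  }
qed

text \<open>\<open>is_Schur_module\<close> admits any ordered basis. The group element that carries
  \<open>es'\<close> to \<open>es\<close> translates polarizations with respect to
  \<open>es'\<close> into polarizations with respect to \<open>es\<close>.\<close>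

lemma change_of_basis:
  assumes "ordered_basis s es'" "length es' = length es"
  shows "\<exists>g\<in>GL s. \<forall>F x. polar (act g F) x = sym_power.polar s es' n F x"
proof -
  interpret B: sym_power s es' n d by unfold_locales (rule assms)
  define g where "g v = (\<Sum>l<D. s (B.crd l v) (es ! l))" for v
  define h where "h v = (\<Sum>l<D. s (crd l v) (es' ! l))" for v
  have lg: "Vector_Spaces.linear s s g"
    by (simp add: Vector_Spaces.linear_iff vector_space_axioms g_def B.crd_add B.crd_scale
        scale_left_distrib sum.distrib scale_sum_right)
  have gb: "g (es' ! l) = es ! l" if "l < D" for l
  proof -
    have "g (es' ! l) = (\<Sum>k<D. if k = l then es ! l else 0)"
      unfolding g_def by (rule sum.cong) (use that assms in \<open>auto simp: B.crd_basis\<close>)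
    then show ?thesis using that by simp
  qed
  have hb: "h (es ! l) = es' ! l" if "l < D" for l
  proof -
    have "h (es ! l) = (\<Sum>k<D. if k = l then es' ! l else 0)"
      unfolding h_def by (rule sum.cong) (use that in \<open>auto simp: crd_basis\<close>)
    then show ?thesis using that by simp
  qed
  have lh: "Vector_Spaces.linear s s h"
    by (simp add: Vector_Spaces.linear_iff vector_space_axioms h_def crd_add crd_scale
        scale_left_distrib sum.distrib scale_sum_right)
  have "g (h v) = v" for v
  proof -
    interpret Vector_Spaces.linear s s g by (rule lg)
    have "g (h v) = (\<Sum>l<D. s (crd l v) (es ! l))" by (simp add: h_def sum scale gb)
    then show ?thesis by (simp only: crd_expand [symmetric])
  qed
  moreover have "h (g v) = v" for v
  proof -
    interpret Vector_Spaces.linear s s h by (rule lh)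
    have "h (g v) = (\<Sum>l<D. s (B.crd l v) (es' ! l))" by (simp add: g_def sum scale hb)
    then show ?thesis using B.crd_expand [of v] assms(2) by simp
  qed
  ultimately have GL: "g \<in> GL s" using lg o_bij [of h g] by (auto simp: GL_def fun_eq_iff)
  have "form y \<circ> g = B.form y" for y
  proof -
    have "Vector_Spaces.linear s (*) (form y \<circ> g)" using lg linear_form by (rule Vector_Spaces.linear_compose)
    then have eq: "form y \<circ> g = B.form (\<lambda>k. (form y \<circ> g) (es' ! k))" by (rule B.linear_form_eq)
    also have "\<dots> = B.form y"
      unfolding B.form_def by (intro ext sum.cong) (use assms(2) gb form_basis in auto)
    finally show ?thesis .
  qed
  then have "ev S x \<circ> Sym_map g = B.ev S x" for S x
    by (auto simp: ev_def B.ev_def Sym_map_def)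
  then have "polar (act g F) x = B.polar F x" for F x
    by (simp add: polar_def B.polar_def act_def Sym_map_def)
  then show ?thesis using GL by blast
qed

end

context sym_power
begin

text \<open>A monomial of degree \<open>d\<close> in every row is lifted to the product
  \<open>mon2 I\<close> with the same indices, whose polarization is its row symmetrization.\<close>

lemma rowpoly_polar:
  assumes "p \<in> rowpoly n D (\<lambda>_. d)"
  shows "\<exists>F\<in>M. \<forall>x. polar F x = (\<Sum>\<sigma> | \<sigma> permutes {..<n}. p (rowperm \<sigma> x))"
  using assms
proof induction
  case (mono ws)
  define I where "I = restrict (\<lambda>i. restrict (\<lambda>j. ws i ! j) {..<d}) {..<n}"
  have "ws i ! j < D" if "i < n" "j < d" for i j
    using mono [OF that(1)] that(2) nth_mem [of j "ws i"] by (metis lessThan_iff subsetD)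
  then have I: "I \<in> Idx" by (auto simp: I_def Idx_def Jdx_def)
  have "(\<Prod>k\<leftarrow>ws i. x (\<sigma> i, k)) = (\<Prod>j<d. x (\<sigma> i, I i j))" if "i < n" for i and x :: "nat \<times> nat \<Rightarrow> complex" and \<sigma>
    using mono [OF that] that by (simp add: prod.list_conv_set_nth I_def flip: atLeast0LessThan)
  then have "polar (mon2 I) x = (\<Sum>\<sigma> | \<sigma> permutes {..<n}. mono_fun n ws (rowperm \<sigma> x))" for x
    by (simp add: polar_mon2 [OF I] mono_fun_def rowperm_def)
  then show ?case using mon2_M by blast
next
  case zero
  show ?case
    by (intro bexI [of _ 0] allI fs.subspace_0 [OF subspace_M]) (simp only: polar_zero sum.neutral_const)
next
  case (add p q)
  obtain F where F: "F \<in> M" "\<forall>x. polar F x = (\<Sum>\<sigma> | \<sigma> permutes {..<n}. p (rowperm \<sigma> x))"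
    using add.IH(1) by (elim bexE) (rule that)
  obtain G where G: "G \<in> M" "\<forall>x. polar G x = (\<Sum>\<sigma> | \<sigma> permutes {..<n}. q (rowperm \<sigma> x))"
    using add.IH(2) by (elim bexE) (rule that)
  show ?case
    by (intro bexI [of _ "F + G"] allI fs.subspace_add [OF subspace_M] F(1) G(1))
      (simp only: polar_add sum.distrib F(2) G(2))
next
  case (cmult p c)
  obtain F where F: "F \<in> M" "\<forall>x. polar F x = (\<Sum>\<sigma> | \<sigma> permutes {..<n}. p (rowperm \<sigma> x))"
    using cmult.IH by (elim bexE) (rule that)
  show ?case
    by (intro bexI [of _ "fscale c F"] allI fs.subspace_scale [OF subspace_M] F(1))
      (simp only: polar_scale sum_distrib_left F(2))
qed

end

section \<open>Multiplicity and minimality\<close>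

locale min_sym_power = sym_power s es n "n + 1"
  for s :: "complex \<Rightarrow> 'v \<Rightarrow> 'v :: ab_group_add" and es and n +
  assumes n: "even n" "1 \<le> n" "n \<le> length es"
begin

abbreviation lam :: "nat list" where "lam \<equiv> replicate (n - 1) (n + 2) @ [2]"

lemma padded_part_lam: "padded_part lam = min_weight n"
  using n by (auto simp: fun_eq_iff padded_part_def min_weight_def nth_append)

text \<open>\<open>min_hwf n\<close> is already symmetric in the rows, so symmetrization only
  multiplies it by \<open>fact n\<close>.\<close>

lemma min_hwv_exists: "\<exists>F\<in>M. \<forall>x. polar F x = min_hwf n x"
proof -
  obtain F where F: "F \<in> M" "\<forall>x. polar F x = (\<Sum>\<sigma> | \<sigma> permutes {..<n}. min_hwf n (rowperm \<sigma> x))"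
    using rowpoly_polar [OF rowpoly_min_hwf [OF n(3)]] by (elim bexE) (rule that)
  have "polar F x = fact n * min_hwf n x" for x
  proof -
    have "polar F x = (\<Sum>\<sigma> | \<sigma> permutes {..<n}. min_hwf n x)"
      unfolding F(2) [rule_format] using min_hwf_rowperm n(1) by (intro sum.cong) auto
    also have "\<dots> = of_nat (card {\<sigma>. \<sigma> permutes {..<n}}) * min_hwf n x" by simp
    also have "card {\<sigma>. \<sigma> permutes {..<n}} = fact n" by (rule card_permutations) auto
    finally show ?thesis by simp
  qed
  then have "polar (fscale (1 / fact n) F) x = min_hwf n x" for x by (simp add: polar_scale)
  then show ?thesis using fs.subspace_scale [OF subspace_M F(1)] by blast
qed

definition F0 where "F0 = (SOME F. F \<in> M \<and> (\<forall>x. polar F x = min_hwf n x))"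

lemma F0: "F0 \<in> M" "polar F0 x = min_hwf n x"
proof -
  have "\<exists>F. F \<in> M \<and> (\<forall>x. polar F x = min_hwf n x)" using min_hwv_exists by blast
  from someI_ex [OF this] show "F0 \<in> M" "polar F0 x = min_hwf n x" by (auto simp: F0_def)
qed

lemma F0_nonzero: "F0 \<noteq> 0"
  using F0(2) [of "base_matrix n"] min_hwf_base_matrix [OF n(2)] polar_zero by force

lemma hwfun_F0: "hwfun n D (n + 1) (min_weight n) (polar F0)"
proof -
  have "polar F0 = min_hwf n" using F0(2) by auto
  then show ?thesis using hwfun_min_hwf [OF n] by simp
qed

lemma hwv_F0: "highest_weight_vector s fscale act es lam F0"
  by (rule hwfun_hwv [OF F0(1) F0_nonzero]) (simp only: padded_part_lam hwfun_F0)

lemma hwfun_multiple_F0: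
  assumes "F \<in> M" "hwfun n D (n + 1) (min_weight n) (polar F)"
  shows "\<exists>c. F = fscale c F0"
proof -
  define c where "c = polar F (base_matrix n) / min_hwf n (base_matrix n)"
  have "polar F x = c * polar F0 x" for x
    using hwfun_min_weight_unique [OF assms(2) hwfun_F0 n(2,3), of x] min_hwf_base_matrix [OF n(2)]
    by (simp add: c_def F0(2) field_simps)
  then have "polar (F - fscale c F0) x = 0" for x by (simp add: polar_diff polar_scale)
  then have "F - fscale c F0 = 0"
    using assms(1) F0(1) fs.subspace_diff [OF subspace_M] fs.subspace_scale [OF subspace_M]
    by (intro polar_inject) auto
  then show ?thesis by auto
qed

lemma hwv_multiple_F0:
  assumes "F \<in> M" "highest_weight_vector s fscale act es lam F"
  shows "\<exists>c. F = fscale c F0"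
  using hwv_hwfun [OF assms] by (intro hwfun_multiple_F0 assms(1)) (simp only: padded_part_lam)

lemma length_basis: "ordered_basis s es' \<Longrightarrow> length es' = length es"
proof -
  assume "ordered_basis s es'"
  then have "distinct es'" "independent (set es')" "span (set es') = UNIV"
    by (auto simp: ordered_basis_def)
  then have "dim (UNIV :: 'v set) = length es'"
    using dim_span_eq_card_independent [of "set es'"] by (simp add: distinct_card)
  moreover have "dim (UNIV :: 'v set) = length es"
    using basis dim_span_eq_card_independent [of "set es"] by (simp add: distinct_card)
  ultimately show ?thesis by simp
qed

text \<open>Replaces an isomorphism type by membership of one vector. A highest weight vector in
  \<open>N\<close> for another basis is moved by a group element to a nonzero multiple of
  \<open>F0\<close>, and \<open>N\<close> is invariant.\<close>

lemma Schur_iff_F0: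
  assumes N: "GL_irreducible s fscale act N" "N \<subseteq> M"
  shows "is_Schur_module s fscale act lam N \<longleftrightarrow> F0 \<in> N"
proof
  assume "F0 \<in> N"
  have "polynomial_GL_module s fscale act N"
    using N by (intro polynomial_submodule) (auto simp: GL_irreducible_def)
  moreover have "length lam \<le> length es" using n by simp
  ultimately show "is_Schur_module s fscale act lam N"
    unfolding is_Schur_module_def using N(1) ob hwv_F0 \<open>F0 \<in> N\<close> by blast
next
  assume "is_Schur_module s fscale act lam N"
  then obtain es' F where es': "ordered_basis s es'" and F: "F \<in> N"
    "highest_weight_vector s fscale act es' lam F"
    unfolding is_Schur_module_def by blast
  interpret B: sym_power s es' n "n + 1" by unfold_locales (rule es')
  note len = length_basis [OF es']
  obtain g where g: "g \<in> GL s" "\<And>F x. polar (act g F) x = B.polar F x"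
    using change_of_basis [OF es' len] by blast
  have MF: "F \<in> M" using F N by blast
  have "hwfun n D (n + 1) (min_weight n) (B.polar F)"
    using B.hwv_hwfun [OF MF F(2)] by (simp only: padded_part_lam len)
  moreover have "B.polar F = polar (act g F)" using g(2) by auto
  ultimately obtain c where c: "act g F = fscale c F0"
    using hwfun_multiple_F0 [OF act_M [OF g(1) MF]] by auto
  have mod: "GL_module s fscale act N" using N by (simp add: GL_irreducible_def)
  then have gN: "act g F \<in> N" using g(1) F(1) by (auto simp: GL_module_def)
  have "c \<noteq> 0"
  proof
    assume "c = 0"
    then have "polar (act g F) x = 0" for x by (simp add: c polar_zero)
    then have "B.polar F x = 0" for x using g(2) by simp
    then have "F = 0" by (rule B.polar_inject [OF MF])
    then show False using F(2) by (simp add: highest_weight_vector_def)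
  qed
  then have "F0 = fscale (1 / c) (act g F)" by (simp add: c fscale_def)
  moreover have "fscale (1 / c) (act g F) \<in> N" using mod gN by (auto simp: GL_module_def fs.subspace_scale)
  ultimately show "F0 \<in> N" by simp
qed

text \<open>Every nonzero component of \<open>F0\<close> in the decomposition is a highest weight
  vector of the same weight, hence a multiple of \<open>F0\<close>; so \<open>F0\<close> lies in a
  summand, and by independence in only one.\<close>

lemma Schur_summand_unique:
  assumes dec: "irreducible_decomposition s fscale act M \<D>"
  shows "card {N \<in> \<D>. is_Schur_module s fscale act lam N} = 1"
proof -
  note D = dec [unfolded irreducible_decomposition_def]
  have fin: "finite \<D>" using D by (rule conjunct1)
  have irr: "GL_irreducible s fscale act N" if "N \<in> \<D>" for N
    using D [THEN conjunct2, THEN conjunct1] that by (rule bspec)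
  have sp: "fs.span (\<Union>\<D>) = M" by (rule D [THEN conjunct2, THEN conjunct2, THEN conjunct1])
  have ind: "\<forall>N\<in>\<D>. f N = 0" if "\<forall>N\<in>\<D>. f N \<in> N" "(\<Sum>N\<in>\<D>. f N) = 0" for f
    by (rule D [THEN conjunct2, THEN conjunct2, THEN conjunct2, THEN spec, THEN mp]) (intro conjI that)
  have mod: "GL_module s fscale act N" if "N \<in> \<D>" for N using irr that by (auto simp: GL_irreducible_def)
  have sub: "fs.subspace N" if "N \<in> \<D>" for N using mod that by (auto simp: GL_module_def)
  have NM: "N \<subseteq> M" if "N \<in> \<D>" for N using sp fs.span_superset that by blast
  obtain f where f: "\<forall>N\<in>\<D>. f N \<in> N" "F0 = (\<Sum>N\<in>\<D>. f N)"
    using fs.span_Union_sum [OF fin sub, of F0] F0(1) sp by auto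
  \<comment> \<open>Components are unique and summands invariant, so an eigenvector relation for
    \<open>F0\<close> holds for each component separately.\<close>
  have stable: "act g (f N) = fscale c (f N)" if g: "g \<in> GL s" and c: "act g F0 = fscale c F0" and N: "N \<in> \<D>" for g c N
  proof -
    define h where "h K = act g (f K) - fscale c (f K)" for K
    have 1: "h K \<in> K" if "K \<in> \<D>" for K
      using that f(1) g mod [OF that] sub [OF that]
      by (auto simp: h_def GL_module_def intro!: fs.subspace_diff fs.subspace_scale)
    have "(\<Sum>K\<in>\<D>. h K) = act g F0 - fscale c F0"
      unfolding h_def sum_subtractf act_sum [symmetric] fs.scale_sum_right [symmetric] f(2) [symmetric] ..
    then have "(\<Sum>K\<in>\<D>. h K) = 0" unfolding c by (rule trans) (rule diff_self)
    from ind [OF ballI [OF 1] this] N have "h N = 0" by (rule bspec)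
    then show ?thesis by (simp add: h_def)
  qed
  have F0_N: "F0 \<in> N" if N: "N \<in> \<D>" and nz: "f N \<noteq> 0" for N
  proof -
    have "highest_weight_vector s fscale act es lam (f N)"
      unfolding highest_weight_vector_def
    proof (intro conjI ballI allI impI nz)
      fix g assume g: "g \<in> GL s" "\<forall>j<D. g (es ! j) - es ! j \<in> span (set (take j es))"
      then have "act g F0 = fscale 1 F0" using hwv_F0 by (simp add: highest_weight_vector_def)
      then show "act g (f N) = f N" using stable [OF g(1) _ N, of 1] by simp
    next
      fix g c assume g: "g \<in> GL s" "\<forall>i<D. g (es ! i) = s (c i) (es ! i)"
      then have "act g F0 = fscale (\<Prod>i<D. c i ^ padded_part lam i) F0"
        using hwv_F0 unfolding highest_weight_vector_def by blast
      then show "act g (f N) = fscale (\<Prod>i<D. c i ^ padded_part lam i) (f N)" by (rule stable [OF g(1) _ N])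
    qed
    moreover have "f N \<in> M" using f(1) N NM by blast
    ultimately obtain c where c: "f N = fscale c F0" using hwv_multiple_F0 by blast
    with nz have "c \<noteq> 0" by auto
    then have "F0 = fscale (1 / c) (f N)" by (simp add: c)
    also have "\<dots> \<in> N" using f(1) N sub fs.subspace_scale by blast
    finally show ?thesis .
  qed
  have "\<exists>N\<in>\<D>. f N \<noteq> 0"
  proof (rule ccontr)
    assume "\<not> (\<exists>N\<in>\<D>. f N \<noteq> 0)"
    then have "F0 = 0" unfolding f(2) by (intro sum.neutral) auto
    then show False using F0_nonzero by simp
  qed
  then obtain N where N: "N \<in> \<D>" "F0 \<in> N" using F0_N by blast
  have uniq: "K = N" if K: "K \<in> \<D>" "F0 \<in> K" for K
  proof (rule ccontr)
    assume "K \<noteq> N"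
    \<comment> \<open>\<open>F0\<close> in one summand and \<open>- F0\<close> in the other would be
      a nontrivial representation of 0.\<close>
    define h where "h L = (if L = K then F0 else 0) - (if L = N then F0 else 0)" for L
    have 1: "h L \<in> L" if "L \<in> \<D>" for L
      using that N K sub [OF that] by (auto simp: h_def fs.subspace_0 fs.subspace_neg)
    have "(\<Sum>L\<in>\<D>. h L) = 0"
      unfolding h_def sum_subtractf using fin N K by simp
    from ind [OF ballI [OF 1] this] K(1) have "h K = 0" by (rule bspec)
    then show False using \<open>K \<noteq> N\<close> F0_nonzero by (simp add: h_def)
  qed
  define S where "S = is_Schur_module s fscale act lam"
  have S: "S K \<longleftrightarrow> F0 \<in> K" if "K \<in> \<D>" for K
    unfolding S_def by (rule Schur_iff_F0 [OF irr [OF that] NM [OF that]])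
  have "{K \<in> \<D>. S K} = {N}" using N S uniq by blast
  then have "card {K \<in> \<D>. S K} = 1" by simp
  then show ?thesis unfolding S_def .
qed

text \<open>If the first part of \<open>mu\<close> exceeds \<open>n + 2\<close>, the comparison is
  decided there. Otherwise the Casimir argument forces the weight, and \<open>mu = lam\<close>
  contradicts the hypothesis.\<close>

lemma weight_bound:
  assumes mu: "is_partition mu" "occurs_in s fscale act M mu" "mu \<noteq> lam"
  shows "lex_less lam mu"
proof -
  obtain \<D> N where dec: "irreducible_decomposition s fscale act M \<D>" "N \<in> \<D>"
    and "is_Schur_module s fscale act mu N"
    using mu(2) unfolding occurs_in_def by blast
  then obtain es' F where es': "ordered_basis s es'" "length mu \<le> length es'" and F: "F \<in> N"
    "highest_weight_vector s fscale act es' mu F"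
    unfolding is_Schur_module_def by blast
  interpret B: sym_power s es' n "n + 1" by unfold_locales (rule es'(1))
  have len: "length es' = length es" by (rule length_basis [OF es'(1)])
  have sp: "fs.span (\<Union>\<D>) = M" using dec(1) unfolding irreducible_decomposition_def by (elim conjE)
  have "N \<subseteq> M"
    unfolding sp [symmetric] by (rule subset_trans [OF Union_upper [OF dec(2)] fs.span_superset])
  then have "F \<in> B.M" using F(1) by blast
  then interpret hwfun n D "n + 1" "padded_part mu" "B.polar F"
    using B.hwv_hwfun [OF _ F(2)] by (simp only: len)
  have "\<exists>x. B.polar F x \<noteq> 0"
    using B.polar_inject [OF \<open>F \<in> B.M\<close>] F(2) by (auto simp: highest_weight_vector_def)
  then obtain x where x: "B.polar F x \<noteq> 0" ..
  have anti: "padded_part mu b \<le> padded_part mu a" if "a \<le> b" for a b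
    using mu(1) that sorted_wrt_nth_less [of "(\<ge>)" mu a b]
    by (cases "a = b") (auto simp: padded_part_def is_partition_def)
  show ?thesis
  proof (cases "padded_part mu 0 \<le> n + 2")
    case True
    have eq: "padded_part mu k = padded_part lam k" for k
    proof (cases "k < D")
      case True
      have "padded_part mu k = min_weight n k"
        by (rule weight_eq_min_weight [OF n refl anti \<open>padded_part mu 0 \<le> n + 2\<close> x True])
      then show ?thesis by (simp only: padded_part_lam)
    next
      case False
      then show ?thesis using es'(2) len n by (simp add: padded_part_def)
    qed
    \<comment> \<open>Partitions have no zero parts, so the padded sequence determines the length
      and thereby the list.\<close>
    have pos: "padded_part nu k \<noteq> 0 \<longleftrightarrow> k < length nu" if "0 \<notin> set nu" for nu k
    proof -
      have "nu ! k \<noteq> 0" if "k < length nu" using nth_mem [OF that] \<open>0 \<notin> set nu\<close> by metis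
      then show ?thesis by (simp add: padded_part_def)
    qed
    have "k < length mu \<longleftrightarrow> k < length lam" for k
      using pos [of mu k] pos [of lam k] mu(1) eq [of k] by (auto simp: is_partition_def)
    then have len': "length mu = length lam" by (metis linorder_neq_iff)
    have nth: "padded_part nu i = nu ! i" if "i < length nu" for nu i
      by (simp add: padded_part_def that)
    have "mu = lam"
    proof (rule nth_equalityI [OF len'])
      fix i assume i: "i < length mu"
      then have "mu ! i = padded_part mu i" by (rule nth [symmetric])
      also have "\<dots> = padded_part lam i" by (rule eq)
      also have "\<dots> = lam ! i" using i unfolding len' by (rule nth)
      finally show "mu ! i = lam ! i" .
    qed
    then show ?thesis using mu(3) by simp
  next
    case False
    moreover have "padded_part lam 0 = n + 2"
      using n by (simp only: padded_part_lam) (auto simp: min_weight_def)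
    ultimately show ?thesis by (auto simp: lex_less_def intro!: exI [of _ 0])
  qed
qed

end

lemma ordered_basis_exists:
  assumes "finite_dimensional_vector_space scale Basis"
  shows "\<exists>es. ordered_basis scale es \<and> length es = vector_space.dim scale UNIV"
proof -
  interpret finite_dimensional_vector_space scale Basis by fact
  obtain es where "set es = Basis" "distinct es" using finite_distinct_list [OF finite_Basis] by blast
  then show ?thesis
    using independent_Basis span_Basis by (auto simp: ordered_basis_def distinct_card [symmetric] intro!: exI [of _ es])
qed

theorem theorem6p3:
  fixes scale :: "complex \<Rightarrow> 'v \<Rightarrow> 'v::ab_group_add" and Basis :: "'v set" and m :: nat
  assumes "finite_dimensional_vector_space scale Basis"
    and "m \<ge> 1"
    and "vector_space.dim scale (UNIV :: 'v set) \<ge> 2 * m"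
  defines "M \<equiv> Sym fscale (2 * m) (Sym scale (2 * m + 1) (UNIV :: 'v set))"
    and "\<rho> \<equiv> (\<lambda>g :: 'v \<Rightarrow> 'v. Sym_map (Sym_map g))"
    and "lam \<equiv> replicate (2 * m - 1) (2 * m + 2) @ [2]"
  shows "has_multiplicity scale fscale \<rho> M lam 1 \<and>
    is_partition lam \<and> occurs_in scale fscale \<rho> M lam \<and>
    (\<forall>mu. is_partition mu \<and> occurs_in scale fscale \<rho> M mu \<and> mu \<noteq> lam \<longrightarrow> lex_less lam mu)"
proof -
  interpret V: finite_dimensional_vector_space scale Basis by fact
  obtain es where es: "ordered_basis scale es" "length es = V.dim UNIV"
    using ordered_basis_exists [OF assms(1)] by blast
  interpret P: min_sym_power scale es "2 * m"
    by unfold_locales (use es assms(2,3) in auto)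
  have M: "M = P.M" by (simp only: M_def P.M_def)
  have \<rho>: "\<rho> = P.act" by (simp add: \<rho>_def P.act_def fun_eq_iff)
  obtain \<D> where \<D>: "irreducible_decomposition scale fscale \<rho> M \<D>"
    using P.complete_reducibility unfolding M \<rho> by blast
  have card: "card {N \<in> \<D>. is_Schur_module scale fscale \<rho> lam N} = 1"
    if "irreducible_decomposition scale fscale \<rho> M \<D>" for \<D>
    using P.Schur_summand_unique that unfolding M \<rho> lam_def by blast
  have "{N \<in> \<D>. is_Schur_module scale fscale \<rho> lam N} \<noteq> {}" using card [OF \<D>] by fastforce
  then have "occurs_in scale fscale \<rho> M lam" using \<D> unfolding occurs_in_def by blast
  moreover have "has_multiplicity scale fscale \<rho> M lam 1"
    unfolding has_multiplicity_def using \<D> card by blast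
  moreover have "is_partition lam"
  proof -
    have "sorted_wrt (\<ge>) (replicate k c)" for k c :: nat by (induction k) auto
    then show ?thesis using assms(2) by (auto simp: is_partition_def lam_def sorted_wrt_append)
  qed
  moreover have "lex_less lam mu" if "is_partition mu" "occurs_in scale fscale \<rho> M mu" "mu \<noteq> lam" for mu
    using P.weight_bound that unfolding M \<rho> lam_def by blast
  ultimately show ?thesis by blast
qed

end
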